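(* Let $A$ be a finite-dimensional Hopf algebra and $V$ a finite-dimensional $A$-module. For all $x\in A$, $$\mathrm{Tr}_P(x)\,M_{V^*}=\sum_x\operatorname{tr}_V(x_{(2)})\,\mathrm{Tr}_P(x_{(1)}).$$ If $(V^* )^*\cong V$, then $\mathrm{Tr}_P(x)M_V=\sum_x\operatorname{tr}_{V^*}(x_{(2)})\mathrm{Tr}_P(x_{(1)})$; in particular for grouplike $g$, $\mathrm{Tr}_P(g)M_V=\operatorname{tr}_{V^*}(g)\mathrm{Tr}_P(g)$, and if $\Delta(x)=x\otimes y+z\otimes x$ with $y,z\ne0$ then $\mathrm{Tr}_P(x)M_V=\operatorname{tr}_{V^*}(y)\mathrm{Tr}_P(x)+\operatorname{tr}_{V^*}(x)\mathrm{Tr}_P(z)$.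
   Context: $A$ is a finite-dimensional Hopf algebra over an algebraically closed field with coproduct $\Delta(x)=\sum_x x_{(1)}\otimes x_{(2)}$. $S_1,\dots,S_m$ are the non-isomorphic simple $A$-modules and $P_1,\dots,P_m$ their projective covers. $M_W$ is the McKay matrix of a module $W$: $(i,j)$ entry $[S_i\otimes W:S_j]$ (composition multiplicity). $\operatorname{tr}_U(x)$ is the trace of $x$ on $U$, and $\mathrm{Tr}_P(x)=[\operatorname{tr}_{P_1}(x)\ \cdots\ \operatorname{tr}_{P_m}(x)]$ is a row vector. $V^*$ is the dual module. *)

theory Defs
  imports "Jordan_Normal_Form.Matrix" "HOL-Computational_Algebra.Polynomial"
begin

text \<open>A Hopf algebra A of dimension d over the field 'k is given by a basis b_0,...,b_(d-1)
 and structure constants: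
  b_i b_j = sum_l mu i j l b_l;  1 = sum_l eta l b_l;
  Delta(b_i) = sum_(j,l) delta i j l b_j (x) b_l;  epsilon(b_i) = eps i;
  S(b_i) = sum_l anti i l b_l.
 Elements of A are coordinate vectors of dimension d; elements of A (x) A are
 d x d coefficient matrices.\<close>

record 'k hopf =
  hdim :: nat
  hmu :: "nat \<Rightarrow> nat \<Rightarrow> nat \<Rightarrow> 'k"
  heta :: "nat \<Rightarrow> 'k"
  hdelta :: "nat \<Rightarrow> nat \<Rightarrow> nat \<Rightarrow> 'k"
  heps :: "nat \<Rightarrow> 'k"
  hanti :: "nat \<Rightarrow> nat \<Rightarrow> 'k"

definition kdelta :: "nat \<Rightarrow> nat \<Rightarrow> 'k::field" where
  "kdelta i j = (if i = j then 1 else 0)"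

definition hopf_algebra :: "('k::field, 'z) hopf_scheme \<Rightarrow> bool" where
  "hopf_algebra H \<longleftrightarrow> (let d = hdim H; mu = hmu H; eta = heta H; dl = hdelta H;
       eps = heps H; s = hanti H in
    \<comment> \<open>associativity\<close>
    (\<forall>i<d. \<forall>j<d. \<forall>k<d. \<forall>l<d.
        (\<Sum>p<d. mu i j p * mu p k l) = (\<Sum>p<d. mu j k p * mu i p l)) \<and>
    \<comment> \<open>unit\<close>
    (\<forall>i<d. \<forall>l<d. (\<Sum>p<d. eta p * mu p i l) = kdelta i l \<and>
                 (\<Sum>p<d. eta p * mu i p l) = kdelta i l) \<and>
    \<comment> \<open>coassociativity\<close>
    (\<forall>i<d. \<forall>p<d. \<forall>q<d. \<forall>r<d.
        (\<Sum>j<d. dl i j r * dl j p q) = (\<Sum>l<d. dl i p l * dl l q r)) \<and>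
    \<comment> \<open>counit\<close>
    (\<forall>i<d. \<forall>l<d. (\<Sum>j<d. eps j * dl i j l) = kdelta i l \<and>
                 (\<Sum>j<d. dl i l j * eps j) = kdelta i l) \<and>
    \<comment> \<open>Delta is an algebra map\<close>
    (\<forall>i<d. \<forall>j<d. \<forall>p<d. \<forall>q<d.
        (\<Sum>l<d. mu i j l * dl l p q) =
        (\<Sum>a<d. \<Sum>b<d. \<Sum>c<d. \<Sum>e<d. dl i a b * dl j c e * mu a c p * mu b e q)) \<and>
    (\<forall>p<d. \<forall>q<d. (\<Sum>l<d. eta l * dl l p q) = eta p * eta q) \<and>
    \<comment> \<open>epsilon is an algebra map\<close>
    (\<forall>i<d. \<forall>j<d. (\<Sum>l<d. mu i j l * eps l) = eps i * eps j) \<and>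
    (\<Sum>l<d. eta l * eps l) = 1 \<and>
    \<comment> \<open>antipode axioms\<close>
    (\<forall>i<d. \<forall>q<d.
        (\<Sum>j<d. \<Sum>l<d. \<Sum>a<d. dl i j l * s j a * mu a l q) = eps i * eta q \<and>
        (\<Sum>j<d. \<Sum>l<d. \<Sum>a<d. dl i j l * s l a * mu j a q) = eps i * eta q))"

definition comult :: "('k::field, 'z) hopf_scheme \<Rightarrow> 'k vec \<Rightarrow> nat \<Rightarrow> nat \<Rightarrow> 'k" where
  "comult H x j l = (\<Sum>i<hdim H. x $ i * hdelta H i j l)"

definition algebraically_closed_field :: "'k::field itself \<Rightarrow> bool" where
  "algebraically_closed_field _ \<longleftrightarrow> (\<forall>p :: 'k poly. degree p > 0 \<longrightarrow> (\<exists>z. poly p z = 0))"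

text \<open>A module of dimension n is a pair (n, rho) where rho i is the n x n matrix
  by which the basis element b_i acts on k^n (column vectors).\<close>

type_synonym 'k rep = "nat \<times> (nat \<Rightarrow> 'k mat)"

definition rdim :: "'k rep \<Rightarrow> nat" where "rdim V = fst V"
definition ract :: "'k rep \<Rightarrow> nat \<Rightarrow> 'k mat" where "ract V = snd V"

definition lincomb :: "('k::field, 'z) hopf_scheme \<Rightarrow> 'k rep \<Rightarrow> (nat \<Rightarrow> 'k) \<Rightarrow> 'k mat" where
  "lincomb H V c = mat (rdim V) (rdim V) (\<lambda>(r, t). \<Sum>l<hdim H. c l * ract V l $$ (r, t))"

definition act :: "('k::field, 'z) hopf_scheme \<Rightarrow> 'k rep \<Rightarrow> 'k vec \<Rightarrow> 'k mat" where
  "act H V x = lincomb H V (\<lambda>i. x $ i)"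

definition is_module :: "('k::field, 'z) hopf_scheme \<Rightarrow> 'k rep \<Rightarrow> bool" where
  "is_module H V \<longleftrightarrow>
     (\<forall>i<hdim H. ract V i \<in> carrier_mat (rdim V) (rdim V)) \<and>
     (\<forall>i<hdim H. \<forall>j<hdim H. ract V i * ract V j = lincomb H V (hmu H i j)) \<and>
     lincomb H V (heta H) = 1\<^sub>m (rdim V)"

definition mtrace :: "'k::comm_ring_1 mat \<Rightarrow> 'k" where
  "mtrace M = (\<Sum>i<dim_row M. M $$ (i, i))"

definition tr :: "('k::field, 'z) hopf_scheme \<Rightarrow> 'k rep \<Rightarrow> 'k vec \<Rightarrow> 'k" where
  "tr H V x = mtrace (act H V x)"

text \<open>Tensor product V (x) W, with a.(v (x) w) = sum a_(1) v (x) a_(2) w;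
  the basis e_r (x) f_t of V (x) W is indexed by r * dim W + t.\<close>
definition tensor :: "('k::field, 'z) hopf_scheme \<Rightarrow> 'k rep \<Rightarrow> 'k rep \<Rightarrow> 'k rep" where
  "tensor H V W = (rdim V * rdim W, \<lambda>i. mat (rdim V * rdim W) (rdim V * rdim W)
     (\<lambda>(r, t). \<Sum>j<hdim H. \<Sum>l<hdim H. hdelta H i j l *
         (ract V j $$ (r div rdim W, t div rdim W)) * (ract W l $$ (r mod rdim W, t mod rdim W))))"

text \<open>Dual module V^*, with (a.f)(v) = f(S(a) v); in the dual basis a acts by the
  transpose of the matrix of S(a).\<close>
definition dual :: "('k::field, 'z) hopf_scheme \<Rightarrow> 'k rep \<Rightarrow> 'k rep" where
  "dual H V = (rdim V, \<lambda>i. mat (rdim V) (rdim V)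
     (\<lambda>(r, t). \<Sum>l<hdim H. hanti H i l * ract V l $$ (t, r)))"

definition hom :: "('k::field, 'z) hopf_scheme \<Rightarrow> 'k rep \<Rightarrow> 'k rep \<Rightarrow> 'k mat \<Rightarrow> bool" where
  "hom H V W F \<longleftrightarrow> F \<in> carrier_mat (rdim W) (rdim V) \<and>
     (\<forall>i<hdim H. F * ract V i = ract W i * F)"

definition surjective_map :: "'k::field rep \<Rightarrow> 'k rep \<Rightarrow> 'k mat \<Rightarrow> bool" where
  "surjective_map V W F \<longleftrightarrow> (\<forall>w\<in>carrier_vec (rdim W). \<exists>v\<in>carrier_vec (rdim V). F *\<^sub>v v = w)"

definition iso :: "('k::field, 'z) hopf_scheme \<Rightarrow> 'k rep \<Rightarrow> 'k rep \<Rightarrow> bool" where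
  "iso H V W \<longleftrightarrow> (\<exists>F G. hom H V W F \<and> hom H W V G \<and>
      F * G = 1\<^sub>m (rdim W) \<and> G * F = 1\<^sub>m (rdim V))"

definition submodule :: "('k::field, 'z) hopf_scheme \<Rightarrow> 'k rep \<Rightarrow> 'k vec set \<Rightarrow> bool" where
  "submodule H V U \<longleftrightarrow> U \<subseteq> carrier_vec (rdim V) \<and> 0\<^sub>v (rdim V) \<in> U \<and>
     (\<forall>u\<in>U. \<forall>w\<in>U. u + w \<in> U) \<and> (\<forall>c. \<forall>u\<in>U. c \<cdot>\<^sub>v u \<in> U) \<and>
     (\<forall>i<hdim H. \<forall>u\<in>U. ract V i *\<^sub>v u \<in> U)"

definition simple_module :: "('k::field, 'z) hopf_scheme \<Rightarrow> 'k rep \<Rightarrow> bool" where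
  "simple_module H V \<longleftrightarrow> is_module H V \<and> rdim V > 0 \<and>
     (\<forall>U. submodule H V U \<longrightarrow> U = {0\<^sub>v (rdim V)} \<or> U = carrier_vec (rdim V))"

definition comp_series :: "('k::field, 'z) hopf_scheme \<Rightarrow> 'k rep \<Rightarrow> 'k vec set list \<Rightarrow> bool" where
  "comp_series H V Us \<longleftrightarrow> Us \<noteq> [] \<and> hd Us = {0\<^sub>v (rdim V)} \<and> last Us = carrier_vec (rdim V) \<and>
     (\<forall>k<length Us. submodule H V (Us ! k)) \<and>
     (\<forall>k. Suc k < length Us \<longrightarrow> Us ! k \<subset> Us ! Suc k \<and>
        (\<forall>U. submodule H V U \<and> Us ! k \<subseteq> U \<and> U \<subseteq> Us ! Suc k \<longrightarrow>
             U = Us ! k \<or> U = Us ! Suc k))"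

text \<open>The subquotient U'/U of V is isomorphic to the module S: there is a surjective
  module map from U' onto S with kernel exactly U.\<close>
definition factor_iso :: "('k::field, 'z) hopf_scheme \<Rightarrow> 'k rep \<Rightarrow> 'k vec set \<Rightarrow> 'k vec set \<Rightarrow> 'k rep \<Rightarrow> bool" where
  "factor_iso H V U U' S \<longleftrightarrow> (\<exists>F \<in> carrier_mat (rdim S) (rdim V).
      (\<forall>u\<in>U'. \<forall>i<hdim H. F *\<^sub>v (ract V i *\<^sub>v u) = ract S i *\<^sub>v (F *\<^sub>v u)) \<and>
      (\<lambda>u. F *\<^sub>v u) ` U' = carrier_vec (rdim S) \<and>
      {u \<in> U'. F *\<^sub>v u = 0\<^sub>v (rdim S)} = U)"

text \<open>Composition multiplicity [W : S] (well defined by Jordan-Hoelder).\<close>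
definition comp_mult :: "('k::field, 'z) hopf_scheme \<Rightarrow> 'k rep \<Rightarrow> 'k rep \<Rightarrow> nat" where
  "comp_mult H W S = (let Us = (SOME Us. comp_series H W Us) in
     card {k. Suc k < length Us \<and> factor_iso H W (Us ! k) (Us ! Suc k) S})"

definition projective :: "('k::field, 'z) hopf_scheme \<Rightarrow> 'k rep \<Rightarrow> bool" where
  "projective H P \<longleftrightarrow> is_module H P \<and>
     (\<forall>M N f g. is_module H M \<longrightarrow> is_module H N \<longrightarrow> hom H M N f \<longrightarrow> surjective_map M N f \<longrightarrow>
        hom H P N g \<longrightarrow> (\<exists>h. hom H P M h \<and> f * h = g))"

definition projective_cover :: "('k::field, 'z) hopf_scheme \<Rightarrow> 'k rep \<Rightarrow> 'k rep \<Rightarrow> bool" where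
  "projective_cover H P S \<longleftrightarrow> projective H P \<and>
     (\<exists>p. hom H P S p \<and> surjective_map P S p \<and>
        (\<forall>U. submodule H P U \<longrightarrow>
            (\<forall>v\<in>carrier_vec (rdim P). \<exists>u\<in>U. \<exists>w\<in>carrier_vec (rdim P).
                p *\<^sub>v w = 0\<^sub>v (rdim S) \<and> v = u + w) \<longrightarrow>
            U = carrier_vec (rdim P)))"

definition mckay :: "('k::field, 'z) hopf_scheme \<Rightarrow> 'k rep list \<Rightarrow> 'k rep \<Rightarrow> 'k mat" where
  "mckay H Ss W = mat (length Ss) (length Ss)
     (\<lambda>(i, j). of_nat (comp_mult H (tensor H (Ss ! i) W) (Ss ! j)))"

definition TrP :: "('k::field, 'z) hopf_scheme \<Rightarrow> 'k rep list \<Rightarrow> 'k vec \<Rightarrow> 'k vec" where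
  "TrP H Ps x = vec (length Ps) (\<lambda>k. tr H (Ps ! k) x)"

definition row_times :: "'k::comm_ring_1 vec \<Rightarrow> 'k mat \<Rightarrow> 'k vec" where
  "row_times v M = vec (dim_col M) (\<lambda>j. \<Sum>i<dim_vec v. v $ i * M $$ (i, j))"

text \<open>sum_x tr_V(x_(2)) Tr_P(x_(1)), expanded via Delta(x) = sum_(j,l) c_jl b_j (x) b_l.\<close>
definition sweedler_tr :: "('k::field, 'z) hopf_scheme \<Rightarrow> 'k rep list \<Rightarrow> 'k rep \<Rightarrow> 'k vec \<Rightarrow> 'k vec" where
  "sweedler_tr H Ps V x = vec (length Ps) (\<lambda>k.
     \<Sum>j<hdim H. \<Sum>l<hdim H. comult H x j l * tr H V (unit_vec (hdim H) l) *
        tr H (Ps ! k) (unit_vec (hdim H) j))"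

end

theory Submission
  imports "Jordan_Normal_Form.Char_Poly" "HOL-Library.Function_Algebras" Defs
begin

text \<open>
  The right-hand side is the trace of \<open>x\<close> on \<open>P\<^sub>j \<otimes> V\<close>. Since \<open>Hom(P \<otimes> V, W) = Hom(P, W \<otimes> V\<^sup>*)\<close>
  naturally in \<open>W\<close>, the module \<open>P\<^sub>j \<otimes> V\<close> is projective, so it is a direct sum of the \<open>P\<^sub>i\<close>, and
  \<open>P\<^sub>i\<close> occurs with multiplicity \<open>dim Hom(P\<^sub>j \<otimes> V, S\<^sub>i) = dim Hom(P\<^sub>j, S\<^sub>i \<otimes> V\<^sup>*)\<close>. As \<open>Hom(P\<^sub>j, -)\<close>
  is exact and \<open>Hom(P\<^sub>j, S)\<close> is one-dimensional for \<open>S = S\<^sub>j\<close> and zero for every other simple \<open>S\<close>, this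
  dimension is the composition multiplicity \<open>[S\<^sub>i \<otimes> V\<^sup>* : S\<^sub>j]\<close>, and it depends only on the
  isomorphism class of \<open>V\<^sup>*\<close>, which gives the bidual case.
\<close>

section \<open>Subspaces and dimensions\<close>

text \<open>All work is done on matrices of explicit size, so sub- and quotient objects appear as
  split pairs \<open>F\<close>, \<open>G\<close> with \<open>F * G = 1\<close>, and the linear
  algebra consists of statements about such pairs. The delicate point on the module side is that
  \<open>comp_mult\<close> counts factors of a series picked by the choice operator: nothing
  particular is known about that series, and isomorphic modules may receive unrelated ones.
  Identifying the count with the dimension of a space of homomorphisms settles this for whichever
  series is picked, and uniqueness of that dimension fixes the multiplicities of the P_i. Algebraic
  closure enters through Schur's lemma: endomorphisms of S_j are scalar, hence Hom(P_j, S_j) is a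
  line. On the Hopf side the antipode is given by its two convolution identities; that it reverses
  products, without which the dual would not be a module, has to be derived from them. In
  coordinates the adjunction says that two convolution operators, one built from the action and one
  from its antipode, invert each other; each direction takes one of the two identities.\<close>

definition subsp :: "nat \<Rightarrow> 'k::field vec set \<Rightarrow> bool" where
  "subsp n U \<longleftrightarrow> U \<subseteq> carrier_vec n \<and> 0\<^sub>v n \<in> U \<and>
     (\<forall>u\<in>U. \<forall>w\<in>U. u + w \<in> U) \<and> (\<forall>c. \<forall>u\<in>U. c \<cdot>\<^sub>v u \<in> U)"

lemma mat_eq_by_vec:
  assumes A: "A \<in> carrier_mat m n" and B: "B \<in> carrier_mat m n"
    and e: "\<And>v. v \<in> carrier_vec n \<Longrightarrow> A *\<^sub>v v = B *\<^sub>v v"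
  shows "A = (B :: 'k::field mat)"
proof (rule eq_matI)
  fix i j assume ij: "i < dim_row B" "j < dim_col B"
  have "(A *\<^sub>v unit_vec n j) $ i = (B *\<^sub>v unit_vec n j) $ i" using e[of "unit_vec n j"] by simp
  thus "A $$ (i,j) = B $$ (i,j)" using ij A B by simp
qed (use A B in auto)

lemma mult_inverse_vec:
  fixes A :: "'k::field mat"
  assumes "A \<in> carrier_mat n m" "B \<in> carrier_mat m n" "A * B = 1\<^sub>m n" "v \<in> carrier_vec n"
  shows "A *\<^sub>v (B *\<^sub>v v) = v"
  unfolding assoc_mult_mat_vec[OF assms(1,2,4), symmetric] assms(3) using assms(4) by simp

lemma vec_minus_eq_zero:
  assumes "a \<in> carrier_vec n" "b \<in> carrier_vec n" "a - b = 0\<^sub>v n"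
  shows "a = (b :: 'k::field vec)"
proof (rule eq_vecI)
  fix i assume i: "i < dim_vec b"
  have "(a - b) $ i = 0" using assms i by simp
  thus "a $ i = b $ i" using i by simp
qed (use assms in auto)

text \<open>Pick a pivot \<open>p\<close> with \<open>w $ p\<close> nonzero. \<open>F\<close>
  subtracts the multiple of \<open>w\<close> that clears coordinate \<open>p\<close> and then drops
  this coordinate; \<open>G\<close> puts a zero back in its place. So the kernel of \<open>F\<close>
  is the line through \<open>w\<close>, and \<open>G\<close> is a section.\<close>

lemma one_vec_kernel_quotient:
  fixes w :: "'k::field vec"
  assumes w: "w \<in> carrier_vec (Suc r)" "w \<noteq> 0\<^sub>v (Suc r)"
  shows "\<exists>F G. F \<in> carrier_mat r (Suc r) \<and> G \<in> carrier_mat (Suc r) r \<and> F * G = 1\<^sub>m r \<and>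
    (\<forall>v\<in>carrier_vec (Suc r). F *\<^sub>v v = 0\<^sub>v r \<longleftrightarrow> (\<exists>c. v = c \<cdot>\<^sub>v w))"
proof -
  from w obtain p where p: "p < Suc r" "w $ p \<noteq> 0"
    by (metis carrier_vecD eq_vecI index_zero_vec(1) zero_carrier_vec)
  \<comment> \<open>\<open>sk\<close> enumerates, in increasing order, the \<open>r\<close>
    coordinates that remain once \<open>p\<close> is removed.\<close>
  define sk where "sk i = (if i < p then i else Suc i)" for i
  have skr: "sk i < Suc r" "sk i \<noteq> p" if "i < r" for i using that by (auto simp: sk_def)
  have sksurj: "\<exists>i<r. sk i = k" if "k < Suc r" "k \<noteq> p" for k
  proof (cases "k < p")
    case True thus ?thesis using p by (intro exI[of _ k]) (auto simp: sk_def)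
  next
    case False thus ?thesis using that by (intro exI[of _ "k - 1"]) (auto simp: sk_def)
  qed
  have skinj: "sk i = sk j \<longleftrightarrow> i = j" for i j by (auto simp: sk_def)
  define F where "F = mat r (Suc r) (\<lambda>(i,j). (if j = sk i then 1 else 0) - (if j = p then w $ sk i / w $ p else 0))"
  define G where "G = mat (Suc r) r (\<lambda>(i,j). if i = sk j then 1 else (0::'k))"
  have Fv: "(F *\<^sub>v v) $ i = v $ sk i - w $ sk i / w $ p * v $ p"
    if "v \<in> carrier_vec (Suc r)" "i < r" for v i
  proof -
    have "(F *\<^sub>v v) $ i = (\<Sum>j = 0..<Suc r. ((if j = sk i then 1 else 0) - (if j = p then w $ sk i / w $ p else 0)) * v $ j)"
      using that by (auto simp: F_def scalar_prod_def intro!: sum.cong)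
    also have "\<dots> = (\<Sum>j = 0..<Suc r. if j = sk i then v $ j else 0) - (\<Sum>j = 0..<Suc r. if j = p then w $ sk i / w $ p * v $ j else 0)"
      unfolding sum_subtractf[symmetric] by (rule sum.cong) (auto simp: algebra_simps)
    also have "\<dots> = v $ sk i - w $ sk i / w $ p * v $ p"
      using skr[OF that(2)] p by (simp add: sum.delta del: sum.op_ivl_Suc)
    finally show ?thesis .
  qed
  have "F * G = 1\<^sub>m r"
  proof (rule eq_matI)
    fix i j assume "i < dim_row (1\<^sub>m r :: 'k mat)" "j < dim_col (1\<^sub>m r :: 'k mat)"
    hence ij: "i < r" "j < r" by auto
    have "(F * G) $$ (i,j) = (F *\<^sub>v col G j) $ i" using ij by (auto simp: F_def G_def)
    also have "\<dots> = col G j $ sk i - w $ sk i / w $ p * col G j $ p"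
      using ij by (intro Fv) (auto simp: G_def carrier_dim_vec)
    also have "\<dots> = (if i = j then 1 else 0)" using skr[OF ij(1)] skr[OF ij(2)] p ij by (auto simp: G_def skinj)
    finally show "(F * G) $$ (i,j) = 1\<^sub>m r $$ (i,j)" using ij by auto
  qed (auto simp: F_def G_def)
  moreover have "F *\<^sub>v v = 0\<^sub>v r \<longleftrightarrow> (\<exists>c. v = c \<cdot>\<^sub>v w)" if v: "v \<in> carrier_vec (Suc r)" for v
  proof
    assume 0: "F *\<^sub>v v = 0\<^sub>v r"
    have "v = (v $ p / w $ p) \<cdot>\<^sub>v w"
    proof (rule eq_vecI)
      fix k assume "k < dim_vec ((v $ p / w $ p) \<cdot>\<^sub>v w)"
      hence k: "k < Suc r" using w by auto
      show "v $ k = ((v $ p / w $ p) \<cdot>\<^sub>v w) $ k"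
      proof (cases "k = p")
        case True thus ?thesis using p w by auto
      next
        case False
        then obtain i where "i < r" "sk i = k" using sksurj k by auto
        hence "v $ k - w $ k / w $ p * v $ p = 0" using Fv[OF v \<open>i < r\<close>] 0 by auto
        thus ?thesis using k w by auto
      qed
    qed (use v w in auto)
    thus "\<exists>c. v = c \<cdot>\<^sub>v w" by blast
  next
    assume "\<exists>c. v = c \<cdot>\<^sub>v w"
    then obtain c where c: "v = c \<cdot>\<^sub>v w" ..
    show "F *\<^sub>v v = 0\<^sub>v r"
    proof (rule eq_vecI)
      fix i assume "i < dim_vec (0\<^sub>v r :: 'k vec)"
      hence i: "i < r" by simp
      show "(F *\<^sub>v v) $ i = 0\<^sub>v r $ i" using Fv[OF v i] c p skr[OF i] w i by auto
    qed (auto simp: F_def)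
  qed
  ultimately show ?thesis by (intro exI[of _ F] exI[of _ G]) (auto simp: F_def G_def)
qed

text \<open>Induction on the target dimension \<open>r\<close>. As long as some \<open>u\<close> in
  \<open>U\<close> is not killed by \<open>F\<close>, compose with the quotient by the line through
  \<open>F *\<^sub>v u\<close>: the target shrinks by one, and the kernel grows only by multiples of
  \<open>u\<close>, so it stays inside \<open>U\<close>. When no such \<open>u\<close> is left the
  kernel is exactly \<open>U\<close>.\<close>

lemma subsp_quotient_aux:
  assumes U: "subsp n U"
    and F: "F \<in> carrier_mat r n" "G \<in> carrier_mat n r" "F * G = 1\<^sub>m r"
    and k: "\<And>v. v \<in> carrier_vec n \<Longrightarrow> F *\<^sub>v v = 0\<^sub>v r \<Longrightarrow> v \<in> U"
  shows "\<exists>r F G. F \<in> carrier_mat r n \<and> G \<in> carrier_mat n r \<and> F * G = 1\<^sub>m r \<and>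
     (\<forall>v\<in>carrier_vec n. F *\<^sub>v v = 0\<^sub>v r \<longleftrightarrow> v \<in> U)"
  using F k
proof (induction r arbitrary: F G)
  case 0
  have "F *\<^sub>v v = 0\<^sub>v 0" for v using 0 by (intro eq_vecI) auto
  with 0 show ?case by blast
next
  case (Suc r)
  show ?case
  proof (cases "\<forall>u\<in>U. F *\<^sub>v u = 0\<^sub>v (Suc r)")
    case True
    with Suc.prems show ?thesis by blast
  next
    case False
    then obtain u where u: "u \<in> U" "F *\<^sub>v u \<noteq> 0\<^sub>v (Suc r)" by blast
    have uc: "u \<in> carrier_vec n" using U u by (auto simp: subsp_def)
    have "F *\<^sub>v u \<in> carrier_vec (Suc r)" using Suc.prems(1) by (auto simp: carrier_dim_vec)
    from one_vec_kernel_quotient[OF this u(2)] obtain F' G' where F':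
      "F' \<in> carrier_mat r (Suc r)" "G' \<in> carrier_mat (Suc r) r" "F' * G' = 1\<^sub>m r"
      "\<And>v. v\<in>carrier_vec (Suc r) \<Longrightarrow> F' *\<^sub>v v = 0\<^sub>v r \<longleftrightarrow> (\<exists>c. v = c \<cdot>\<^sub>v (F *\<^sub>v u))" by blast
    have "(F' * F) * (G * G') = F' * (F * (G * G'))"
      by (rule assoc_mult_mat) (use F'(1,2) Suc.prems(1,2) in auto)
    also have "F * (G * G') = (F * G) * G'" by (rule assoc_mult_mat[symmetric]) (use F'(1,2) Suc.prems(1,2) in auto)
    also have "F' * \<dots> = 1\<^sub>m r" using F'(2,3) Suc.prems(3) by simp
    finally have one: "(F' * F) * (G * G') = 1\<^sub>m r" .
    show ?thesis
    proof (rule Suc.IH[OF _ _ one])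
      fix v assume v: "v \<in> carrier_vec n" "F' * F *\<^sub>v v = 0\<^sub>v r"
      have Fv: "F *\<^sub>v v \<in> carrier_vec (Suc r)" using Suc.prems(1) by (auto simp: carrier_dim_vec)
      have "F' *\<^sub>v (F *\<^sub>v v) = 0\<^sub>v r"
        using v assoc_mult_mat_vec[OF F'(1) Suc.prems(1) v(1)] by simp
      then obtain c where c: "F *\<^sub>v v = c \<cdot>\<^sub>v (F *\<^sub>v u)" using F'(4)[OF Fv] by blast
      have cu: "c \<cdot>\<^sub>v u \<in> carrier_vec n" using uc by simp
      have "F *\<^sub>v (v - c \<cdot>\<^sub>v u) = F *\<^sub>v v - F *\<^sub>v (c \<cdot>\<^sub>v u)"
        by (rule mult_minus_distrib_mat_vec[OF Suc.prems(1) v(1) cu])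
      also have "\<dots> = 0\<^sub>v (Suc r)" using c mult_mat_vec[OF Suc.prems(1) uc, of c] Fv by simp
      finally have "v - c \<cdot>\<^sub>v u \<in> U" using Suc.prems(4) v cu by simp
      moreover have "c \<cdot>\<^sub>v u \<in> U" using U u by (auto simp: subsp_def)
      ultimately have "(v - c \<cdot>\<^sub>v u) + c \<cdot>\<^sub>v u \<in> U" using U unfolding subsp_def by blast
      moreover have "(v - c \<cdot>\<^sub>v u) + c \<cdot>\<^sub>v u = v" using v uc by (intro eq_vecI) auto
      ultimately show "v \<in> U" by simp
    qed (use F'(1,2) Suc.prems(1,2) in auto)
  qed
qed

lemma subsp_quotient:
  assumes U: "subsp n U"
  obtains r F G where "F \<in> carrier_mat r n" "G \<in> carrier_mat n r" "F * G = 1\<^sub>m r"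
     "\<And>v. v\<in>carrier_vec n \<Longrightarrow> F *\<^sub>v v = 0\<^sub>v r \<longleftrightarrow> v \<in> U"
proof -
  have "\<exists>r F G. F \<in> carrier_mat r n \<and> G \<in> carrier_mat n r \<and> F * G = 1\<^sub>m r \<and>
     (\<forall>v\<in>carrier_vec n. F *\<^sub>v v = 0\<^sub>v r \<longleftrightarrow> v \<in> U)"
    by (rule subsp_quotient_aux[OF U, of "1\<^sub>m n" n "1\<^sub>m n"]) (use U in \<open>auto simp: subsp_def\<close>)
  thus thesis using that by blast
qed

text \<open>\<open>G * F\<close> differs from the identity by vectors in the kernel of
  \<open>F\<close>, and these are killed by \<open>E\<close>. So \<open>E\<close> factors through
  \<open>F\<close> as \<open>E * G\<close>, which is the universal property of a quotient in matrix
  form.\<close>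

lemma kernel_imp_factor:
  fixes F :: "'k::field mat"
  assumes F: "F \<in> carrier_mat r n" "G \<in> carrier_mat n r" "F * G = 1\<^sub>m r"
    and E: "E \<in> carrier_mat m n"
    and k: "\<And>v. v \<in> carrier_vec n \<Longrightarrow> F *\<^sub>v v = 0\<^sub>v r \<Longrightarrow> E *\<^sub>v v = 0\<^sub>v m"
  shows "E * (G * F) = E"
proof (rule mat_eq_by_vec)
  show "E * (G * F) \<in> carrier_mat m n" by (rule mult_carrier_mat[OF E mult_carrier_mat[OF F(2,1)]])
  show "E \<in> carrier_mat m n" by (rule E)
  fix v :: "'k vec" assume v: "v \<in> carrier_vec n"
  have gfv: "(G * F) *\<^sub>v v \<in> carrier_vec n" by (rule mult_mat_vec_carrier[OF mult_carrier_mat[OF F(2,1)] v])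
  have Fv: "F *\<^sub>v v \<in> carrier_vec r" by (rule mult_mat_vec_carrier[OF F(1) v])
  have "F *\<^sub>v ((G * F) *\<^sub>v v - v) = F *\<^sub>v ((G * F) *\<^sub>v v) - F *\<^sub>v v"
    by (rule mult_minus_distrib_mat_vec[OF F(1) gfv v])
  also have "F *\<^sub>v ((G * F) *\<^sub>v v) = (F * G) *\<^sub>v (F *\<^sub>v v)"
    using assoc_mult_mat_vec[OF F(2,1) v] assoc_mult_mat_vec[OF F(1,2) Fv] by simp
  finally have "F *\<^sub>v ((G * F) *\<^sub>v v - v) = 0\<^sub>v r" using F(3) Fv by simp
  hence "E *\<^sub>v ((G * F) *\<^sub>v v - v) = 0\<^sub>v m" using k gfv v by simp
  hence z: "E *\<^sub>v ((G * F) *\<^sub>v v) - E *\<^sub>v v = 0\<^sub>v m"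
    using mult_minus_distrib_mat_vec[OF E gfv v] by simp
  have c: "E *\<^sub>v ((G * F) *\<^sub>v v) \<in> carrier_vec m" "E *\<^sub>v v \<in> carrier_vec m" using E by (auto simp: carrier_dim_vec)
  have "E *\<^sub>v ((G * F) *\<^sub>v v) = E *\<^sub>v v" by (rule vec_minus_eq_zero[OF c z])
  thus "E * (G * F) *\<^sub>v v = E *\<^sub>v v" using assoc_mult_mat_vec[OF E _ v, of "G * F"] F(1,2) by simp
qed

text \<open>If \<open>U\<close> is the kernel of a split pair \<open>A\<close>, \<open>B\<close>,
  then \<open>E = 1 - B * A\<close> is an idempotent with image \<open>U\<close>. Dividing by the
  kernel of \<open>E\<close> factors it as \<open>J * K\<close> with \<open>K * J = 1\<close>: the
  columns of \<open>J\<close> are a basis of \<open>U\<close>, and \<open>K\<close> reads off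
  coordinates.\<close>

lemma subsp_basis:
  fixes U :: "'k::field vec set"
  assumes U: "subsp n U"
  obtains r J K where "J \<in> carrier_mat n r" "K \<in> carrier_mat r n" "K * J = 1\<^sub>m r"
     "U = (*\<^sub>v) J ` carrier_vec r" "\<And>u. u \<in> U \<Longrightarrow> J *\<^sub>v (K *\<^sub>v u) = u"
proof -
  obtain s A B where A: "A \<in> carrier_mat s n" "B \<in> carrier_mat n s" "A * B = 1\<^sub>m s"
     "\<And>v. v\<in>carrier_vec n \<Longrightarrow> A *\<^sub>v v = 0\<^sub>v s \<longleftrightarrow> v \<in> U" by (rule subsp_quotient[OF U]) (rule that)
  define E where "E = 1\<^sub>m n - B * A"
  have E: "E \<in> carrier_mat n n" using A(1,2) by (auto simp: E_def)
  have Ev: "E *\<^sub>v v = v - B *\<^sub>v (A *\<^sub>v v)" if "v \<in> carrier_vec n" for v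
    unfolding E_def using A(1,2) that by (subst minus_mult_distrib_mat_vec) auto
  have EU: "E *\<^sub>v u = u" if "u \<in> U" for u
  proof -
    have "u \<in> carrier_vec n" using U that by (auto simp: subsp_def)
    moreover from this have "A *\<^sub>v u = 0\<^sub>v s" using A(4) that by blast
    moreover have "B *\<^sub>v 0\<^sub>v s = 0\<^sub>v n" using A(2) by (intro eq_vecI) auto
    ultimately show ?thesis by (simp add: Ev)
  qed
  have EinU: "E *\<^sub>v v \<in> U" if v: "v \<in> carrier_vec n" for v
  proof -
    have Av: "A *\<^sub>v v \<in> carrier_vec s" using A(1) by (auto simp: carrier_dim_vec)
    have "A *\<^sub>v (E *\<^sub>v v) = A *\<^sub>v v - A *\<^sub>v (B *\<^sub>v (A *\<^sub>v v))"
      unfolding Ev[OF v] using A(1,2) v Av by (intro mult_minus_distrib_mat_vec) auto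
    also have "A *\<^sub>v (B *\<^sub>v (A *\<^sub>v v)) = A *\<^sub>v v"
      using assoc_mult_mat_vec[OF A(1,2) Av] A(3) Av by simp
    finally show ?thesis using A(4)[of "E *\<^sub>v v"] Av E v by auto
  qed
  have kE: "subsp n {v \<in> carrier_vec n. E *\<^sub>v v = 0\<^sub>v n}"
  proof -
    have "E *\<^sub>v 0\<^sub>v n = 0\<^sub>v n" using E by (intro eq_vecI) auto
    thus ?thesis unfolding subsp_def by (auto simp: mult_add_distrib_mat_vec[OF E] mult_mat_vec[OF E])
  qed
  obtain r F G where F: "F \<in> carrier_mat r n" "G \<in> carrier_mat n r" "F * G = 1\<^sub>m r"
     "\<And>v. v\<in>carrier_vec n \<Longrightarrow> F *\<^sub>v v = 0\<^sub>v r \<longleftrightarrow> v \<in> {v \<in> carrier_vec n. E *\<^sub>v v = 0\<^sub>v n}" by (rule subsp_quotient[OF kE]) (rule that)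
  have EGF: "E * (G * F) = E" by (rule kernel_imp_factor[OF F(1-3) E]) (use F(4) in blast)
  have FE: "F * E = F"
  proof (rule mat_eq_by_vec)
    fix v :: "'k vec" assume v: "v \<in> carrier_vec n"
    have Evc: "E *\<^sub>v v \<in> carrier_vec n" using E v by auto
    have "E *\<^sub>v (E *\<^sub>v v - v) = 0\<^sub>v n"
      using mult_minus_distrib_mat_vec[OF E Evc v] EU[OF EinU[OF v]] Evc by simp
    hence "F *\<^sub>v (E *\<^sub>v v - v) = 0\<^sub>v r" using F(4)[of "E *\<^sub>v v - v"] Evc v by auto
    hence "F *\<^sub>v (E *\<^sub>v v) - F *\<^sub>v v = 0\<^sub>v r" using mult_minus_distrib_mat_vec[OF F(1) Evc v] by simp
    hence "F *\<^sub>v (E *\<^sub>v v) = F *\<^sub>v v"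
      by (rule vec_minus_eq_zero[rotated 2]) (use F(1) in \<open>auto simp: carrier_dim_vec\<close>)
    thus "F * E *\<^sub>v v = F *\<^sub>v v" using assoc_mult_mat_vec[OF F(1) E v] by simp
  qed (use F(1) E in auto)
  define J where "J = E * G"
  have J: "J \<in> carrier_mat n r" using E F(2) by (auto simp: J_def)
  have KJ: "F * J = 1\<^sub>m r" unfolding J_def using assoc_mult_mat[OF F(1) E F(2)] FE F(3) by simp
  have JK: "J * F = E" unfolding J_def using assoc_mult_mat[OF E F(2,1)] EGF by simp
  have JKu: "J *\<^sub>v (F *\<^sub>v u) = u" if "u \<in> U" for u
  proof -
    have "u \<in> carrier_vec n" using U that by (auto simp: subsp_def)
    thus ?thesis using assoc_mult_mat_vec[OF J F(1)] JK EU[OF that] by metis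
  qed
  have "U = (*\<^sub>v) J ` carrier_vec r"
  proof safe
    fix u assume u: "u \<in> U"
    have "F *\<^sub>v u \<in> carrier_vec r" using F(1) by (auto simp: carrier_dim_vec)
    thus "u \<in> (*\<^sub>v) J ` carrier_vec r" using JKu[OF u] by (metis imageI)
  next
    fix v :: "'k vec" assume v: "v \<in> carrier_vec r"
    have "J *\<^sub>v v = E *\<^sub>v (G *\<^sub>v v)" unfolding J_def using assoc_mult_mat_vec[OF E F(2) v] .
    thus "J *\<^sub>v v \<in> U" using EinU F(2) v by auto
  qed
  thus thesis using that[OF J F(1) KJ] JKu by blast
qed

text \<open>If \<open>s < r\<close>, pad both matrices with zeros to square ones. A right inverse of
  a square matrix is also a left inverse, yet row \<open>s\<close> of the reversed product is
  zero.\<close>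

lemma one_mat_factor_le:
  fixes A :: "'k::field mat"
  assumes A: "A \<in> carrier_mat r s" and B: "B \<in> carrier_mat s r" and AB: "A * B = 1\<^sub>m r"
  shows "r \<le> s"
proof (rule ccontr)
  assume "\<not> r \<le> s"
  hence sr: "s < r" by simp
  define A' where "A' = mat r r (\<lambda>(i,j). if j < s then A $$ (i,j) else 0)"
  define B' where "B' = mat r r (\<lambda>(i,j). if i < s then B $$ (i,j) else 0)"
  have c: "A' \<in> carrier_mat r r" "B' \<in> carrier_mat r r" by (auto simp: A'_def B'_def)
  have "A' * B' = 1\<^sub>m r"
  proof (rule eq_matI)
    fix i j assume "i < dim_row (1\<^sub>m r :: 'k mat)" "j < dim_col (1\<^sub>m r :: 'k mat)"
    hence ij: "i < r" "j < r" by auto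
    have "(A' * B') $$ (i,j) = (\<Sum>k=0..<r. if k < s then A $$ (i,k) * B $$ (k,j) else 0)"
      using ij by (auto simp: A'_def B'_def scalar_prod_def intro!: sum.cong)
    also have "\<dots> = (\<Sum>k=0..<s. A $$ (i,k) * B $$ (k,j))"
      using sr by (intro sum.mono_neutral_cong_right) auto
    also have "\<dots> = (A * B) $$ (i,j)" using ij A B by (auto simp: scalar_prod_def intro!: sum.cong)
    finally show "(A' * B') $$ (i,j) = 1\<^sub>m r $$ (i,j)" using AB by simp
  qed (use c in auto)
  hence "B' * A' = 1\<^sub>m r" by (rule mat_mult_left_right_inverse[OF c])
  hence "(B' * A') $$ (s,s) = 1" using sr by simp
  moreover have "(B' * A') $$ (s,s) = 0" using sr by (auto simp: A'_def B'_def scalar_prod_def)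
  ultimately show False by simp
qed

text \<open>\<open>LEAST\<close> fixes a value before the size of a basis is known to be unique. The
  number serves as a measure: it is bounded by \<open>n\<close> and strictly monotone under proper
  inclusion.\<close>

definition sdim :: "nat \<Rightarrow> 'k::field vec set \<Rightarrow> nat" where
  "sdim n U = (LEAST r. \<exists>J K. J \<in> carrier_mat n r \<and> K \<in> carrier_mat r n \<and> K * J = 1\<^sub>m r \<and>
     U = (*\<^sub>v) J ` carrier_vec r)"

lemma sdim_basis:
  assumes U: "subsp n U"
  obtains J K where "J \<in> carrier_mat n (sdim n U)" "K \<in> carrier_mat (sdim n U) n" "K * J = 1\<^sub>m (sdim n U)"
     "U = (*\<^sub>v) J ` carrier_vec (sdim n U)"
proof -
  have "\<exists>r. \<exists>J K. J \<in> carrier_mat n r \<and> K \<in> carrier_mat r n \<and> K * J = 1\<^sub>m r \<and>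
     U = (*\<^sub>v) J ` carrier_vec r" by (rule subsp_basis[OF U]) blast
  from LeastI_ex[OF this] show thesis unfolding sdim_def[symmetric] by (elim exE conjE) (rule that)
qed

lemma sdim_le: "subsp n U \<Longrightarrow> sdim n U \<le> n"
proof -
  assume "subsp n U"
  then obtain J K where "J \<in> carrier_mat n (sdim n U)" "K \<in> carrier_mat (sdim n U) n" "K * J = 1\<^sub>m (sdim n U)"
    "U = (*\<^sub>v) J ` carrier_vec (sdim n U)" by (rule sdim_basis)
  thus ?thesis using one_mat_factor_le by blast
qed

text \<open>\<open>K' * J\<close> and \<open>K * J'\<close> compare the two coordinate systems, and
  the inclusion makes their composite the identity of size \<open>?r\<close>, so the dimension
  cannot drop. If the dimensions agreed, the two would be mutually inverse, \<open>J'\<close> would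
  factor through \<open>J\<close>, and \<open>U'\<close> would lie in \<open>U\<close>.\<close>

lemma sdim_less:
  fixes U :: "'k::field vec set"
  assumes U: "subsp n U" and U': "subsp n U'" and lt: "U \<subset> U'"
  shows "sdim n U < sdim n U'"
proof -
  let ?r = "sdim n U" let ?s = "sdim n U'"
  obtain J K where J: "J \<in> carrier_mat n ?r" "K \<in> carrier_mat ?r n" "K * J = 1\<^sub>m ?r"
     "U = (*\<^sub>v) J ` carrier_vec ?r" by (rule sdim_basis[OF U])
  obtain J' K' where J': "J' \<in> carrier_mat n ?s" "K' \<in> carrier_mat ?s n" "K' * J' = 1\<^sub>m ?s"
     "U' = (*\<^sub>v) J' ` carrier_vec ?s" by (rule sdim_basis[OF U'])
  have JK': "J' *\<^sub>v (K' *\<^sub>v u) = u" if u: "u \<in> U'" for u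
  proof -
    obtain v where v: "v \<in> carrier_vec ?s" "u = J' *\<^sub>v v" using u J'(4) by blast
    have "K' *\<^sub>v u = v" unfolding v(2) by (rule mult_inverse_vec[OF J'(2,1,3) v(1)])
    thus ?thesis using v by simp
  qed
  have JKJ: "J' * (K' * J) = J"
  proof (rule mat_eq_by_vec)
    fix v :: "'k vec" assume v: "v \<in> carrier_vec ?r"
    have "J *\<^sub>v v \<in> U'" using J(4) lt v by blast
    hence "J' *\<^sub>v (K' *\<^sub>v (J *\<^sub>v v)) = J *\<^sub>v v" by (rule JK')
    moreover have "J' * (K' * J) *\<^sub>v v = J' *\<^sub>v ((K' * J) *\<^sub>v v)"
      by (rule assoc_mult_mat_vec) (use J(1,2) J'(1,2) v in auto)
    moreover have "(K' * J) *\<^sub>v v = K' *\<^sub>v (J *\<^sub>v v)" by (rule assoc_mult_mat_vec) (use J(1,2) J'(1,2) v in auto)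
    ultimately show "J' * (K' * J) *\<^sub>v v = J *\<^sub>v v" by simp
  qed (use J(1,2) J'(1,2) in auto)
  have one: "(K * J') * (K' * J) = 1\<^sub>m ?r"
    using assoc_mult_mat[OF J(2) J'(1), of "K' * J" ?r] JKJ J(1-3) J'(1,2) by simp
  have c: "K * J' \<in> carrier_mat ?r ?s" "K' * J \<in> carrier_mat ?s ?r" using J(1,2) J'(1,2) by auto
  have "?r \<le> ?s" by (rule one_mat_factor_le[OF c one])
  moreover have "?r \<noteq> ?s"
  proof
    assume eq: "?r = ?s"
    hence one': "(K' * J) * (K * J') = 1\<^sub>m ?s" using mat_mult_left_right_inverse[of _ ?s] c one by metis
    have "U' \<subseteq> U"
    proof
      fix u assume "u \<in> U'"
      then obtain v where v: "v \<in> carrier_vec ?s" "u = J' *\<^sub>v v" using J'(4) by blast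
      have Kv: "(K * J') *\<^sub>v v \<in> carrier_vec ?r" using c by (auto simp: carrier_dim_vec)
      have "J * (K * J') = J' * ((K' * J) * (K * J'))"
        using assoc_mult_mat[OF J'(1) c(2) c(1)] JKJ by simp
      hence "J * (K * J') = J'" using one' J'(1) by simp
      hence "u = J *\<^sub>v ((K * J') *\<^sub>v v)" using v assoc_mult_mat_vec[OF J(1) c(1) v(1)] by simp
      thus "u \<in> U" using J(4) Kv by blast
    qed
    thus False using lt by blast
  qed
  ultimately show ?thesis by simp
qed

text \<open>Dimension of a space of matrices, witnessed by a flag: each step adjoins one matrix
  outside the space reached so far. Spaces of homomorphisms grow in just this way along a
  composition series and under the splitting of idempotents, so no basis has to be carried
  along.\<close>

inductive mat_dim :: "nat \<Rightarrow> nat \<Rightarrow> 'k::field mat set \<Rightarrow> nat \<Rightarrow> bool" for a b where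
  zero: "mat_dim a b {0\<^sub>m a b} 0"
| step: "mat_dim a b X n \<Longrightarrow> x0 \<in> carrier_mat a b \<Longrightarrow> x0 \<notin> X \<Longrightarrow>
    mat_dim a b {x + c \<cdot>\<^sub>m x0 | x c. x \<in> X} (Suc n)"

lemma mat_dim_carrier: "mat_dim a b X n \<Longrightarrow> X \<subseteq> carrier_mat a b"
  by (induction rule: mat_dim.induct) auto

text \<open>Injectivity keeps each newly adjoined matrix outside the image of the previous space, so
  the flag is carried to a flag. It transports dimensions along linear bijections between spaces of
  homomorphisms.\<close>

lemma mat_dim_image:
  fixes X :: "'k::field mat set"
  assumes "mat_dim a b X n"
    and c: "\<And>x. x \<in> carrier_mat a b \<Longrightarrow> \<phi> x \<in> carrier_mat a' b'"
    and z: "\<phi> (0\<^sub>m a b) = 0\<^sub>m a' b'"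
    and l: "\<And>x y k. x \<in> carrier_mat a b \<Longrightarrow> y \<in> carrier_mat a b \<Longrightarrow> \<phi> (x + k \<cdot>\<^sub>m y) = \<phi> x + k \<cdot>\<^sub>m \<phi> y"
    and inj: "inj_on \<phi> (carrier_mat a b)"
  shows "mat_dim a' b' (\<phi> ` X) n"
  using assms(1)
proof (induction rule: mat_dim.induct)
  case zero thus ?case using z by (auto intro: mat_dim.zero)
next
  case (step X n x0)
  note X = mat_dim_carrier[OF step(1)]
  have "\<phi> x0 \<notin> \<phi> ` X" using inj step(2,3) X by (metis inj_on_image_mem_iff)
  from mat_dim.step[OF step.IH c[OF step(2)] this]
  have "mat_dim a' b' {x + k \<cdot>\<^sub>m \<phi> x0 | x k. x \<in> \<phi> ` X} (Suc n)" .
  moreover have "{x + k \<cdot>\<^sub>m \<phi> x0 | x k. x \<in> \<phi> ` X} = \<phi> ` {x + k \<cdot>\<^sub>m x0 | x k. x \<in> X}"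
  proof -
    have e: "\<phi> (x + k \<cdot>\<^sub>m x0) = \<phi> x + k \<cdot>\<^sub>m \<phi> x0" if "x \<in> X" for x k using l X step(2) that by blast
    show ?thesis
    proof (intro equalityI subsetI)
      fix y assume "y \<in> {x + k \<cdot>\<^sub>m \<phi> x0 | x k. x \<in> \<phi> ` X}"
      then obtain x k where "x \<in> X" "y = \<phi> x + k \<cdot>\<^sub>m \<phi> x0" by blast
      hence "x \<in> X" "y = \<phi> (x + k \<cdot>\<^sub>m x0)" using e by auto
      thus "y \<in> \<phi> ` {x + k \<cdot>\<^sub>m x0 | x k. x \<in> X}" by blast
    next
      fix y assume "y \<in> \<phi> ` {x + k \<cdot>\<^sub>m x0 | x k. x \<in> X}"
      then obtain x k where "x \<in> X" "y = \<phi> (x + k \<cdot>\<^sub>m x0)" by blast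
      thus "y \<in> {x + k \<cdot>\<^sub>m \<phi> x0 | x k. x \<in> \<phi> ` X}" using e by blast
    qed
  qed
  ultimately show ?case by simp
qed

lemma vector_space_fun: "vector_space (\<lambda>(c::'k::field) (f :: 'a \<Rightarrow> 'k) x. c * f x)"
  by unfold_locales (simp_all only: fun_eq_iff plus_fun_apply algebra_simps, simp_all)

text \<open>The type of matrices mixes all sizes and is no vector space. Reading entries as
  functions on index pairs, zero outside the frame, embeds the matrices of one size into a vector
  space; there each step of the flag enlarges an independent set, and the dimension of its span
  recovers the count.\<close>

lemma mat_dim_unique:
  fixes X :: "'k::field mat set"
  assumes "mat_dim a b X n" "mat_dim a b X m"
  shows "n = m"
proof -
  interpret V: vector_space "\<lambda>(c::'k) (f :: nat \<times> nat \<Rightarrow> 'k) x. c * f x" by (rule vector_space_fun)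
  define emb where "emb M = (\<lambda>ij. if fst ij < a \<and> snd ij < b then M $$ ij else (0::'k))" for M
  have inj: "inj_on emb (carrier_mat a b)"
  proof (rule inj_onI, rule eq_matI)
    fix x y i j assume "x \<in> carrier_mat a b" "y \<in> carrier_mat a b" "emb x = emb y"
      and ij: "i < dim_row y" "j < dim_col y"
    moreover have "emb x (i,j) = emb y (i,j)" using \<open>emb x = emb y\<close> by simp
    ultimately show "x $$ (i,j) = y $$ (i,j)" unfolding emb_def by simp
  qed auto
  have ex: "\<exists>B. finite B \<and> V.independent B \<and> card B = n \<and> V.span B = emb ` X" if "mat_dim a b X n" for X n
    using that
  proof (induction rule: mat_dim.induct)
    case zero
    have "emb (0\<^sub>m a b) = 0" by (auto simp: emb_def fun_eq_iff)
    thus ?case by (intro exI[of _ "{}"]) (auto simp: V.span_empty V.independent_empty)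
  next
    case (step X n x0)
    then obtain B where B: "finite B" "V.independent B" "card B = n" "V.span B = emb ` X" by blast
    note X = mat_dim_carrier[OF step(1)]
    have nin: "emb x0 \<notin> V.span B" using inj step(2,3) X B by (metis inj_on_image_mem_iff)
    have e: "emb (x + c \<cdot>\<^sub>m x0) = emb x + (\<lambda>i. c * emb x0 i)" if "x \<in> X" for x c
      using that X step(2) by (auto simp: emb_def fun_eq_iff subset_iff)
    have "V.span (insert (emb x0) B) = emb ` {x + c \<cdot>\<^sub>m x0 | x c. x \<in> X}"
    proof safe
      fix f assume "f \<in> V.span (insert (emb x0) B)"
      then obtain k where "f - (\<lambda>i. k * emb x0 i) \<in> emb ` X" using V.span_breakdown_eq B(4) by metis
      then obtain x where x: "x \<in> X" "f - (\<lambda>i. k * emb x0 i) = emb x" by blast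
      hence "f = emb (x + k \<cdot>\<^sub>m x0)" using e[OF x(1)] by (metis diff_add_cancel)
      thus "f \<in> emb ` {x + c \<cdot>\<^sub>m x0 | x c. x \<in> X}" using x by blast
    next
      fix x c assume x: "x \<in> X"
      have "emb (x + c \<cdot>\<^sub>m x0) - (\<lambda>i. c * emb x0 i) \<in> V.span B" using e[OF x] x B by auto
      thus "emb (x + c \<cdot>\<^sub>m x0) \<in> V.span (insert (emb x0) B)" using V.span_breakdown_eq by blast
    qed
    moreover have "emb x0 \<notin> B" using nin V.span_base by blast
    moreover have "V.independent (insert (emb x0) B)" using V.independent_insertI[OF nin B(2)] .
    ultimately show ?case using B by (intro exI[of _ "insert (emb x0) B"]) auto
  qed
  have "n = V.dim (emb ` X)" if Xn: "mat_dim a b X n" for n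
  proof -
    obtain B where B: "V.independent B" "card B = n" "V.span B = emb ` X" using ex[OF Xn] by blast
    show ?thesis using V.dim_span_eq_card_independent[OF B(1)] unfolding B(2,3) by simp
  qed
  from this[OF assms(1)] this[OF assms(2)] show ?thesis by simp
qed

section \<open>Modules given by matrices\<close>

abbreviation vecs :: "'k rep \<Rightarrow> 'k vec set" where
  "vecs V \<equiv> carrier_vec (rdim V)"

abbreviation mats :: "'k rep \<Rightarrow> 'k rep \<Rightarrow> 'k mat set" where
  "mats V W \<equiv> carrier_mat (rdim W) (rdim V)"

lemma homD:
  assumes "hom H V W F"
  shows "F \<in> mats V W" and "i < hdim H \<Longrightarrow> F * ract V i = ract W i * F"
  using assms by (auto simp: hom_def)

lemma is_moduleD:
  assumes "is_module H V"
  shows "i < hdim H \<Longrightarrow> ract V i \<in> mats V V"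
    and "i < hdim H \<Longrightarrow> j < hdim H \<Longrightarrow> ract V i * ract V j = lincomb H V (hmu H i j)"
    and "lincomb H V (heta H) = 1\<^sub>m (rdim V)"
  using assms by (auto simp: is_module_def)

lemma hom_comp:
  assumes m: "is_module H U" "is_module H V" "is_module H W"
    and F: "hom H U V F" and G: "hom H V W G"
  shows "hom H U W (G * F)"
  unfolding hom_def
proof (intro conjI allI impI)
  note Fc = homD(1)[OF F] and Gc = homD(1)[OF G]
  show "G * F \<in> mats U W" by (rule mult_carrier_mat[OF Gc Fc])
  fix i assume i: "i < hdim H"
  note c = is_moduleD(1)[OF m(1) i] is_moduleD(1)[OF m(2) i] is_moduleD(1)[OF m(3) i]
  have "G * F * ract U i = G * (F * ract U i)" by (rule assoc_mult_mat[OF Gc Fc c(1)])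
  also have "\<dots> = G * (ract V i * F)" by (simp only: homD(2)[OF F i])
  also have "\<dots> = G * ract V i * F" by (rule assoc_mult_mat[OF Gc c(2) Fc, symmetric])
  also have "\<dots> = ract W i * G * F" by (simp only: homD(2)[OF G i])
  also have "\<dots> = ract W i * (G * F)" by (rule assoc_mult_mat[OF c(3) Gc Fc])
  finally show "G * F * ract U i = ract W i * (G * F)" .
qed

lemma hom_vec:
  assumes m: "is_module H V" "is_module H W" and F: "hom H V W F" and i: "i < hdim H"
    and v: "v \<in> vecs V"
  shows "F *\<^sub>v (ract V i *\<^sub>v v) = ract W i *\<^sub>v (F *\<^sub>v v)"
  using assoc_mult_mat_vec[OF homD(1)[OF F] is_moduleD(1)[OF m(1) i] v]
    assoc_mult_mat_vec[OF is_moduleD(1)[OF m(2) i] homD(1)[OF F] v] homD(2)[OF F i] by simp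

lemma submodule_iff:
  "submodule H V U \<longleftrightarrow> subsp (rdim V) U \<and> (\<forall>i<hdim H. \<forall>u\<in>U. ract V i *\<^sub>v u \<in> U)"
  by (auto simp: submodule_def subsp_def)

lemma mult_mat_vec_zero: "A \<in> carrier_mat m n \<Longrightarrow> A *\<^sub>v 0\<^sub>v n = (0\<^sub>v m :: 'k::field vec)"
  by (intro eq_vecI) auto

lemma submodule_zero: "is_module H V \<Longrightarrow> submodule H V {0\<^sub>v (rdim V)}"
  by (auto simp: submodule_def mult_mat_vec_zero[OF is_moduleD(1)])

lemma submodule_full: "is_module H V \<Longrightarrow> submodule H V (vecs V)"
  by (auto simp: submodule_def intro: mult_mat_vec_carrier[OF is_moduleD(1)])

lemma preimage_submodule:
  assumes m: "is_module H V" "is_module H W" and F: "hom H V W F" and X: "submodule H W X"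
  shows "submodule H V {v \<in> vecs V. F *\<^sub>v v \<in> X}"
proof -
  note Fc = homD(1)[OF F]
  show ?thesis using X unfolding submodule_def
    by (auto simp: hom_vec[OF m F] mult_mat_vec_zero[OF Fc] mult_add_distrib_mat_vec[OF Fc] mult_mat_vec[OF Fc]
      intro: mult_mat_vec_carrier[OF is_moduleD(1)[OF m(1)]])
qed

lemma kernel_submodule:
  assumes m: "is_module H V" "is_module H W" and F: "hom H V W F"
  shows "submodule H V {v \<in> vecs V. F *\<^sub>v v = 0\<^sub>v (rdim W)}"
  using preimage_submodule[OF m F submodule_zero[OF m(2)]] by simp

lemma image_submodule:
  assumes m: "is_module H V" "is_module H W" and F: "hom H V W F" and U: "submodule H V U"
  shows "submodule H W ((*\<^sub>v) F ` U)"
proof -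
  note Fc = homD(1)[OF F]
  have Uc: "u \<in> vecs V" if "u \<in> U" for u using U that by (auto simp: submodule_def)
  show ?thesis unfolding submodule_def
  proof (intro conjI ballI allI impI)
    show "(*\<^sub>v) F ` U \<subseteq> vecs W" using mult_mat_vec_carrier[OF Fc Uc] by blast
    show "0\<^sub>v (rdim W) \<in> (*\<^sub>v) F ` U"
      using U mult_mat_vec_zero[OF Fc] unfolding submodule_def by (metis imageI)
  next
    fix x y assume "x \<in> (*\<^sub>v) F ` U" "y \<in> (*\<^sub>v) F ` U"
    then obtain a b where "a \<in> U" "b \<in> U" "x = F *\<^sub>v a" "y = F *\<^sub>v b" by blast
    moreover from this have "a + b \<in> U" using U unfolding submodule_def by blast
    ultimately show "x + y \<in> (*\<^sub>v) F ` U" using mult_add_distrib_mat_vec[OF Fc Uc Uc] by (metis imageI)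
  next
    fix c x assume "x \<in> (*\<^sub>v) F ` U"
    then obtain a where "a \<in> U" "x = F *\<^sub>v a" by blast
    moreover from this have "c \<cdot>\<^sub>v a \<in> U" using U unfolding submodule_def by blast
    ultimately show "c \<cdot>\<^sub>v x \<in> (*\<^sub>v) F ` U" using mult_mat_vec[OF Fc Uc] by (metis imageI)
  next
    fix i x assume i: "i < hdim H" and "x \<in> (*\<^sub>v) F ` U"
    then obtain a where "a \<in> U" "x = F *\<^sub>v a" by blast
    moreover from this have "ract V i *\<^sub>v a \<in> U" using U i unfolding submodule_def by blast
    ultimately show "ract W i *\<^sub>v x \<in> (*\<^sub>v) F ` U" using hom_vec[OF m F i Uc] by (metis imageI)
  qed
qed

lemma mult_mat_entry:
  assumes "A \<in> carrier_mat n m" "B \<in> carrier_mat m s" "a < n" "b < s"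
  shows "(A * B) $$ (a, b) = (\<Sum>x<m. A $$ (a, x) * B $$ (x, b))"
proof -
  have "(A * B) $$ (a, b) = row A a \<bullet> col B b" using assms by simp
  also have "\<dots> = (\<Sum>x<m. A $$ (a, x) * B $$ (x, b))"
    unfolding scalar_prod_def lessThan_atLeast0 using assms by (intro sum.cong) auto
  finally show ?thesis .
qed

lemma mult_mat_triple_entry:
  assumes F: "F \<in> carrier_mat r n" and M: "M \<in> carrier_mat n m" and G: "G \<in> carrier_mat m s"
    and ab: "a < r" "b < s"
  shows "(F * M * G) $$ (a, b) = (\<Sum>y<m. \<Sum>x<n. F $$ (a, x) * M $$ (x, y) * G $$ (y, b))"
proof -
  have "(F * M * G) $$ (a, b) = (\<Sum>y<m. (F * M) $$ (a, y) * G $$ (y, b))"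
    by (rule mult_mat_entry[OF mult_carrier_mat[OF F M] G ab])
  also have "\<dots> = (\<Sum>y<m. \<Sum>x<n. F $$ (a, x) * M $$ (x, y) * G $$ (y, b))"
    by (intro sum.cong refl) (simp add: mult_mat_entry[OF F M ab(1)] sum_distrib_right)
  finally show ?thesis .
qed

lemma lincomb_carrier: "lincomb H V c \<in> mats V V"
  by (simp add: lincomb_def)

lemma lincomb_conj:
  assumes V: "is_module H V" and F: "F \<in> carrier_mat r (rdim V)" and G: "G \<in> carrier_mat (rdim V) r"
  shows "F * lincomb H V c * G = lincomb H (r, \<lambda>i. F * ract V i * G) c" (is "?L = ?R")
proof (rule eq_matI)
  fix a b assume "a < dim_row ?R" "b < dim_col ?R"
  hence ab: "a < r" "b < r" by (auto simp: lincomb_def rdim_def)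
  let ?n = "rdim V"
  have "?L $$ (a, b) = (\<Sum>y<?n. \<Sum>x<?n. F $$ (a, x) * lincomb H V c $$ (x, y) * G $$ (y, b))"
    by (rule mult_mat_triple_entry[OF F lincomb_carrier G ab])
  also have "\<dots> = (\<Sum>y<?n. \<Sum>x<?n. \<Sum>l<hdim H. c l * (F $$ (a, x) * ract V l $$ (x, y) * G $$ (y, b)))"
    by (intro sum.cong refl) (simp add: lincomb_def sum_distrib_left sum_distrib_right mult_ac)
  also have "\<dots> = (\<Sum>y<?n. \<Sum>l<hdim H. \<Sum>x<?n. c l * (F $$ (a, x) * ract V l $$ (x, y) * G $$ (y, b)))"
    by (intro sum.cong refl sum.swap)
  also have "\<dots> = (\<Sum>l<hdim H. \<Sum>y<?n. \<Sum>x<?n. c l * (F $$ (a, x) * ract V l $$ (x, y) * G $$ (y, b)))"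
    by (rule sum.swap)
  also have "\<dots> = (\<Sum>l<hdim H. c l * (F * ract V l * G) $$ (a, b))"
    by (intro sum.cong refl)
      (simp add: mult_mat_triple_entry[OF F is_moduleD(1)[OF V] G ab] sum_distrib_left)
  also have "\<dots> = ?R $$ (a, b)" using ab by (simp add: lincomb_def rdim_def ract_def)
  finally show "?L $$ (a, b) = ?R $$ (a, b)" .
qed (use F G in \<open>auto simp: lincomb_def rdim_def\<close>)

text \<open>Serves quotients and submodules alike: the action is compressed by a pair with
  \<open>F * G = 1\<close>. The unit law is automatic, but \<open>G * F\<close> sits between the
  factors of a product and need not be the identity, so multiplicativity is left to be supplied from
  the stability of the subspace at hand.\<close>

lemma is_module_conj:
  assumes V: "is_module H V" and F: "F \<in> carrier_mat r (rdim V)" and G: "G \<in> carrier_mat (rdim V) r"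
    and FG: "F * G = 1\<^sub>m r"
    and mul: "\<And>i j. i < hdim H \<Longrightarrow> j < hdim H \<Longrightarrow>
       (F * ract V i * G) * (F * ract V j * G) = F * (ract V i * ract V j) * G"
  shows "is_module H (r, \<lambda>i. F * ract V i * G)"
proof -
  let ?M = "(r, \<lambda>i. F * ract V i * G)"
  have d: "rdim ?M = r" "\<And>i. ract ?M i = F * ract V i * G" by (auto simp: rdim_def ract_def)
  show ?thesis unfolding is_module_def d
  proof (intro conjI allI impI)
    fix i assume "i < hdim H"
    thus "F * ract V i * G \<in> carrier_mat r r"
      by (intro mult_carrier_mat[OF mult_carrier_mat[OF F is_moduleD(1)[OF V]] G])
  next
    fix i j assume ij: "i < hdim H" "j < hdim H"
    show "(F * ract V i * G) * (F * ract V j * G) = lincomb H ?M (hmu H i j)"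
      unfolding mul[OF ij] is_moduleD(2)[OF V ij] by (rule lincomb_conj[OF V F G])
  next
    have "lincomb H ?M (heta H) = F * lincomb H V (heta H) * G" by (rule lincomb_conj[OF V F G, symmetric])
    also have "\<dots> = 1\<^sub>m r" unfolding is_moduleD(3)[OF V] right_mult_one_mat[OF F] by (rule FG)
    finally show "lincomb H ?M (heta H) = 1\<^sub>m r" .
  qed
qed

text \<open>Since \<open>U\<close> is stable, \<open>F * ract V i\<close> vanishes on the kernel of
  \<open>F\<close> and hence factors through \<open>F\<close>. The resulting identity
  \<open>hm\<close> both makes \<open>F\<close> equivariant for the compressed action and cancels
  the inner \<open>G * F\<close> in products.\<close>

lemma quotient_module:
  assumes V: "is_module H V" and U: "submodule H V U"
  obtains Q F G where "is_module H Q" "hom H V Q F" "G \<in> mats Q V"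
    "F * G = 1\<^sub>m (rdim Q)" "\<And>v. v \<in> vecs V \<Longrightarrow> F *\<^sub>v v = 0\<^sub>v (rdim Q) \<longleftrightarrow> v \<in> U"
proof -
  have s: "subsp (rdim V) U" using U by (simp add: submodule_iff)
  obtain r F G where F: "F \<in> carrier_mat r (rdim V)" "G \<in> carrier_mat (rdim V) r" "F * G = 1\<^sub>m r"
     "\<And>v. v\<in>vecs V \<Longrightarrow> F *\<^sub>v v = 0\<^sub>v r \<longleftrightarrow> v \<in> U" by (rule subsp_quotient[OF s]) (rule that)
  let ?Q = "(r, \<lambda>i. F * ract V i * G)"
  have d: "rdim ?Q = r" "\<And>i. ract ?Q i = F * ract V i * G" by (auto simp: rdim_def ract_def)
  note c = is_moduleD(1)[OF V]
  have E: "F * ract V i * (G * F) = F * ract V i" if i: "i < hdim H" for i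
  proof (rule kernel_imp_factor[OF F(1-3) mult_carrier_mat[OF F(1) c[OF i]]])
    fix v assume v: "v \<in> vecs V" "F *\<^sub>v v = 0\<^sub>v r"
    hence "v \<in> U" using F(4) by blast
    hence "ract V i *\<^sub>v v \<in> U" using U i by (auto simp: submodule_def)
    hence "F *\<^sub>v (ract V i *\<^sub>v v) = 0\<^sub>v r" using F(4) mult_mat_vec_carrier[OF c[OF i] v(1)] by blast
    thus "F * ract V i *\<^sub>v v = 0\<^sub>v r" using assoc_mult_mat_vec[OF F(1) c[OF i] v(1)] by simp
  qed
  have hm: "F * ract V i = F * ract V i * G * F" if i: "i < hdim H" for i
    using E[OF i] assoc_mult_mat[OF mult_carrier_mat[OF F(1) c[OF i]] F(2,1)] by simp
  have mul: "(F * ract V i * G) * (F * ract V j * G) = F * (ract V i * ract V j) * G"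
    if ij: "i < hdim H" "j < hdim H" for i j
  proof -
    note Fi = mult_carrier_mat[OF F(1) c[OF ij(1)]] and Fj = mult_carrier_mat[OF F(1) c[OF ij(2)]]
    have "(F * ract V i * G) * (F * ract V j * G) = (F * ract V i * G) * (F * ract V j) * G"
      by (rule assoc_mult_mat[OF mult_carrier_mat[OF Fi F(2)] Fj F(2), symmetric])
    also have "(F * ract V i * G) * (F * ract V j) = F * ract V i * G * F * ract V j"
      by (rule assoc_mult_mat[OF mult_carrier_mat[OF Fi F(2)] F(1) c[OF ij(2)], symmetric])
    also have "\<dots> = F * ract V i * ract V j" by (simp only: hm[OF ij(1), symmetric])
    also have "\<dots> = F * (ract V i * ract V j)" by (rule assoc_mult_mat[OF F(1) c[OF ij(1)] c[OF ij(2)]])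
    finally show ?thesis .
  qed
  have Q: "is_module H ?Q" by (rule is_module_conj[OF V F(1-3) mul])
  have h: "hom H V ?Q F" unfolding hom_def d using F(1) hm by blast
  show thesis by (rule that[of ?Q F G, unfolded d, OF Q h F(2-4)])
qed

text \<open>Dual to the quotient: stability of \<open>U\<close> lets \<open>J * K\<close> act as the
  identity in front of \<open>ract V i * J\<close>, so \<open>J\<close> is equivariant and the
  compressed action multiplicative. The coordinate map \<open>K\<close> is claimed to respect the
  action on \<open>U\<close> alone.\<close>

lemma submodule_rep:
  assumes V: "is_module H V" and U: "submodule H V U"
  obtains M J K where "is_module H M" "hom H M V J" "K \<in> mats V M"
    "K * J = 1\<^sub>m (rdim M)" "U = (*\<^sub>v) J ` vecs M"
    "\<And>u. u \<in> U \<Longrightarrow> J *\<^sub>v (K *\<^sub>v u) = u"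
    "\<And>i u. i < hdim H \<Longrightarrow> u \<in> U \<Longrightarrow> K *\<^sub>v (ract V i *\<^sub>v u) = ract M i *\<^sub>v (K *\<^sub>v u)"
proof -
  have s: "subsp (rdim V) U" using U by (simp add: submodule_iff)
  let ?n = "rdim V"
  obtain r J K where J: "J \<in> carrier_mat ?n r" "K \<in> carrier_mat r ?n" "K * J = 1\<^sub>m r"
     "U = (*\<^sub>v) J ` carrier_vec r" "\<And>u. u \<in> U \<Longrightarrow> J *\<^sub>v (K *\<^sub>v u) = u"
    by (rule subsp_basis[OF s]) (rule that)
  let ?M = "(r, \<lambda>i. K * ract V i * J)"
  have d: "rdim ?M = r" "\<And>i. ract ?M i = K * ract V i * J" by (auto simp: rdim_def ract_def)
  note c = is_moduleD(1)[OF V]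
  have Uc: "u \<in> carrier_vec ?n" if "u \<in> U" for u using U that by (auto simp: submodule_def)
  have hm: "J * (K * ract V i * J) = ract V i * J" if i: "i < hdim H" for i
  proof (rule mat_eq_by_vec)
    note KV = mult_carrier_mat[OF J(2) c[OF i]]
    show "J * (K * ract V i * J) \<in> carrier_mat ?n r"
      by (rule mult_carrier_mat[OF J(1) mult_carrier_mat[OF KV J(1)]])
    show "ract V i * J \<in> carrier_mat ?n r" by (rule mult_carrier_mat[OF c[OF i] J(1)])
    fix v :: "'a vec" assume v: "v \<in> carrier_vec r"
    have Jv: "J *\<^sub>v v \<in> U" using v J(4) by blast
    hence u: "ract V i *\<^sub>v (J *\<^sub>v v) \<in> U" using U i by (auto simp: submodule_def)
    have "J * (K * ract V i * J) *\<^sub>v v = J *\<^sub>v (K *\<^sub>v (ract V i *\<^sub>v (J *\<^sub>v v)))"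
      by (simp only: assoc_mult_mat_vec[OF J(1) mult_carrier_mat[OF KV J(1)] v]
          assoc_mult_mat_vec[OF KV J(1) v] assoc_mult_mat_vec[OF J(2) c[OF i] Uc[OF Jv]])
    also have "\<dots> = ract V i *\<^sub>v (J *\<^sub>v v)" by (rule J(5)[OF u])
    also have "\<dots> = ract V i * J *\<^sub>v v" by (rule assoc_mult_mat_vec[OF c[OF i] J(1) v, symmetric])
    finally show "J * (K * ract V i * J) *\<^sub>v v = ract V i * J *\<^sub>v v" .
  qed
  have mul: "(K * ract V i * J) * (K * ract V j * J) = K * (ract V i * ract V j) * J"
    if ij: "i < hdim H" "j < hdim H" for i j
  proof -
    note Ki = mult_carrier_mat[OF J(2) c[OF ij(1)]] and Kj = mult_carrier_mat[OF J(2) c[OF ij(2)]]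
    have "(K * ract V i * J) * (K * ract V j * J) = (K * ract V i) * (J * (K * ract V j * J))"
      by (rule assoc_mult_mat[OF Ki J(1) mult_carrier_mat[OF Kj J(1)]])
    also have "\<dots> = (K * ract V i) * (ract V j * J)" by (simp only: hm[OF ij(2)])
    also have "\<dots> = (K * ract V i) * ract V j * J" by (rule assoc_mult_mat[OF Ki c[OF ij(2)] J(1), symmetric])
    also have "(K * ract V i) * ract V j = K * (ract V i * ract V j)" by (rule assoc_mult_mat[OF J(2) c[OF ij(1)] c[OF ij(2)]])
    finally show ?thesis .
  qed
  have M: "is_module H ?M" by (rule is_module_conj[OF V J(2,1,3) mul])
  have h: "hom H ?M V J" unfolding hom_def d using J(1) hm by blast
  have K: "K *\<^sub>v (ract V i *\<^sub>v u) = ract ?M i *\<^sub>v (K *\<^sub>v u)" if i: "i < hdim H" and u: "u \<in> U" for i u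
  proof -
    have Ku: "K *\<^sub>v u \<in> carrier_vec r" by (rule mult_mat_vec_carrier[OF J(2) Uc[OF u]])
    have "ract ?M i *\<^sub>v (K *\<^sub>v u) = K * ract V i *\<^sub>v (J *\<^sub>v (K *\<^sub>v u))"
      unfolding d by (rule assoc_mult_mat_vec[OF mult_carrier_mat[OF J(2) c[OF i]] J(1) Ku])
    also have "\<dots> = K *\<^sub>v (ract V i *\<^sub>v u)"
      unfolding J(5)[OF u] by (rule assoc_mult_mat_vec[OF J(2) c[OF i] Uc[OF u]])
    finally show ?thesis by simp
  qed
  show thesis by (rule that[of ?M J K, unfolded d, OF M h J(2-5) K[unfolded d]])
qed

lemma mat_zero_iff_vec:
  fixes f :: "'k::field mat"
  assumes f: "f \<in> carrier_mat m n"
  shows "f = 0\<^sub>m m n \<longleftrightarrow> (\<forall>v\<in>carrier_vec n. f *\<^sub>v v = 0\<^sub>v m)"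
proof
  assume "f = 0\<^sub>m m n"
  thus "\<forall>v\<in>carrier_vec n. f *\<^sub>v v = 0\<^sub>v m" by auto
next
  assume z: "\<forall>v\<in>carrier_vec n. f *\<^sub>v v = 0\<^sub>v m"
  show "f = 0\<^sub>m m n" by (rule mat_eq_by_vec[OF f zero_carrier_mat]) (use z in auto)
qed

lemma hom_add_smult:
  assumes m: "is_module H V" "is_module H W" and f: "hom H V W f" and g: "hom H V W g"
  shows "hom H V W (f + k \<cdot>\<^sub>m g)"
  unfolding hom_def
proof (intro conjI allI impI)
  note fc = homD(1)[OF f] and gc = homD(1)[OF g]
  have kg: "k \<cdot>\<^sub>m g \<in> mats V W" using gc by simp
  show "f + k \<cdot>\<^sub>m g \<in> mats V W" using kg by simp
  fix i assume i: "i < hdim H"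
  note c = is_moduleD(1)[OF m(1) i] is_moduleD(1)[OF m(2) i]
  have "(f + k \<cdot>\<^sub>m g) * ract V i = f * ract V i + k \<cdot>\<^sub>m g * ract V i" by (rule add_mult_distrib_mat[OF fc kg c(1)])
  also have "k \<cdot>\<^sub>m g * ract V i = k \<cdot>\<^sub>m (g * ract V i)" by (rule mult_smult_assoc_mat[OF gc c(1)])
  also have "\<dots> = k \<cdot>\<^sub>m (ract W i * g)" by (simp only: homD(2)[OF g i])
  also have "\<dots> = ract W i * (k \<cdot>\<^sub>m g)" by (rule mult_smult_distrib[OF c(2) gc, symmetric])
  also have "f * ract V i + \<dots> = ract W i * (f + k \<cdot>\<^sub>m g)"
    unfolding homD(2)[OF f i] by (rule mult_add_distrib_mat[OF c(2) fc kg, symmetric])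
  finally show "(f + k \<cdot>\<^sub>m g) * ract V i = ract W i * (f + k \<cdot>\<^sub>m g)" .
qed

lemma hom_id:
  assumes V: "is_module H V"
  shows "hom H V V (1\<^sub>m (rdim V))"
  unfolding hom_def using left_mult_one_mat[OF is_moduleD(1)[OF V]] right_mult_one_mat[OF is_moduleD(1)[OF V]] by simp

lemma add_smult_mult_vec:
  fixes f :: "'k::field mat"
  assumes f: "f \<in> carrier_mat m n" and g: "g \<in> carrier_mat m n" and v: "v \<in> carrier_vec n"
  shows "(f + k \<cdot>\<^sub>m g) *\<^sub>v v = f *\<^sub>v v + k \<cdot>\<^sub>v (g *\<^sub>v v)"
proof -
  have "(f + k \<cdot>\<^sub>m g) *\<^sub>v v = f *\<^sub>v v + (k \<cdot>\<^sub>m g) *\<^sub>v v"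
    by (rule add_mult_distrib_mat_vec[OF f _ v]) (use g in simp)
  also have "(k \<cdot>\<^sub>m g) *\<^sub>v v = k \<cdot>\<^sub>v (g *\<^sub>v v)"
    using g v by (intro eq_vecI) (auto simp: smult_scalar_prod_distrib[of _ n])
  finally show ?thesis .
qed

section \<open>Simple modules and projective covers\<close>

text \<open>Chosen preimages of the unit vectors form the columns of \<open>G\<close>. This section
  is only linear; when \<open>F\<close> is a module map it need not be equivariant.\<close>

lemma surjective_right_inverse:
  fixes F :: "'k::field mat"
  assumes F: "F \<in> carrier_mat r n" and s: "\<And>w. w \<in> carrier_vec r \<Longrightarrow> \<exists>v\<in>carrier_vec n. F *\<^sub>v v = w"
  obtains G where "G \<in> carrier_mat n r" "F * G = 1\<^sub>m r"
proof -
  from s have "\<forall>j. \<exists>v\<in>carrier_vec n. F *\<^sub>v v = unit_vec r j" by simp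
  then obtain g where g: "\<And>j. g j \<in> carrier_vec n" "\<And>j. F *\<^sub>v g j = unit_vec r j" by metis
  define G where "G = mat n r (\<lambda>(i,j). g j $ i)"
  have G: "G \<in> carrier_mat n r" by (simp add: G_def)
  have col: "col G j = g j" if "j < r" for j
    using that g(1)[of j] by (intro eq_vecI) (auto simp: G_def)
  have "F * G = 1\<^sub>m r"
  proof (rule eq_matI)
    fix i j assume "i < dim_row (1\<^sub>m r :: 'k mat)" "j < dim_col (1\<^sub>m r :: 'k mat)"
    hence ij: "i < r" "j < r" by auto
    have "(F * G) $$ (i,j) = (F *\<^sub>v col G j) $ i" using ij F G by simp
    also have "\<dots> = unit_vec r j $ i" by (simp only: col[OF ij(2)] g(2))
    finally show "(F * G) $$ (i,j) = 1\<^sub>m r $$ (i,j)" using ij by simp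
  qed (use F G in auto)
  thus thesis using that G by blast
qed

lemma bijective_hom_iso:
  assumes m: "is_module H V" "is_module H W" and F: "hom H V W F" and s: "surjective_map V W F"
    and inj: "\<And>v. v \<in> vecs V \<Longrightarrow> F *\<^sub>v v = 0\<^sub>v (rdim W) \<Longrightarrow> v = 0\<^sub>v (rdim V)"
  shows "iso H V W"
proof -
  note Fc = homD(1)[OF F]
  obtain G where G: "G \<in> mats W V" "F * G = 1\<^sub>m (rdim W)"
    by (rule surjective_right_inverse[OF Fc]) (use s in \<open>auto simp: surjective_map_def\<close>)
  have "1\<^sub>m (rdim V) * (G * F) = 1\<^sub>m (rdim V)"
    by (rule kernel_imp_factor[OF Fc G one_carrier_mat]) (use inj in auto)
  hence GF: "G * F = 1\<^sub>m (rdim V)" using left_mult_one_mat[OF mult_carrier_mat[OF G(1) Fc]] by simp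
  have "G * ract W i = ract V i * G" if i: "i < hdim H" for i
  proof -
    note c = is_moduleD(1)[OF m(1) i] is_moduleD(1)[OF m(2) i]
    have "G * ract W i = G * ract W i * (F * G)"
      unfolding G(2) by (rule right_mult_one_mat[OF mult_carrier_mat[OF G(1) c(2)], symmetric])
    also have "\<dots> = G * ract W i * F * G"
      by (rule assoc_mult_mat[OF mult_carrier_mat[OF G(1) c(2)] Fc G(1), symmetric])
    also have "G * ract W i * F = G * (ract W i * F)" by (rule assoc_mult_mat[OF G(1) c(2) Fc])
    also have "\<dots> = G * (F * ract V i)" by (simp only: homD(2)[OF F i])
    also have "\<dots> = G * F * ract V i" by (rule assoc_mult_mat[OF G(1) Fc c(1), symmetric])
    also have "\<dots> = ract V i" unfolding GF by (rule left_mult_one_mat[OF c(1)])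
    finally show ?thesis .
  qed
  hence "hom H W V G" using G(1) by (simp add: hom_def)
  thus ?thesis using F G(2) GF by (auto simp: iso_def)
qed

lemma simple_hom_injective:
  assumes S: "simple_module H S" and W: "is_module H W" and F: "hom H S W F"
    and nz: "F \<noteq> 0\<^sub>m (rdim W) (rdim S)"
    and v: "v \<in> vecs S" "F *\<^sub>v v = 0\<^sub>v (rdim W)"
  shows "v = 0\<^sub>v (rdim S)"
proof -
  have m: "is_module H S" using S by (simp add: simple_module_def)
  let ?U = "{v \<in> vecs S. F *\<^sub>v v = 0\<^sub>v (rdim W)}"
  have "?U = {0\<^sub>v (rdim S)} \<or> ?U = vecs S"
    using S kernel_submodule[OF m W F] unfolding simple_module_def by blast
  moreover have "?U \<noteq> vecs S"
  proof
    assume U: "?U = vecs S"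
    have "F = 0\<^sub>m (rdim W) (rdim S)" unfolding mat_zero_iff_vec[OF homD(1)[OF F]] using U by blast
    thus False using nz by simp
  qed
  ultimately show ?thesis using v by blast
qed

lemma image_mult_mat:
  assumes "A \<in> carrier_mat m n" "B \<in> carrier_mat n k"
  shows "(*\<^sub>v) A ` (*\<^sub>v) B ` carrier_vec k = (*\<^sub>v) (A * B) ` carrier_vec k"
  unfolding image_image by (intro image_cong refl assoc_mult_mat_vec[OF assms, symmetric])

lemma surjective_map_image:
  assumes F: "F \<in> mats V W" and s: "surjective_map V W F"
  shows "(*\<^sub>v) F ` vecs V = vecs W"
proof -
  have "\<exists>v\<in>vecs V. w = F *\<^sub>v v" if "w \<in> vecs W" for w using s that unfolding surjective_map_def by metis
  thus ?thesis using mult_mat_vec_carrier[OF F] by blast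
qed

lemma surjective_mapI: "vecs W = (*\<^sub>v) F ` vecs V \<Longrightarrow> surjective_map V W F"
  by (auto simp: surjective_map_def)

lemma hom_simple_surjective:
  assumes S: "simple_module H S" and M: "is_module H M" and F: "hom H M S F"
    and nz: "F \<noteq> 0\<^sub>m (rdim S) (rdim M)"
  shows "surjective_map M S F"
proof -
  have m: "is_module H S" using S by (simp add: simple_module_def)
  let ?U = "(*\<^sub>v) F ` vecs M"
  have "?U = {0\<^sub>v (rdim S)} \<or> ?U = vecs S"
    using S image_submodule[OF M m F submodule_full[OF M]] unfolding simple_module_def by blast
  moreover have "?U \<noteq> {0\<^sub>v (rdim S)}"
  proof
    assume U: "?U = {0\<^sub>v (rdim S)}"
    have "F = 0\<^sub>m (rdim S) (rdim M)" unfolding mat_zero_iff_vec[OF homD(1)[OF F]] using U by blast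
    thus False using nz by simp
  qed
  ultimately have "?U = vecs S" by blast
  thus ?thesis by (intro surjective_mapI) simp
qed

lemma surjective_map_nonzero:
  assumes "surjective_map P S p" "rdim S > 0"
  shows "p \<noteq> 0\<^sub>m (rdim S) (rdim P)"
proof
  assume p: "p = 0\<^sub>m (rdim S) (rdim P)"
  obtain v where v: "v \<in> vecs P" "p *\<^sub>v v = unit_vec (rdim S) 0"
    using assms(1) unfolding surjective_map_def by (metis unit_vec_carrier)
  have "(p *\<^sub>v v) $ 0 = 0" using v(1) assms(2) unfolding p by simp
  moreover have "unit_vec (rdim S) 0 $ 0 = (1::'a)" using assms(2) by simp
  ultimately show False unfolding v(2) by simp
qed

text \<open>Separates the essential surjection from the projectivity of its source. Fixing
  \<open>p\<close> by name matters later, since homomorphisms from \<open>P\<close> to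
  \<open>S\<close> are expressed as multiples of it.\<close>

definition cover_map :: "('k::field, 'z) hopf_scheme \<Rightarrow> 'k rep \<Rightarrow> 'k rep \<Rightarrow> 'k mat \<Rightarrow> bool" where
  "cover_map H P S p \<longleftrightarrow> hom H P S p \<and> surjective_map P S p \<and>
        (\<forall>U. submodule H P U \<longrightarrow>
            (\<forall>v\<in>vecs P. \<exists>u\<in>U. \<exists>w\<in>vecs P.
                p *\<^sub>v w = 0\<^sub>v (rdim S) \<and> v = u + w) \<longrightarrow>
            U = vecs P)"

lemma projective_cover_map:
  "projective_cover H P S \<longleftrightarrow> projective H P \<and> (\<exists>p. cover_map H P S p)"
  by (simp add: projective_cover_def cover_map_def)

lemma cover_mapD:
  assumes "cover_map H P S p"
  shows "p \<in> mats P S" and "hom H P S p" and "surjective_map P S p"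
  using assms homD(1)[of H P S p] by (auto simp: cover_map_def)

text \<open>If \<open>u\<close> in \<open>U\<close> has the same image as \<open>v\<close>, then
  \<open>v - u\<close> lies in the kernel of \<open>p\<close>. So \<open>U\<close> and the kernel
  together give all of \<open>P\<close>, and \<open>p\<close> is essential.\<close>

lemma cover_map_full:
  assumes p: "cover_map H P S p" and U: "submodule H P U"
    and s: "(*\<^sub>v) p ` U = vecs S"
  shows "U = vecs P"
proof -
  have pc: "p \<in> mats P S" by (rule cover_mapD(1)[OF p])
  have Uc: "u \<in> vecs P" if "u \<in> U" for u using U that by (auto simp: submodule_def)
  have "\<exists>u\<in>U. \<exists>w\<in>vecs P. p *\<^sub>v w = 0\<^sub>v (rdim S) \<and> v = u + w"
    if v: "v \<in> vecs P" for v
  proof -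
    have pv: "p *\<^sub>v v \<in> vecs S" by (rule mult_mat_vec_carrier[OF pc v])
    then obtain u where u: "u \<in> U" "p *\<^sub>v v = p *\<^sub>v u" using s by blast
    have "p *\<^sub>v (v - u) = p *\<^sub>v v - p *\<^sub>v u" by (rule mult_minus_distrib_mat_vec[OF pc v Uc[OF u(1)]])
    also have "\<dots> = 0\<^sub>v (rdim S)" unfolding u(2)[symmetric] using pv by simp
    finally have "p *\<^sub>v (v - u) = 0\<^sub>v (rdim S)" .
    moreover have "v = u + (v - u)" using v Uc[OF u(1)] by (intro eq_vecI) auto
    moreover have "v - u \<in> vecs P" using v Uc[OF u(1)] by simp
    ultimately show ?thesis using u(1) by blast
  qed
  thus ?thesis using p U unfolding cover_map_def by blast
qed

text \<open>The kernel of a nonzero \<open>f\<close> is a proper submodule, so its image under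
  \<open>p\<close> is not all of \<open>S\<close> (\<open>cover_map_full\<close>), hence zero
  because \<open>S\<close> is simple. Thus the kernel of \<open>f\<close> lies in that of
  \<open>p\<close>, and \<open>p\<close> factors through the surjection \<open>f\<close>.\<close>

lemma cover_map_factor:
  assumes p: "cover_map H P S p" and P: "is_module H P" and S: "simple_module H S"
    and S': "simple_module H S'" and f: "hom H P S' f" and nz: "f \<noteq> 0\<^sub>m (rdim S') (rdim P)"
  obtains \<psi> where "hom H S' S \<psi>" "\<psi> * f = p"
proof -
  have m: "is_module H S" "is_module H S'" and S0: "rdim S > 0"
    using S S' by (auto simp: simple_module_def)
  have ph: "hom H P S p" and ps: "surjective_map P S p" using p by (auto simp: cover_map_def)
  note pc = homD(1)[OF ph] and fc = homD(1)[OF f]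
  let ?U = "{v \<in> vecs P. f *\<^sub>v v = 0\<^sub>v (rdim S')}"
  have U: "submodule H P ?U" by (rule kernel_submodule[OF P m(2) f])
  have "(*\<^sub>v) p ` ?U \<noteq> vecs S"
  proof
    assume "(*\<^sub>v) p ` ?U = vecs S"
    from cover_map_full[OF p U this] have U: "?U = vecs P" .
    have "f = 0\<^sub>m (rdim S') (rdim P)" unfolding mat_zero_iff_vec[OF fc] using U by blast
    thus False using nz by simp
  qed
  hence z: "(*\<^sub>v) p ` ?U = {0\<^sub>v (rdim S)}"
    using S image_submodule[OF P m(1) ph U] unfolding simple_module_def by blast
  have fs: "surjective_map P S' f" by (rule hom_simple_surjective[OF S' P f nz])
  obtain G where G: "G \<in> mats S' P" "f * G = 1\<^sub>m (rdim S')"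
    by (rule surjective_right_inverse[OF fc]) (use fs in \<open>auto simp: surjective_map_def\<close>)
  have "p * (G * f) = p" by (rule kernel_imp_factor[OF fc G pc]) (use z in blast)
  \<comment> \<open>\<open>p * G\<close>, with \<open>G\<close> a linear section of
    \<open>f\<close>, is the factor. It is equivariant even though \<open>G\<close> need not be,
    because \<open>p\<close> does not see the difference between \<open>G * f\<close> and the
    identity.\<close>
  hence pf: "p * G * f = p" using assoc_mult_mat[OF pc G(1) fc] by simp
  note \<psi>c = mult_carrier_mat[OF pc G(1)]
  have "p * G * ract S' i = ract S i * (p * G)" if i: "i < hdim H" for i
  proof -
    note c = is_moduleD(1)[OF m(1) i] is_moduleD(1)[OF m(2) i] is_moduleD(1)[OF P i]
    have "p * G * ract S' i = p * G * ract S' i * (f * G)"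
      unfolding G(2) by (rule right_mult_one_mat[OF mult_carrier_mat[OF \<psi>c c(2)], symmetric])
    also have "\<dots> = p * G * ract S' i * f * G"
      by (rule assoc_mult_mat[OF mult_carrier_mat[OF \<psi>c c(2)] fc G(1), symmetric])
    also have "p * G * ract S' i * f = p * G * (ract S' i * f)" by (rule assoc_mult_mat[OF \<psi>c c(2) fc])
    also have "\<dots> = p * G * (f * ract P i)" by (simp only: homD(2)[OF f i])
    also have "\<dots> = p * G * f * ract P i" by (rule assoc_mult_mat[OF \<psi>c fc c(3), symmetric])
    also have "\<dots> = ract S i * p" by (simp only: pf homD(2)[OF ph i])
    also have "ract S i * p * G = ract S i * (p * G)" by (rule assoc_mult_mat[OF c(1) pc G(1)])
    finally show ?thesis .
  qed
  hence "hom H S' S (p * G)" using \<psi>c by (simp add: hom_def)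
  thus thesis using that pf by blast
qed

text \<open>A projective cover has just one simple quotient: the factor \<open>\<psi>\<close> is a
  nonzero map between simple modules, so it is bijective.\<close>

lemma cover_hom_iso:
  assumes p: "cover_map H P S p" and P: "is_module H P" and S: "simple_module H S"
    and S': "simple_module H S'" and f: "hom H P S' f" and nz: "f \<noteq> 0\<^sub>m (rdim S') (rdim P)"
  shows "iso H S' S"
proof -
  have m: "is_module H S" "is_module H S'" and S0: "rdim S > 0"
    using S S' by (auto simp: simple_module_def)
  obtain \<psi> where \<psi>: "hom H S' S \<psi>" "\<psi> * f = p" by (rule cover_map_factor[OF assms])
  have "p \<noteq> 0\<^sub>m (rdim S) (rdim P)" using p surjective_map_nonzero[OF _ S0] by (auto simp: cover_map_def)
  hence nz: "\<psi> \<noteq> 0\<^sub>m (rdim S) (rdim S')" using \<psi>(2) left_mult_zero_mat[OF homD(1)[OF f]] by auto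
  show ?thesis
    by (rule bijective_hom_iso[OF m(2,1) \<psi>(1) hom_simple_surjective[OF S m(2) \<psi>(1) nz]
        simple_hom_injective[OF S' m(1) \<psi>(1) nz]])
qed

text \<open>Over an algebraically closed field the characteristic polynomial has a root
  \<open>k\<close>. The equivariant map \<open>\<psi> - k\<close> kills an eigenvector, so it is not
  injective on a simple module and must vanish.\<close>

lemma schur_scalar:
  fixes S :: "'k::field rep"
  assumes ac: "algebraically_closed_field TYPE('k)" and S: "simple_module H S" and \<psi>: "hom H S S \<psi>"
  obtains c where "\<psi> = c \<cdot>\<^sub>m 1\<^sub>m (rdim S)"
proof -
  let ?n = "rdim S"
  have m: "is_module H S" and n0: "?n > 0" using S by (auto simp: simple_module_def)
  note c = homD(1)[OF \<psi>]
  have "degree (char_poly \<psi>) = ?n" using degree_monic_char_poly[OF c] by simp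
  then obtain k where "poly (char_poly \<psi>) k = 0" using ac n0 unfolding algebraically_closed_field_def by metis
  hence "eigenvalue \<psi> k" using eigenvalue_root_char_poly[OF c] by simp
  then obtain v where v: "v \<in> carrier_vec ?n" "v \<noteq> 0\<^sub>v ?n" "\<psi> *\<^sub>v v = k \<cdot>\<^sub>v v"
    using c unfolding eigenvalue_def eigenvector_def by auto
  let ?D = "\<psi> + (- k) \<cdot>\<^sub>m 1\<^sub>m ?n"
  have Dh: "hom H S S ?D" by (rule hom_add_smult[OF m m \<psi> hom_id[OF m]])
  have "?D *\<^sub>v v = \<psi> *\<^sub>v v + (- k) \<cdot>\<^sub>v (1\<^sub>m ?n *\<^sub>v v)" by (rule add_smult_mult_vec[OF c one_carrier_mat v(1)])
  also have "\<dots> = 0\<^sub>v ?n" unfolding v(3) using v(1) by (intro eq_vecI) auto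
  finally have Dv: "?D *\<^sub>v v = 0\<^sub>v ?n" .
  have D: "?D = 0\<^sub>m ?n ?n" using simple_hom_injective[OF S m Dh _ v(1) Dv] v(2) by blast
  have "\<psi> = k \<cdot>\<^sub>m 1\<^sub>m ?n"
  proof (rule eq_matI)
    fix i j assume ij: "i < dim_row (k \<cdot>\<^sub>m 1\<^sub>m ?n)" "j < dim_col (k \<cdot>\<^sub>m 1\<^sub>m ?n)"
    have "?D $$ (i,j) = 0" unfolding D using ij by simp
    thus "\<psi> $$ (i,j) = (k \<cdot>\<^sub>m 1\<^sub>m ?n) $$ (i,j)" using ij c by (auto split: if_splits)
  qed (use c in auto)
  thus thesis by (rule that)
qed

text \<open>The factorization runs in the opposite direction: a nonzero \<open>f\<close> gives
  \<open>p = \<psi> * f\<close> with \<open>\<psi>\<close> a scalar \<open>k\<close>. As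
  \<open>p\<close> is nonzero so is \<open>k\<close>, and it can be inverted.\<close>

lemma cover_hom_scalar:
  fixes S :: "'k::field rep"
  assumes ac: "algebraically_closed_field TYPE('k)"
    and p: "cover_map H P S p" and P: "is_module H P" and S: "simple_module H S"
    and f: "hom H P S f"
  obtains c where "f = c \<cdot>\<^sub>m p"
proof (cases "f = 0\<^sub>m (rdim S) (rdim P)")
  case True
  have pc: "p \<in> mats P S" by (rule cover_mapD(1)[OF p])
  have "f = 0 \<cdot>\<^sub>m p" unfolding True using pc by (intro eq_matI) auto
  thus thesis by (rule that)
next
  case False
  have m: "is_module H S" and S0: "rdim S > 0" using S by (auto simp: simple_module_def)
  note fc = homD(1)[OF f]
  obtain \<psi> where \<psi>: "hom H S S \<psi>" "\<psi> * f = p" by (rule cover_map_factor[OF p P S S f False])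
  obtain k where k: "\<psi> = k \<cdot>\<^sub>m 1\<^sub>m (rdim S)" by (rule schur_scalar[OF ac S \<psi>(1)])
  have pk: "p = k \<cdot>\<^sub>m f"
    using \<psi>(2) mult_smult_assoc_mat[OF one_carrier_mat fc, of k] left_mult_one_mat[OF fc] unfolding k by simp
  have "p \<noteq> 0\<^sub>m (rdim S) (rdim P)" using p surjective_map_nonzero[OF _ S0] by (auto simp: cover_map_def)
  hence "k \<noteq> 0" using pk fc by (auto intro!: eq_matI)
  hence "f = inverse k \<cdot>\<^sub>m p" unfolding pk by (intro eq_matI) (auto simp: field_simps)
  thus thesis by (rule that)
qed

section \<open>Maximal submodules, composition series and simple subquotients\<close>

lemma maximal_submodule_below:
  assumes U: "submodule H V U" and T: "submodule H V T" and lt: "U \<subset> T"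
  obtains X where "submodule H V X" "U \<subseteq> X" "X \<subset> T"
    "\<And>Y. submodule H V Y \<Longrightarrow> X \<subseteq> Y \<Longrightarrow> Y \<subseteq> T \<Longrightarrow> Y = X \<or> Y = T"
proof -
  let ?P = "\<lambda>X. submodule H V X \<and> U \<subseteq> X \<and> X \<subset> T"
  \<comment> \<open>Dimensions are bounded by that of \<open>V\<close>, so among the candidates
    there is one of greatest dimension; by \<open>sdim_less\<close> nothing fits strictly between it
    and \<open>T\<close>.\<close>
  have "\<forall>X. ?P X \<longrightarrow> sdim (rdim V) X < Suc (rdim V)"
    using sdim_le by (auto simp: submodule_iff less_Suc_eq_le)
  then obtain X where X: "?P X" "\<And>Y. ?P Y \<Longrightarrow> sdim (rdim V) Y \<le> sdim (rdim V) X"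
    using ex_has_greatest_nat[of ?P U "sdim (rdim V)" "Suc (rdim V)"] U lt by blast
  have "Y = X \<or> Y = T" if Y: "submodule H V Y" "X \<subseteq> Y" "Y \<subseteq> T" for Y
  proof (rule ccontr)
    assume n: "\<not> (Y = X \<or> Y = T)"
    hence "?P Y" using X(1) Y by blast
    hence "sdim (rdim V) Y \<le> sdim (rdim V) X" by (rule X(2))
    moreover have "sdim (rdim V) X < sdim (rdim V) Y"
      using X(1) Y n by (intro sdim_less) (auto simp: submodule_iff)
    ultimately show False by simp
  qed
  thus thesis using that[of X] X(1) by blast
qed

text \<open>Induction on the dimension of \<open>U\<close>: a maximal proper submodule has a series,
  and \<open>U\<close> is appended to it. Treating all submodules of one fixed \<open>V\<close>
  keeps every member of the series inside the same ambient space.\<close>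

lemma comp_series_below:
  assumes V: "is_module H V" and U: "submodule H V U"
  shows "\<exists>Us. Us \<noteq> [] \<and> hd Us = {0\<^sub>v (rdim V)} \<and> last Us = U \<and>
     (\<forall>k<length Us. submodule H V (Us ! k)) \<and>
     (\<forall>k. Suc k < length Us \<longrightarrow> Us ! k \<subset> Us ! Suc k \<and>
        (\<forall>U. submodule H V U \<and> Us ! k \<subseteq> U \<and> U \<subseteq> Us ! Suc k \<longrightarrow>
             U = Us ! k \<or> U = Us ! Suc k))"
  using U
proof (induction "sdim (rdim V) U" arbitrary: U rule: less_induct)
  case less
  show ?case
  proof (cases "U = {0\<^sub>v (rdim V)}")
    case True
    thus ?thesis using less.prems by (intro exI[of _ "[U]"]) auto
  next
    case False
    hence "{0\<^sub>v (rdim V)} \<subset> U" using less.prems by (auto simp: submodule_def)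
    then obtain X where X: "submodule H V X" "X \<subset> U"
      "\<And>Y. submodule H V Y \<Longrightarrow> X \<subseteq> Y \<Longrightarrow> Y \<subseteq> U \<Longrightarrow> Y = X \<or> Y = U"
      using maximal_submodule_below[OF submodule_zero[OF V] less.prems] by metis
    have "sdim (rdim V) X < sdim (rdim V) U"
      using X less.prems by (intro sdim_less) (auto simp: submodule_iff)
    from less.hyps[OF this X(1)] obtain Us where Us: "Us \<noteq> []" "hd Us = {0\<^sub>v (rdim V)}" "last Us = X"
      "\<forall>k<length Us. submodule H V (Us ! k)"
      "\<forall>k. Suc k < length Us \<longrightarrow> Us ! k \<subset> Us ! Suc k \<and>
        (\<forall>U. submodule H V U \<and> Us ! k \<subseteq> U \<and> U \<subseteq> Us ! Suc k \<longrightarrow> U = Us ! k \<or> U = Us ! Suc k)"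
      by blast
    have lastX: "Us ! (length Us - 1) = X" using Us(1,3) by (simp add: last_conv_nth)
    show ?thesis
    proof (intro exI[of _ "Us @ [U]"] conjI allI impI)
      fix k assume "k < length (Us @ [U])"
      thus "submodule H V ((Us @ [U]) ! k)" using Us(4) less.prems by (auto simp: nth_append)
    next
      fix k assume k: "Suc k < length (Us @ [U])"
      consider "Suc k < length Us" | "k = length Us - 1" "Suc k = length Us" using k by fastforce
      hence "(Us @ [U]) ! k \<subset> (Us @ [U]) ! Suc k \<and>
        (\<forall>Y. submodule H V Y \<and> (Us @ [U]) ! k \<subseteq> Y \<and> Y \<subseteq> (Us @ [U]) ! Suc k \<longrightarrow>
          Y = (Us @ [U]) ! k \<or> Y = (Us @ [U]) ! Suc k)"
      proof cases
        case 1
        thus ?thesis using Us(5) by (simp add: nth_append)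
      next
        case 2
        have "(Us @ [U]) ! k = X" "(Us @ [U]) ! Suc k = U" using 2 lastX Us(1) by (auto simp: nth_append)
        thus ?thesis using X by simp
      qed
      thus "(Us @ [U]) ! k \<subset> (Us @ [U]) ! Suc k"
        "\<And>Y. submodule H V Y \<and> (Us @ [U]) ! k \<subseteq> Y \<and> Y \<subseteq> (Us @ [U]) ! Suc k \<Longrightarrow>
          Y = (Us @ [U]) ! k \<or> Y = (Us @ [U]) ! Suc k" by blast+
    qed (use Us(1,2) in auto)
  qed
qed

lemma comp_series_exists: "is_module H V \<Longrightarrow> \<exists>Us. comp_series H V Us"
  using comp_series_below[OF _ submodule_full] unfolding comp_series_def by blast

text \<open>\<open>U'\<close> is presented as a module \<open>M\<close> and divided by the preimage
  of \<open>U\<close>. The map \<open>F = A * K\<close> is a matrix on the whole of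
  \<open>V\<close>, but its equivariance is asserted on \<open>U'\<close> only, in accordance with
  \<open>factor_iso\<close>.\<close>

lemma simple_subquotient:
  assumes V: "is_module H V" and U: "submodule H V U" and U': "submodule H V U'" and lt: "U \<subset> U'"
    and max: "\<And>Y. submodule H V Y \<Longrightarrow> U \<subseteq> Y \<Longrightarrow> Y \<subseteq> U' \<Longrightarrow> Y = U \<or> Y = U'"
  obtains X F where "simple_module H X" "F \<in> mats V X"
    "\<And>i u. i < hdim H \<Longrightarrow> u \<in> U' \<Longrightarrow> F *\<^sub>v (ract V i *\<^sub>v u) = ract X i *\<^sub>v (F *\<^sub>v u)"
    "(*\<^sub>v) F ` U' = vecs X"
    "\<And>u. u \<in> U' \<Longrightarrow> F *\<^sub>v u = 0\<^sub>v (rdim X) \<longleftrightarrow> u \<in> U"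
proof -
  obtain M J K where M: "is_module H M" "hom H M V J" "K \<in> mats V M"
    "K * J = 1\<^sub>m (rdim M)" "U' = (*\<^sub>v) J ` vecs M"
    "\<And>u. u \<in> U' \<Longrightarrow> J *\<^sub>v (K *\<^sub>v u) = u"
    "\<And>i u. i < hdim H \<Longrightarrow> u \<in> U' \<Longrightarrow> K *\<^sub>v (ract V i *\<^sub>v u) = ract M i *\<^sub>v (K *\<^sub>v u)"
    by (rule submodule_rep[OF V U']) (rule that)
  note Jc = homD(1)[OF M(2)]
  have KJ: "K *\<^sub>v (J *\<^sub>v v) = v" if "v \<in> vecs M" for v
    by (rule mult_inverse_vec[OF M(3) Jc M(4) that])
  have U'c: "u \<in> vecs V" if "u \<in> U'" for u using U' that by (auto simp: submodule_def)
  have Kc: "K *\<^sub>v u \<in> vecs M" if "u \<in> U'" for u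
    by (rule mult_mat_vec_carrier[OF M(3) U'c[OF that]])
  let ?Y = "{v \<in> vecs M. J *\<^sub>v v \<in> U}"
  have Y: "submodule H M ?Y" by (rule preimage_submodule[OF M(1) V M(2) U])
  obtain Q A B where Q: "is_module H Q" "hom H M Q A" "B \<in> mats Q M"
    "A * B = 1\<^sub>m (rdim Q)" "\<And>v. v \<in> vecs M \<Longrightarrow> A *\<^sub>v v = 0\<^sub>v (rdim Q) \<longleftrightarrow> v \<in> ?Y"
    by (rule quotient_module[OF M(1) Y]) (rule that)
  note Ac = homD(1)[OF Q(2)]
  have AB: "A *\<^sub>v (B *\<^sub>v w) = w" if "w \<in> vecs Q" for w
    by (rule mult_inverse_vec[OF Ac Q(3,4) that])
  have Bc: "B *\<^sub>v w \<in> vecs M" if "w \<in> vecs Q" for w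
    by (rule mult_mat_vec_carrier[OF Q(3) that])
  have Jc': "J *\<^sub>v v \<in> U'" if "v \<in> vecs M" for v unfolding M(5) using that by blast
  let ?F = "A * K"
  have F: "?F *\<^sub>v u = A *\<^sub>v (K *\<^sub>v u)" if "u \<in> U'" for u
    by (rule assoc_mult_mat_vec[OF Ac M(3) U'c[OF that]])
  have Fc: "?F \<in> mats V Q" by (rule mult_carrier_mat[OF Ac M(3)])
  have Fi: "?F *\<^sub>v (ract V i *\<^sub>v u) = ract Q i *\<^sub>v (?F *\<^sub>v u)" if i: "i < hdim H" and u: "u \<in> U'" for i u
  proof -
    have "ract V i *\<^sub>v u \<in> U'" using U' i u by (auto simp: submodule_def)
    thus ?thesis unfolding F[OF u] by (simp only: F M(7)[OF i u] hom_vec[OF M(1) Q(1,2) i Kc[OF u]])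
  qed
  have "(*\<^sub>v) ?F ` U' = (*\<^sub>v) A ` (*\<^sub>v) K ` U'" unfolding image_image by (rule image_cong[OF refl F])
  also have "(*\<^sub>v) K ` U' = vecs M" unfolding M(5) image_mult_mat[OF M(3) Jc] M(4) by force
  also have "(*\<^sub>v) A ` vecs M = vecs Q"
    by (rule surjective_map_image[OF Ac], unfold surjective_map_def) (use AB Bc in blast)
  finally have Fim: "(*\<^sub>v) ?F ` U' = vecs Q" .
  have Fk: "?F *\<^sub>v u = 0\<^sub>v (rdim Q) \<longleftrightarrow> u \<in> U" if u: "u \<in> U'" for u
    unfolding F[OF u] Q(5)[OF Kc[OF u]] using Kc[OF u] M(6)[OF u] by simp
  have "simple_module H Q"
    unfolding simple_module_def
  proof (intro conjI allI impI)
    obtain u where u: "u \<in> U'" "u \<notin> U" using lt by blast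
    show "rdim Q > 0"
    proof (rule ccontr)
      assume "\<not> rdim Q > 0"
      hence "?F *\<^sub>v u = 0\<^sub>v (rdim Q)" using Fc by (intro eq_vecI) auto
      thus False using Fk[OF u(1)] u(2) by simp
    qed
    fix Z assume Z: "submodule H Q Z"
    let ?Z = "{v \<in> vecs M. A *\<^sub>v v \<in> Z}"
    \<comment> \<open>Pulling \<open>Z\<close> back to \<open>M\<close> and pushing it into
      \<open>V\<close> yields a submodule between \<open>U\<close> and \<open>U'\<close>. Maximality
      leaves the two ends, which correspond to \<open>Z\<close> being zero or everything.\<close>
    let ?W = "(*\<^sub>v) J ` ?Z"
    have Zc: "Z \<subseteq> vecs Q" using Z by (simp add: submodule_def)
    have W: "submodule H V ?W"
      by (rule image_submodule[OF M(1) V M(2) preimage_submodule[OF M(1) Q(1,2) Z]])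
    have "U \<subseteq> ?W"
    proof
      fix u assume u: "u \<in> U"
      hence u': "u \<in> U'" using lt by blast
      have "K *\<^sub>v u \<in> ?Y" using Kc[OF u'] M(6)[OF u'] u by simp
      hence "A *\<^sub>v (K *\<^sub>v u) = 0\<^sub>v (rdim Q)" using Q(5)[OF Kc[OF u']] by blast
      hence "K *\<^sub>v u \<in> ?Z" using Kc[OF u'] Z by (simp add: submodule_def)
      thus "u \<in> ?W" using M(6)[OF u'] by (metis imageI)
    qed
    moreover have "?W \<subseteq> U'" using Jc' by blast
    ultimately consider "?W = U" | "?W = U'" using max[OF W] by blast
    thus "Z = {0\<^sub>v (rdim Q)} \<or> Z = vecs Q"
    proof cases
      case 1
      have "z = 0\<^sub>v (rdim Q)" if z: "z \<in> Z" for z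
      proof -
        have zc: "z \<in> vecs Q" using z Zc by blast
        have "B *\<^sub>v z \<in> ?Z" using Bc[OF zc] AB[OF zc] z by simp
        hence "J *\<^sub>v (B *\<^sub>v z) \<in> U" using 1 by blast
        hence "A *\<^sub>v (B *\<^sub>v z) = 0\<^sub>v (rdim Q)" using Q(5)[OF Bc[OF zc]] Bc[OF zc] by blast
        thus ?thesis using AB[OF zc] by simp
      qed
      moreover have "0\<^sub>v (rdim Q) \<in> Z" using Z by (simp add: submodule_def)
      ultimately show ?thesis by blast
    next
      case 2
      have "w \<in> Z" if w: "w \<in> vecs Q" for w
      proof -
        have "J *\<^sub>v (B *\<^sub>v w) \<in> ?W" using Jc'[OF Bc[OF w]] 2 by blast
        then obtain v' where v': "J *\<^sub>v (B *\<^sub>v w) = J *\<^sub>v v'" "v' \<in> ?Z" by (rule imageE)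
        have v'c: "v' \<in> vecs M" "A *\<^sub>v v' \<in> Z" using v'(2) by auto
        have "B *\<^sub>v w = K *\<^sub>v (J *\<^sub>v (B *\<^sub>v w))" by (rule KJ[OF Bc[OF w], symmetric])
        also have "\<dots> = v'" unfolding v'(1) by (rule KJ[OF v'c(1)])
        finally have Bw: "B *\<^sub>v w = v'" .
        show ?thesis using v'c(2) unfolding Bw[symmetric] AB[OF w] .
      qed
      thus ?thesis using Zc by blast
    qed
  qed (rule Q(1))
  thus thesis by (rule that[OF _ Fc Fi Fim Fk])
qed

section \<open>Maps out of a projective cover\<close>

lemma simple_is_module: "simple_module H S \<Longrightarrow> is_module H S"
  by (simp add: simple_module_def)

lemma hom_zero:
  assumes m: "is_module H V" "is_module H W"
  shows "hom H V W (0\<^sub>m (rdim W) (rdim V))"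
  unfolding hom_def using left_mult_zero_mat[OF is_moduleD(1)[OF m(1)]] right_mult_zero_mat[OF is_moduleD(1)[OF m(2)]]
  by simp

text \<open>\<open>F\<close> commutes with the action on \<open>U'\<close>, and this is where
  \<open>f\<close> takes its values. In this way maps to a subquotient are handled by matrices on
  the ambient module.\<close>

lemma hom_into_subquotient:
  assumes m: "is_module H P" "is_module H W" "is_module H X" and f: "hom H P W f"
    and im: "\<And>v. v \<in> vecs P \<Longrightarrow> f *\<^sub>v v \<in> U'"
    and F: "F \<in> mats W X"
    and i: "\<And>i u. i < hdim H \<Longrightarrow> u \<in> U' \<Longrightarrow> F *\<^sub>v (ract W i *\<^sub>v u) = ract X i *\<^sub>v (F *\<^sub>v u)"
  shows "hom H P X (F * f)"
  unfolding hom_def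
proof (intro conjI allI impI)
  note fc = homD(1)[OF f]
  note Ff = mult_carrier_mat[OF F fc]
  show "F * f \<in> mats P X" by (rule Ff)
  fix j assume j: "j < hdim H"
  note c = is_moduleD(1)[OF m(1) j] is_moduleD(1)[OF m(2) j] is_moduleD(1)[OF m(3) j]
  show "F * f * ract P j = ract X j * (F * f)"
  proof (rule mat_eq_by_vec[OF mult_carrier_mat[OF Ff c(1)] mult_carrier_mat[OF c(3) Ff]])
    fix v :: "'a vec" assume v: "v \<in> vecs P"
    have "F * f * ract P j *\<^sub>v v = F *\<^sub>v (f *\<^sub>v (ract P j *\<^sub>v v))"
      by (simp only: assoc_mult_mat_vec[OF Ff c(1) v] assoc_mult_mat_vec[OF F fc mult_mat_vec_carrier[OF c(1) v]])
    also have "\<dots> = ract X j *\<^sub>v (F *\<^sub>v (f *\<^sub>v v))" by (simp only: hom_vec[OF m(1,2) f j v] i[OF j im[OF v]])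
    also have "\<dots> = ract X j * (F * f) *\<^sub>v v"
      by (simp only: assoc_mult_mat_vec[OF c(3) Ff v] assoc_mult_mat_vec[OF F fc v])
    finally show "F * f * ract P j *\<^sub>v v = ract X j * (F * f) *\<^sub>v v" .
  qed
qed

lemma projective_lift:
  assumes "projective H P" "is_module H M" "is_module H N" "hom H M N f" "surjective_map M N f" "hom H P N g"
  obtains h where "hom H P M h" "f * h = g"
  using assms unfolding projective_def by metis

text \<open>Hom(P, U) seen inside Hom(P, W). A composition series of \<open>W\<close> thus becomes
  an increasing chain of sets of matrices of one size, to which \<open>mat_dim\<close>
  applies.\<close>

definition hom_into :: "('k::field, 'z) hopf_scheme \<Rightarrow> 'k rep \<Rightarrow> 'k rep \<Rightarrow> 'k vec set \<Rightarrow> 'k mat set" where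
  "hom_into H P W U = {f. hom H P W f \<and> (\<forall>v\<in>vecs P. f *\<^sub>v v \<in> U)}"

text \<open>Exactness of Hom(P, -) at one step: projectivity lifts \<open>p\<close> to a map
  \<open>f0\<close> into \<open>U'\<close>, and Hom(P, S) is the line through \<open>p\<close>. So
  every \<open>f\<close> into \<open>U'\<close> differs from a multiple of \<open>f0\<close> by a
  map into \<open>U\<close>, and \<open>f0\<close> itself does not map into \<open>U\<close> since
  \<open>p\<close> is nonzero.\<close>

lemma hom_into_step_iso:
  fixes W :: "'k::field rep"
  assumes ac: "algebraically_closed_field TYPE('k)"
    and P: "projective H P" and p: "cover_map H P S p" and S: "simple_module H S" and W: "is_module H W"
    and U: "submodule H W U" and U': "submodule H W U'" and lt: "U \<subseteq> U'"
    and fac: "factor_iso H W U U' S" and dim: "mat_dim (rdim W) (rdim P) (hom_into H P W U) n"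
  shows "mat_dim (rdim W) (rdim P) (hom_into H P W U') (Suc n)"
proof -
  have mP: "is_module H P" using P by (simp add: projective_def)
  have mS: "is_module H S" and S0: "rdim S > 0" using S by (auto simp: simple_module_def)
  note pc = cover_mapD(1)[OF p] and ph = cover_mapD(2)[OF p]
  obtain F where F: "F \<in> mats W S"
    "\<And>i u. i < hdim H \<Longrightarrow> u \<in> U' \<Longrightarrow> F *\<^sub>v (ract W i *\<^sub>v u) = ract S i *\<^sub>v (F *\<^sub>v u)"
    "(*\<^sub>v) F ` U' = vecs S" "{u \<in> U'. F *\<^sub>v u = 0\<^sub>v (rdim S)} = U"
    using fac unfolding factor_iso_def by blast
  obtain M J K where M: "is_module H M" "hom H M W J" "K \<in> mats W M"
    "K * J = 1\<^sub>m (rdim M)" "U' = (*\<^sub>v) J ` vecs M"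
    by (rule submodule_rep[OF W U']) (rule that)
  note Jc = homD(1)[OF M(2)]
  have JU: "J *\<^sub>v v \<in> U'" if "v \<in> vecs M" for v unfolding M(5) using that by blast
  have FJ: "hom H M S (F * J)" by (rule hom_into_subquotient[OF M(1) W mS M(2) JU F(1,2)])
  have FJs: "surjective_map M S (F * J)"
    using F(3) unfolding M(5) image_mult_mat[OF F(1) Jc] by (intro surjective_mapI) simp
  obtain h where h: "hom H P M h" "F * J * h = p" by (rule projective_lift[OF P M(1) mS FJ FJs ph])
  note hc = homD(1)[OF h(1)]
  \<comment> \<open>The lift \<open>h\<close> of \<open>p\<close> takes values in the coordinate
    module \<open>M\<close> of \<open>U'\<close>; \<open>J\<close> carries it back into
    \<open>W\<close>.\<close>
  define f0 where "f0 = J * h"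
  have f0h: "hom H P W f0" unfolding f0_def by (rule hom_comp[OF mP M(1) W h(1) M(2)])
  note f0c = homD(1)[OF f0h]
  have Ff0: "F * f0 = p" unfolding f0_def using assoc_mult_mat[OF F(1) Jc hc] h(2) by simp
  have f0U: "f0 *\<^sub>v v \<in> U'" if v: "v \<in> vecs P" for v
    unfolding f0_def assoc_mult_mat_vec[OF Jc hc v] by (rule JU[OF mult_mat_vec_carrier[OF hc v]])
  have nin: "f0 \<notin> hom_into H P W U"
  proof
    assume a: "f0 \<in> hom_into H P W U"
    have "p = 0\<^sub>m (rdim S) (rdim P)" unfolding mat_zero_iff_vec[OF pc]
    proof
      fix v :: "'k vec" assume v: "v \<in> vecs P"
      have "f0 *\<^sub>v v \<in> U" using a v by (auto simp: hom_into_def)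
      hence "F *\<^sub>v (f0 *\<^sub>v v) = 0\<^sub>v (rdim S)" using F(4) by blast
      thus "p *\<^sub>v v = 0\<^sub>v (rdim S)" unfolding Ff0[symmetric] assoc_mult_mat_vec[OF F(1) f0c v] .
    qed
    thus False using surjective_map_nonzero[OF cover_mapD(3)[OF p] S0] by simp
  qed
  have "hom_into H P W U' = {x + c \<cdot>\<^sub>m f0 | x c. x \<in> hom_into H P W U}"
  proof (intro equalityI subsetI)
    fix f assume "f \<in> hom_into H P W U'"
    hence f: "hom H P W f" "\<And>v. v \<in> vecs P \<Longrightarrow> f *\<^sub>v v \<in> U'" by (auto simp: hom_into_def)
    note fc = homD(1)[OF f(1)]
    obtain c where c: "F * f = c \<cdot>\<^sub>m p"
      by (rule cover_hom_scalar[OF ac p mP S hom_into_subquotient[OF mP W mS f F(1,2)]])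
    define x where "x = f + (- c) \<cdot>\<^sub>m f0"
    have xh: "hom H P W x" unfolding x_def by (rule hom_add_smult[OF mP W f(1) f0h])
    have "x *\<^sub>v v \<in> U" if v: "v \<in> vecs P" for v
    proof -
      have xv: "x *\<^sub>v v = f *\<^sub>v v + (- c) \<cdot>\<^sub>v (f0 *\<^sub>v v)" unfolding x_def by (rule add_smult_mult_vec[OF fc f0c v])
      have fv: "f *\<^sub>v v \<in> U'" "f0 *\<^sub>v v \<in> U'" "(- c) \<cdot>\<^sub>v (f0 *\<^sub>v v) \<in> U'"
        using f(2)[OF v] f0U[OF v] U' by (auto simp: submodule_def)
      hence xU: "x *\<^sub>v v \<in> U'" unfolding xv using U' by (simp add: submodule_def)
      have "F * x = F * f + (- c) \<cdot>\<^sub>m (F * f0)"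
        unfolding x_def mult_add_distrib_mat[OF F(1) fc smult_carrier_mat[OF f0c]] mult_smult_distrib[OF F(1) f0c] ..
      also have "\<dots> = 0\<^sub>m (rdim S) (rdim P)" unfolding c Ff0 using pc by (intro eq_matI) auto
      finally have "F *\<^sub>v (x *\<^sub>v v) = 0\<^sub>v (rdim S)"
        unfolding assoc_mult_mat_vec[OF F(1) homD(1)[OF xh] v, symmetric] using v by auto
      thus ?thesis using xU F(4) by blast
    qed
    hence "x \<in> hom_into H P W U" using xh by (simp add: hom_into_def)
    moreover have "f = x + c \<cdot>\<^sub>m f0" unfolding x_def using fc f0c by (intro eq_matI) auto
    ultimately show "f \<in> {x + c \<cdot>\<^sub>m f0 | x c. x \<in> hom_into H P W U}" by blast
  next
    fix f assume "f \<in> {x + c \<cdot>\<^sub>m f0 | x c. x \<in> hom_into H P W U}"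
    then obtain x c where f: "f = x + c \<cdot>\<^sub>m f0" "x \<in> hom_into H P W U" by blast
    have xh: "hom H P W x" and xU: "\<And>v. v \<in> vecs P \<Longrightarrow> x *\<^sub>v v \<in> U'"
      using f(2) lt by (auto simp: hom_into_def)
    have "hom H P W f" unfolding f(1) by (rule hom_add_smult[OF mP W xh f0h])
    moreover have "f *\<^sub>v v \<in> U'" if v: "v \<in> vecs P" for v
      unfolding f(1) add_smult_mult_vec[OF homD(1)[OF xh] f0c v]
      using xU[OF v] f0U[OF v] U' by (simp add: submodule_def)
    ultimately show "f \<in> hom_into H P W U'" by (simp add: hom_into_def)
  qed
  thus ?thesis using mat_dim.step[OF dim f0c nin] by simp
qed

text \<open>The factor \<open>X\<close> is simple but not isomorphic to \<open>S\<close>. By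
  \<open>cover_hom_iso\<close> every map from \<open>P\<close> to \<open>X\<close> is then zero, so
  a map into \<open>U'\<close> already lands in \<open>U\<close>.\<close>

lemma hom_into_step_not_iso:
  fixes W :: "'k::field rep"
  assumes mP: "is_module H P" and p: "cover_map H P S p" and S: "simple_module H S" and W: "is_module H W"
    and U: "submodule H W U" and U': "submodule H W U'" and lt: "U \<subset> U'"
    and max: "\<And>Y. submodule H W Y \<Longrightarrow> U \<subseteq> Y \<Longrightarrow> Y \<subseteq> U' \<Longrightarrow> Y = U \<or> Y = U'"
    and fac: "\<not> factor_iso H W U U' S"
  shows "hom_into H P W U' = hom_into H P W U"
proof
  obtain X F where X: "simple_module H X" "F \<in> mats W X"
    "\<And>i u. i < hdim H \<Longrightarrow> u \<in> U' \<Longrightarrow> F *\<^sub>v (ract W i *\<^sub>v u) = ract X i *\<^sub>v (F *\<^sub>v u)"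
    "(*\<^sub>v) F ` U' = vecs X"
    "\<And>u. u \<in> U' \<Longrightarrow> F *\<^sub>v u = 0\<^sub>v (rdim X) \<longleftrightarrow> u \<in> U"
    by (rule simple_subquotient[OF W U U' lt max]) (assumption+, rule that)
  have mX: "is_module H X" and mS: "is_module H S" using X(1) S by (auto simp: simple_module_def)
  have U'c: "u \<in> vecs W" if "u \<in> U'" for u using U' that by (auto simp: submodule_def)
  \<comment> \<open>An isomorphism \<open>A\<close> from \<open>X\<close> to \<open>S\<close>,
    composed with the projection \<open>F\<close>, would be a witness of
    \<open>factor_iso\<close>.\<close>
  have niso: "\<not> iso H X S"
  proof
    assume "iso H X S"
    then obtain A B where A: "hom H X S A" "hom H S X B" "A * B = 1\<^sub>m (rdim S)" "B * A = 1\<^sub>m (rdim X)"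
      unfolding iso_def by blast
    note Ac = homD(1)[OF A(1)] and Bc = homD(1)[OF A(2)]
    have BA: "B *\<^sub>v (A *\<^sub>v v) = v" if "v \<in> vecs X" for v
      by (rule mult_inverse_vec[OF Bc Ac A(4) that])
    have AB: "A *\<^sub>v (B *\<^sub>v v) = v" if "v \<in> vecs S" for v
      by (rule mult_inverse_vec[OF Ac Bc A(3) that])
    have AF: "(A * F) *\<^sub>v u = A *\<^sub>v (F *\<^sub>v u)" if "u \<in> U'" for u
      by (rule assoc_mult_mat_vec[OF Ac X(2) U'c[OF that]])
    have Fc: "F *\<^sub>v u \<in> vecs X" if "u \<in> U'" for u
      by (rule mult_mat_vec_carrier[OF X(2) U'c[OF that]])
    have "factor_iso H W U U' S"
      unfolding factor_iso_def
    proof (intro bexI[of _ "A * F"] conjI ballI allI impI)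
      fix u i assume u: "u \<in> U'" and i: "i < hdim H"
      have u': "ract W i *\<^sub>v u \<in> U'" using U' i u by (auto simp: submodule_def)
      show "(A * F) *\<^sub>v (ract W i *\<^sub>v u) = ract S i *\<^sub>v ((A * F) *\<^sub>v u)"
        unfolding AF[OF u] AF[OF u'] X(3)[OF i u] by (rule hom_vec[OF mX mS A(1) i Fc[OF u]])
    next
      have "(*\<^sub>v) (A * F) ` U' = (*\<^sub>v) A ` (*\<^sub>v) F ` U'" unfolding image_image by (rule image_cong[OF refl AF])
      also have "\<dots> = vecs S" unfolding X(4)
        by (rule surjective_map_image[OF Ac], unfold surjective_map_def) (use AB mult_mat_vec_carrier[OF Bc] in blast)
      finally show "(*\<^sub>v) (A * F) ` U' = vecs S" .
    next
      have "(A * F) *\<^sub>v u = 0\<^sub>v (rdim S) \<longleftrightarrow> u \<in> U" if u: "u \<in> U'" for u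
      proof
        assume "(A * F) *\<^sub>v u = 0\<^sub>v (rdim S)"
        hence "A *\<^sub>v (F *\<^sub>v u) = 0\<^sub>v (rdim S)" unfolding AF[OF u] .
        hence "B *\<^sub>v (A *\<^sub>v (F *\<^sub>v u)) = 0\<^sub>v (rdim X)" using mult_mat_vec_zero[OF Bc] by simp
        thus "u \<in> U" unfolding BA[OF Fc[OF u]] X(5)[OF u] .
      next
        assume "u \<in> U"
        hence "F *\<^sub>v u = 0\<^sub>v (rdim X)" using X(5)[OF u] by blast
        thus "(A * F) *\<^sub>v u = 0\<^sub>v (rdim S)" unfolding AF[OF u] using mult_mat_vec_zero[OF Ac] by simp
      qed
      thus "{u \<in> U'. (A * F) *\<^sub>v u = 0\<^sub>v (rdim S)} = U" using lt by blast
    qed (rule mult_carrier_mat[OF Ac X(2)])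
    thus False using fac by simp
  qed
  show "hom_into H P W U' \<subseteq> hom_into H P W U"
  proof
    fix f assume "f \<in> hom_into H P W U'"
    hence f: "hom H P W f" "\<And>v. v \<in> vecs P \<Longrightarrow> f *\<^sub>v v \<in> U'" by (auto simp: hom_into_def)
    have Ff: "hom H P X (F * f)" by (rule hom_into_subquotient[OF mP W mX f X(2,3)])
    have "F * f = 0\<^sub>m (rdim X) (rdim P)" using cover_hom_iso[OF p mP S X(1) Ff] niso by blast
    hence z: "\<forall>v\<in>vecs P. F * f *\<^sub>v v = 0\<^sub>v (rdim X)" using mat_zero_iff_vec[OF homD(1)[OF Ff]] by blast
    have "f *\<^sub>v v \<in> U" if v: "v \<in> vecs P" for v
      using z v X(5)[OF f(2)[OF v]] assoc_mult_mat_vec[OF X(2) homD(1)[OF f(1)] v] by simp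
    thus "f \<in> hom_into H P W U" using f(1) by (simp add: hom_into_def)
  qed
  show "hom_into H P W U \<subseteq> hom_into H P W U'" using lt by (auto simp: hom_into_def)
qed

text \<open>Along the chosen series the dimension of Hom(P, -) rises by one exactly at the factors
  isomorphic to \<open>S\<close>. The left-hand space does not mention the series, so the count is
  the same for every choice.\<close>

lemma hom_dim_comp_mult:
  fixes W :: "'k::field rep"
  assumes ac: "algebraically_closed_field TYPE('k)"
    and P: "projective H P" and p: "cover_map H P S p" and S: "simple_module H S" and W: "is_module H W"
  shows "mat_dim (rdim W) (rdim P) {f. hom H P W f} (comp_mult H W S)"
proof -
  have mP: "is_module H P" using P by (simp add: projective_def)
  define Us where "Us = (SOME Us. comp_series H W Us)"
  have "comp_series H W Us" unfolding Us_def by (rule someI_ex[OF comp_series_exists[OF W]])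
  hence Us: "Us \<noteq> []" "hd Us = {0\<^sub>v (rdim W)}" "last Us = vecs W"
     "\<And>k. k < length Us \<Longrightarrow> submodule H W (Us ! k)"
     "\<And>k. Suc k < length Us \<Longrightarrow> Us ! k \<subset> Us ! Suc k"
     "\<And>k Y. Suc k < length Us \<Longrightarrow> submodule H W Y \<Longrightarrow> Us ! k \<subseteq> Y \<Longrightarrow> Y \<subseteq> Us ! Suc k \<Longrightarrow> Y = Us ! k \<or> Y = Us ! Suc k"
    unfolding comp_series_def by blast+
  let ?fac = "\<lambda>j. factor_iso H W (Us ! j) (Us ! Suc j) S"
  have main: "mat_dim (rdim W) (rdim P) (hom_into H P W (Us ! k)) (card {j. j < k \<and> ?fac j})"
    if "k < length Us" for k
    using that
  proof (induction k)
    case 0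
    have U0: "Us ! 0 = {0\<^sub>v (rdim W)}" using Us(1,2) by (simp add: hd_conv_nth)
    have "hom_into H P W (Us ! 0) = {0\<^sub>m (rdim W) (rdim P)}"
      unfolding U0 hom_into_def
    proof (intro equalityI subsetI)
      fix f assume "f \<in> {f. hom H P W f \<and> (\<forall>v\<in>vecs P. f *\<^sub>v v \<in> {0\<^sub>v (rdim W)})}"
      hence "hom H P W f" "\<forall>v\<in>vecs P. f *\<^sub>v v = 0\<^sub>v (rdim W)" by auto
      thus "f \<in> {0\<^sub>m (rdim W) (rdim P)}" using mat_zero_iff_vec[OF homD(1)] by blast
    next
      fix f assume "f \<in> {0\<^sub>m (rdim W) (rdim P) :: 'k mat}"
      thus "f \<in> {f. hom H P W f \<and> (\<forall>v\<in>vecs P. f *\<^sub>v v \<in> {0\<^sub>v (rdim W)})}"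
        using hom_zero[OF mP W] by auto
    qed
    thus ?case using mat_dim.zero by simp
  next
    case (Suc k)
    have k: "k < length Us" using Suc.prems by simp
    note IH = Suc.IH[OF k]
    note sm = Us(4)[OF k] Us(4)[OF Suc.prems]
    show ?case
    proof (cases "?fac k")
      case True
      have "{j. j < Suc k \<and> ?fac j} = insert k {j. j < k \<and> ?fac j}" using True by (auto simp: less_Suc_eq)
      hence "card {j. j < Suc k \<and> ?fac j} = Suc (card {j. j < k \<and> ?fac j})" by simp
      moreover have "Us ! k \<subseteq> Us ! Suc k" using Us(5)[OF Suc.prems] by blast
      ultimately show ?thesis using hom_into_step_iso[OF ac P p S W sm _ True IH] by simp
    next
      case False
      have "{j. j < Suc k \<and> ?fac j} = {j. j < k \<and> ?fac j}" using False by (auto simp: less_Suc_eq)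
      thus ?thesis
        using hom_into_step_not_iso[OF mP p S W sm Us(5)[OF Suc.prems] Us(6)[OF Suc.prems] False] IH by simp
    qed
  qed
  let ?m = "length Us - 1"
  have l: "?m < length Us" using Us(1) by simp
  have lastU: "Us ! ?m = vecs W" using Us(1,3) by (simp add: last_conv_nth)
  have "hom_into H P W (Us ! ?m) = {f. hom H P W f}"
    unfolding lastU hom_into_def using mult_mat_vec_carrier[OF homD(1)] by blast
  moreover have "card {j. j < ?m \<and> ?fac j} = comp_mult H W S"
    unfolding comp_mult_def Let_def Us_def[symmetric] by (rule arg_cong[where f = card]) auto
  ultimately show ?thesis using main[OF l] by simp
qed

section \<open>Traces on projective modules\<close>

lemma mtrace_comm:
  fixes A :: "'k::field mat"
  assumes A: "A \<in> carrier_mat n m" and B: "B \<in> carrier_mat m n"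
  shows "mtrace (A * B) = mtrace (B * A)"
proof -
  have "mtrace (A * B) = (\<Sum>i<n. \<Sum>x<m. A $$ (i, x) * B $$ (x, i))"
    unfolding mtrace_def using A by (intro sum.cong) (auto simp: mult_mat_entry[OF A B] simp del: index_mult_mat(1))
  also have "\<dots> = (\<Sum>x<m. \<Sum>i<n. B $$ (x, i) * A $$ (i, x))"
    by (subst sum.swap) (simp add: mult.commute)
  also have "\<dots> = mtrace (B * A)"
    unfolding mtrace_def using B by (intro sum.cong) (auto simp: mult_mat_entry[OF B A] simp del: index_mult_mat(1))
  finally show ?thesis .
qed

lemma mtrace_minus:
  fixes A :: "'k::field mat"
  assumes "A \<in> carrier_mat n n" "B \<in> carrier_mat n n"
  shows "mtrace (A - B) = mtrace A - mtrace B"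
  using assms by (simp add: mtrace_def sum_subtractf)

text \<open>Enlarge the kernel of \<open>e\<close>, which is proper, to a maximal submodule
  \<open>Y\<close> and let \<open>q\<close> be the projection modulo \<open>Y\<close>. Since
  \<open>e v - v\<close> lies in the kernel of \<open>e\<close>, hence in \<open>Y\<close>, the
  projection satisfies \<open>q * e = q\<close>; it is a simple quotient of the summand cut out by
  \<open>e\<close>.\<close>

lemma idempotent_simple_quotient:
  fixes Q :: "'k::field rep"
  assumes Q: "is_module H Q" and e: "hom H Q Q e" and ee: "e * e = e" and nz: "e \<noteq> 0\<^sub>m (rdim Q) (rdim Q)"
  obtains X q where "simple_module H X" "hom H Q X q" "q * e = q" "q \<noteq> 0\<^sub>m (rdim X) (rdim Q)"
proof -
  let ?n = "rdim Q"
  note ec = homD(1)[OF e]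
  let ?U = "{v \<in> carrier_vec ?n. e *\<^sub>v v = 0\<^sub>v ?n}"
  have U: "submodule H Q ?U" by (rule kernel_submodule[OF Q Q e])
  have "?U \<subset> carrier_vec ?n"
  proof -
    have "\<exists>v\<in>carrier_vec ?n. e *\<^sub>v v \<noteq> 0\<^sub>v ?n" using nz mat_zero_iff_vec[OF ec] by blast
    thus ?thesis by blast
  qed
  then obtain Y where Y: "submodule H Q Y" "?U \<subseteq> Y" "Y \<subset> carrier_vec ?n"
    "\<And>Z. submodule H Q Z \<Longrightarrow> Y \<subseteq> Z \<Longrightarrow> Z \<subseteq> carrier_vec ?n \<Longrightarrow> Z = Y \<or> Z = carrier_vec ?n"
    by (rule maximal_submodule_below[OF U submodule_full[OF Q]]) (rule that)
  obtain X F where X: "simple_module H X" "F \<in> carrier_mat (rdim X) ?n"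
    "\<And>i u. i < hdim H \<Longrightarrow> u \<in> carrier_vec ?n \<Longrightarrow> F *\<^sub>v (ract Q i *\<^sub>v u) = ract X i *\<^sub>v (F *\<^sub>v u)"
    "(*\<^sub>v) F ` carrier_vec ?n = vecs X"
    "\<And>u. u \<in> carrier_vec ?n \<Longrightarrow> F *\<^sub>v u = 0\<^sub>v (rdim X) \<longleftrightarrow> u \<in> Y"
    by (rule simple_subquotient[OF Q Y(1) submodule_full[OF Q] Y(3) Y(4)]) (assumption+, rule that)
  have mX: "is_module H X" and X0: "rdim X > 0" using X(1) by (auto simp: simple_module_def)
  have "hom H Q X (F * 1\<^sub>m ?n)"
    by (rule hom_into_subquotient[OF Q Q mX hom_id[OF Q] _ X(2,3)]) auto
  hence Fh: "hom H Q X F" using right_mult_one_mat[OF X(2)] by simp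
  have Fe: "F * e = F"
  proof (rule mat_eq_by_vec[OF mult_carrier_mat[OF X(2) ec] X(2)])
    fix v :: "'k vec" assume v: "v \<in> carrier_vec ?n"
    have ev: "e *\<^sub>v v \<in> carrier_vec ?n" by (rule mult_mat_vec_carrier[OF ec v])
    have "e *\<^sub>v (e *\<^sub>v v - v) = e *\<^sub>v (e *\<^sub>v v) - e *\<^sub>v v" by (rule mult_minus_distrib_mat_vec[OF ec ev v])
    also have "e *\<^sub>v (e *\<^sub>v v) = e *\<^sub>v v" unfolding assoc_mult_mat_vec[OF ec ec v, symmetric] ee ..
    finally have "e *\<^sub>v (e *\<^sub>v v - v) = 0\<^sub>v ?n" using ev by simp
    hence "e *\<^sub>v v - v \<in> ?U" using ev v by simp
    hence "e *\<^sub>v v - v \<in> Y" using Y(2) by blast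
    hence "F *\<^sub>v (e *\<^sub>v v - v) = 0\<^sub>v (rdim X)" using X(5)[of "e *\<^sub>v v - v"] ev v by simp
    hence "F *\<^sub>v (e *\<^sub>v v) - F *\<^sub>v v = 0\<^sub>v (rdim X)" unfolding mult_minus_distrib_mat_vec[OF X(2) ev v] .
    hence "F *\<^sub>v (e *\<^sub>v v) = F *\<^sub>v v"
      by (rule vec_minus_eq_zero[OF mult_mat_vec_carrier[OF X(2) ev] mult_mat_vec_carrier[OF X(2) v]])
    thus "F * e *\<^sub>v v = F *\<^sub>v v" unfolding assoc_mult_mat_vec[OF X(2) ec v] .
  qed
  have "surjective_map Q X F" using X(4) by (intro surjective_mapI) simp
  hence "F \<noteq> 0\<^sub>m (rdim X) ?n" by (rule surjective_map_nonzero[OF _ X0])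
  thus thesis by (rule that[OF X(1) Fh Fe])
qed

text \<open>The quotient map is composed with an isomorphism onto the representative in the list;
  composing back with the inverse shows that it has not become zero.\<close>

lemma idempotent_listed_quotient:
  fixes Q :: "'k::field rep"
  assumes Q: "is_module H Q" and e: "hom H Q Q e" and ee: "e * e = e" and nz: "e \<noteq> 0\<^sub>m (rdim Q) (rdim Q)"
    and simples: "\<forall>i<length Ss. simple_module H (Ss ! i)"
    and complete: "\<forall>S. simple_module H S \<longrightarrow> (\<exists>i<length Ss. iso H S (Ss ! i))"
  obtains l q where "l < length Ss" "hom H Q (Ss ! l) q" "q * e = q" "q \<noteq> 0\<^sub>m (rdim (Ss ! l)) (rdim Q)"
proof -
  obtain X q where X: "simple_module H X" "hom H Q X q" "q * e = q" "q \<noteq> 0\<^sub>m (rdim X) (rdim Q)"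
    by (rule idempotent_simple_quotient[OF Q e ee nz])
  obtain l where l: "l < length Ss" "iso H X (Ss ! l)" using complete X(1) by blast
  then obtain A B where A: "hom H X (Ss ! l) A" "hom H (Ss ! l) X B" "B * A = 1\<^sub>m (rdim X)"
    unfolding iso_def by blast
  have m: "is_module H X" "is_module H (Ss ! l)" using X(1) simples l(1) by (auto simp: simple_module_def)
  note Ac = homD(1)[OF A(1)] and Bc = homD(1)[OF A(2)] and qc = homD(1)[OF X(2)] and ec = homD(1)[OF e]
  have "hom H Q (Ss ! l) (A * q)" by (rule hom_comp[OF Q m X(2) A(1)])
  moreover have "A * q * e = A * q" unfolding assoc_mult_mat[OF Ac qc ec] X(3) ..
  moreover have "A * q \<noteq> 0\<^sub>m (rdim (Ss ! l)) (rdim Q)"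
  proof
    assume "A * q = 0\<^sub>m (rdim (Ss ! l)) (rdim Q)"
    hence "B * (A * q) = 0\<^sub>m (rdim X) (rdim Q)" using right_mult_zero_mat[OF Bc] by simp
    hence "q = 0\<^sub>m (rdim X) (rdim Q)"
      unfolding assoc_mult_mat[OF Bc Ac qc, symmetric] A(3) left_mult_one_mat[OF qc] .
    thus False using X(4) by simp
  qed
  ultimately show thesis by (rule that[OF l(1)])
qed

text \<open>Lift \<open>q\<close> through \<open>p\<close> and compose with \<open>e\<close> to get
  \<open>h\<close>. As \<open>p * h = q\<close> is surjective and \<open>p\<close> is essential,
  \<open>h\<close> is surjective, and projectivity of \<open>P\<close> splits it. So
  \<open>P\<close> is a direct summand of the image of \<open>e\<close>; the conditions with
  \<open>e\<close> record that inclusion and projection respect this image.\<close>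

lemma split_cover:
  fixes Q :: "'k::field rep"
  assumes Q: "projective H Q" and e: "hom H Q Q e" and ee: "e * e = e"
    and P: "projective H P" and p: "cover_map H P S p" and S: "simple_module H S"
    and q: "hom H Q S q" "q * e = q" "q \<noteq> 0\<^sub>m (rdim S) (rdim Q)"
  obtains h s where "hom H Q P h" "hom H P Q s" "p * h = q" "h * e = h" "e * s = s" "h * s = 1\<^sub>m (rdim P)"
proof -
  have m: "is_module H Q" "is_module H P" "is_module H S"
    using Q P S by (auto simp: projective_def simple_module_def)
  note pc = cover_mapD(1)[OF p] and ph = cover_mapD(2)[OF p] and ps = cover_mapD(3)[OF p] and ec = homD(1)[OF e]
  obtain h0 where h0: "hom H Q P h0" "p * h0 = q" by (rule projective_lift[OF Q m(2,3) ph ps q(1)])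
  note h0c = homD(1)[OF h0(1)]
  define h where "h = h0 * e"
  have h: "hom H Q P h" unfolding h_def by (rule hom_comp[OF m(1,1,2) e h0(1)])
  note hc = homD(1)[OF h]
  have phq: "p * h = q" unfolding h_def using assoc_mult_mat[OF pc h0c ec] h0(2) q(2) by simp
  have he: "h * e = h" unfolding h_def using assoc_mult_mat[OF h0c ec ec] ee by simp
  have qs: "surjective_map Q S q" by (rule hom_simple_surjective[OF S m(1) q(1,3)])
  let ?U = "(*\<^sub>v) h ` vecs Q"
  have U: "submodule H P ?U" by (rule image_submodule[OF m(1,2) h submodule_full[OF m(1)]])
  have "(*\<^sub>v) p ` ?U = vecs S"
    unfolding image_mult_mat[OF pc hc] phq by (rule surjective_map_image[OF homD(1)[OF q(1)] qs])
  from cover_map_full[OF p U this] have Uf: "?U = vecs P" .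
  have hs: "surjective_map Q P h" using Uf by (intro surjective_mapI) simp
  obtain s0 where s0: "hom H P Q s0" "h * s0 = 1\<^sub>m (rdim P)"
    by (rule projective_lift[OF P m(1,2) h hs hom_id[OF m(2)]])
  note s0c = homD(1)[OF s0(1)]
  have "hom H P Q (e * s0)" by (rule hom_comp[OF m(2,1,1) s0(1) e])
  moreover have "e * (e * s0) = e * s0" unfolding assoc_mult_mat[OF ec ec s0c, symmetric] ee ..
  moreover have "h * (e * s0) = 1\<^sub>m (rdim P)" unfolding assoc_mult_mat[OF hc ec s0c, symmetric] he s0(2) ..
  ultimately show thesis using that[OF h _ phq he] by blast
qed

lemma mat_minus_self: "A \<in> carrier_mat n m \<Longrightarrow> A - A = (0\<^sub>m n m :: 'k::field mat)"
  by (intro eq_matI) auto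

lemma mat_minus_zero: "A \<in> carrier_mat n m \<Longrightarrow> A - 0\<^sub>m n m = (A :: 'k::field mat)"
  by (intro eq_matI) auto

context
  fixes H :: "('k::field, 'z) hopf_scheme" and Ss Ps :: "'k rep list"
  assumes ac: "algebraically_closed_field TYPE('k)"
    and simples: "\<forall>i<length Ss. simple_module H (Ss ! i)"
    and noniso: "\<forall>i<length Ss. \<forall>j<length Ss. i \<noteq> j \<longrightarrow> \<not> iso H (Ss ! i) (Ss ! j)"
    and complete: "\<forall>S. simple_module H S \<longrightarrow> (\<exists>i<length Ss. iso H S (Ss ! i))"
    and covers: "\<forall>i<length Ss. projective_cover H (Ps ! i) (Ss ! i)"
begin

text \<open>Projective covers are split off one at a time by replacing \<open>e\<close> with \<open>e - s h\<close>. Using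
  idempotents of a fixed module avoids bases of direct summands.\<close>
lemma trace_idempotent:
  assumes Q: "projective H Q" and e: "hom H Q Q e" and ee: "e * e = e"
  shows "\<exists>c. (\<forall>l<length Ss. mat_dim (rdim (Ss ! l)) (rdim Q) {f. hom H Q (Ss ! l) f \<and> f * e = f} (c l)) \<and>
     (\<forall>i<hdim H. mtrace (e * ract Q i) = (\<Sum>l<length Ss. of_nat (c l) * mtrace (ract (Ps ! l) i)))"
  using e ee
proof (induction "sdim (rdim Q) ((*\<^sub>v) e ` vecs Q)" arbitrary: e rule: less_induct)
  case (less e)
  note e = less.prems(1) and ee = less.prems(2)
  let ?n = "rdim Q"
  have mQ: "is_module H Q" using Q by (simp add: projective_def)
  have mS: "is_module H (Ss ! l)" if "l < length Ss" for l using simples that by (auto simp: simple_module_def)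
  note ec = homD(1)[OF e]
  have im: "subsp ?n ((*\<^sub>v) f ` carrier_vec ?n)" if "hom H Q Q f" for f
    using image_submodule[OF mQ mQ that submodule_full[OF mQ]] by (simp add: submodule_iff)
  show ?case
  proof (cases "e = 0\<^sub>m ?n ?n")
    case True
    have "{f. hom H Q (Ss ! l) f \<and> f * e = f} = {0\<^sub>m (rdim (Ss ! l)) ?n}" if l: "l < length Ss" for l
    proof (intro equalityI subsetI)
      fix f assume "f \<in> {f. hom H Q (Ss ! l) f \<and> f * e = f}"
      hence f: "hom H Q (Ss ! l) f" "f * e = f" by auto
      show "f \<in> {0\<^sub>m (rdim (Ss ! l)) ?n}"
        using f(2) right_mult_zero_mat[OF homD(1)[OF f(1)], of ?n] unfolding True by simp
    next
      fix f assume "f \<in> {0\<^sub>m (rdim (Ss ! l)) ?n :: 'k mat}"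
      thus "f \<in> {f. hom H Q (Ss ! l) f \<and> f * e = f}"
        using hom_zero[OF mQ mS[OF l]] left_mult_zero_mat[OF ec] by simp
    qed
    moreover have "mtrace (e * ract Q i) = 0" if i: "i < hdim H" for i
      unfolding True left_mult_zero_mat[OF is_moduleD(1)[OF mQ i]] by (simp add: mtrace_def)
    ultimately show ?thesis by (intro exI[of _ "\<lambda>_. 0"]) (auto intro: mat_dim.zero)
  next
    case False
    obtain l0 q where q: "l0 < length Ss" "hom H Q (Ss ! l0) q" "q * e = q" "q \<noteq> 0\<^sub>m (rdim (Ss ! l0)) ?n"
      by (rule idempotent_listed_quotient[OF mQ e ee False simples complete])
    let ?S = "Ss ! l0" and ?P = "Ps ! l0"
    have S: "simple_module H ?S" using simples q(1) by blast
    have P: "projective H ?P" using covers q(1) by (auto simp: projective_cover_map)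
    obtain p where p: "cover_map H ?P ?S p" using covers q(1) by (auto simp: projective_cover_map)
    have mP: "is_module H ?P" using P by (simp add: projective_def)
    let ?r = "rdim ?P"
    obtain h s where h: "hom H Q ?P h" and s: "hom H ?P Q s" and phq: "p * h = q" and he: "h * e = h"
      and es: "e * s = s" and hs: "h * s = 1\<^sub>m ?r"
      by (rule split_cover[OF Q e ee P p S q(2-4)])
    note hc = homD(1)[OF h] and sc = homD(1)[OF s] and pc = cover_mapD(1)[OF p] and qc = homD(1)[OF q(2)]
    note shc = mult_carrier_mat[OF sc hc]
    \<comment> \<open>\<open>s * h\<close> is an idempotent, and multiplying it by \<open>e\<close>
      on either side leaves it unchanged. It projects onto the copy of \<open>?P\<close> inside the
      image of \<open>e\<close>, so \<open>e'\<close> is the complementary idempotent.\<close>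
    define e' where "e' = e - s * h"
    have e'c: "e' \<in> carrier_mat ?n ?n" unfolding e'_def by (rule minus_carrier_mat[OF shc])
    have e's: "e' * s = 0\<^sub>m ?n ?r"
      unfolding e'_def minus_mult_distrib_mat[OF ec shc sc] es assoc_mult_mat[OF sc hc sc] hs
        right_mult_one_mat[OF sc] by (rule mat_minus_self[OF sc])
    have ee': "e * e' = e'"
      unfolding e'_def mult_minus_distrib_mat[OF ec ec shc] ee assoc_mult_mat[OF ec sc hc, symmetric] es ..
    have e'e: "e' * e = e'"
      unfolding e'_def minus_mult_distrib_mat[OF ec shc ec] ee assoc_mult_mat[OF sc hc ec] he ..
    have "e' * e' = e' * e - e' * (s * h)"
      using mult_minus_distrib_mat[OF e'c ec shc] unfolding e'_def[symmetric] .
    also have "e' * (s * h) = 0\<^sub>m ?n ?n"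
      unfolding assoc_mult_mat[OF e'c sc hc, symmetric] e's by (rule left_mult_zero_mat[OF hc])
    finally have e'e': "e' * e' = e'" unfolding e'e mat_minus_zero[OF e'c] .
    have "hom H Q Q (e + (-1) \<cdot>\<^sub>m (s * h))" by (rule hom_add_smult[OF mQ mQ e hom_comp[OF mQ mP mQ h s]])
    moreover have "e + (-1) \<cdot>\<^sub>m (s * h) = e'" unfolding e'_def using ec shc by (intro eq_matI) auto
    ultimately have e'h: "hom H Q Q e'" by simp
    have "(*\<^sub>v) e' ` carrier_vec ?n \<subset> (*\<^sub>v) e ` carrier_vec ?n"
    proof
      show "(*\<^sub>v) e' ` carrier_vec ?n \<subseteq> (*\<^sub>v) e ` carrier_vec ?n"
      proof
        fix w assume "w \<in> (*\<^sub>v) e' ` carrier_vec ?n"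
        then obtain v where v: "w = e' *\<^sub>v v" "v \<in> carrier_vec ?n" by (rule imageE)
        have "w = e *\<^sub>v (e' *\<^sub>v v)" unfolding v(1) assoc_mult_mat_vec[OF ec e'c v(2), symmetric] ee' ..
        thus "w \<in> (*\<^sub>v) e ` carrier_vec ?n" using mult_mat_vec_carrier[OF e'c v(2)] by (rule image_eqI)
      qed
      \<comment> \<open>Strict decrease of the measure: \<open>p\<close> being nonzero supplies a
        nonzero \<open>w\<close>. Then \<open>s *\<^sub>v w\<close> lies in the image of
        \<open>e\<close>, but \<open>e' * s = 0\<close> and idempotence of \<open>e'\<close> keep it
        out of the image of \<open>e'\<close>.\<close>
      have "\<exists>w\<in>carrier_vec ?r. p *\<^sub>v w \<noteq> 0\<^sub>v (rdim ?S)"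
        using surjective_map_nonzero[OF cover_mapD(3)[OF p]] S mat_zero_iff_vec[OF pc] by (auto simp: simple_module_def)
      then obtain w where w: "w \<in> carrier_vec ?r" "p *\<^sub>v w \<noteq> 0\<^sub>v (rdim ?S)" by blast
      have sw: "s *\<^sub>v w \<in> carrier_vec ?n" by (rule mult_mat_vec_carrier[OF sc w(1)])
      have "s *\<^sub>v w \<in> (*\<^sub>v) e ` carrier_vec ?n"
        by (rule image_eqI[OF _ sw]) (simp add: assoc_mult_mat_vec[OF ec sc w(1), symmetric] es)
      moreover have "s *\<^sub>v w \<notin> (*\<^sub>v) e' ` carrier_vec ?n"
      proof
        assume "s *\<^sub>v w \<in> (*\<^sub>v) e' ` carrier_vec ?n"
        then obtain v where v: "s *\<^sub>v w = e' *\<^sub>v v" "v \<in> carrier_vec ?n" by (rule imageE)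
        have "e' *\<^sub>v v = e' *\<^sub>v (e' *\<^sub>v v)" unfolding assoc_mult_mat_vec[OF e'c e'c v(2), symmetric] e'e' ..
        also have "\<dots> = e' * s *\<^sub>v w" unfolding v(1)[symmetric] assoc_mult_mat_vec[OF e'c sc w(1)] ..
        also have "\<dots> = 0\<^sub>v ?n" unfolding e's using w(1) by (intro eq_vecI) auto
        finally have "s *\<^sub>v w = 0\<^sub>v ?n" unfolding v(1) .
        hence "h *\<^sub>v (s *\<^sub>v w) = 0\<^sub>v ?r" using mult_mat_vec_zero[OF hc] by simp
        hence "w = 0\<^sub>v ?r" unfolding assoc_mult_mat_vec[OF hc sc w(1), symmetric] hs one_mult_mat_vec[OF w(1)] .
        thus False using w(2) mult_mat_vec_zero[OF pc] by simp
      qed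
      ultimately show "(*\<^sub>v) e' ` carrier_vec ?n \<noteq> (*\<^sub>v) e ` carrier_vec ?n" by blast
    qed
    note IH = less.hyps[OF sdim_less[OF im[OF e'h] im[OF e] this] e'h e'e']
    obtain c where c: "\<And>l. l < length Ss \<Longrightarrow> mat_dim (rdim (Ss ! l)) ?n {f. hom H Q (Ss ! l) f \<and> f * e' = f} (c l)"
      "\<And>i. i < hdim H \<Longrightarrow> mtrace (e' * ract Q i) = (\<Sum>l<length Ss. of_nat (c l) * mtrace (ract (Ps ! l) i))"
      using IH by blast
    have sub: "f * e = f" if f: "hom H Q (Ss ! l) f" "f * e' = f" for f l
    proof -
      have "f * e = f * e' * e" by (simp only: f(2))
      also have "\<dots> = f * (e' * e)" by (rule assoc_mult_mat[OF homD(1)[OF f(1)] e'c ec])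
      also have "\<dots> = f" by (simp only: e'e f(2))
      finally show ?thesis .
    qed
    have e_eq: "e = e' + s * h" unfolding e'_def using ec shc by (intro eq_matI) auto
    \<comment> \<open>The second summand is governed by \<open>f * s\<close>, a map from
      \<open>?P\<close> to \<open>Ss ! l\<close>: it vanishes when \<open>l\<close> differs from
      \<open>l0\<close>, and is a multiple of \<open>p\<close> when \<open>l = l0\<close>, which
      makes the summand a multiple of \<open>q\<close>.\<close>
    have decomp: "f = f * e' + f * s * h" if f: "hom H Q (Ss ! l) f" "f * e = f" for f l
    proof -
      note fc = homD(1)[OF f(1)]
      have "f = f * (e' + s * h)" using f(2) e_eq by simp
      also have "\<dots> = f * e' + f * (s * h)" by (rule mult_add_distrib_mat[OF fc e'c shc])
      also have "f * (s * h) = f * s * h" by (rule assoc_mult_mat[OF fc sc hc, symmetric])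
      finally show ?thesis .
    qed
    have dims: "mat_dim (rdim (Ss ! l)) ?n {f. hom H Q (Ss ! l) f \<and> f * e = f} ((c(l0 := Suc (c l0))) l)"
      if l: "l < length Ss" for l
    proof (cases "l = l0")
      case False
      have "{f. hom H Q (Ss ! l) f \<and> f * e = f} = {f. hom H Q (Ss ! l) f \<and> f * e' = f}"
      proof (intro equalityI subsetI)
        fix f assume "f \<in> {f. hom H Q (Ss ! l) f \<and> f * e = f}"
        hence f: "hom H Q (Ss ! l) f" "f * e = f" by auto
        note fc = homD(1)[OF f(1)]
        have fs: "hom H ?P (Ss ! l) (f * s)" by (rule hom_comp[OF mP mQ mS[OF l] s f(1)])
        have "f * s = 0\<^sub>m (rdim (Ss ! l)) ?r"
          using cover_hom_iso[OF p mP S _ fs] simples l q(1) False noniso by blast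
        hence "f * s * h = 0\<^sub>m (rdim (Ss ! l)) ?n" using left_mult_zero_mat[OF hc] by simp
        hence "f = f * e'" using decomp[OF f] right_add_zero_mat[OF mult_carrier_mat[OF fc e'c]] by simp
        thus "f \<in> {f. hom H Q (Ss ! l) f \<and> f * e' = f}" using f(1) by simp
      qed (use sub in blast)
      thus ?thesis using c(1)[OF l] False by simp
    next
      case True
      have qe': "q * e' = 0\<^sub>m (rdim ?S) ?n"
      proof -
        have "q * (s * h) = p * h * s * h" unfolding phq by (rule assoc_mult_mat[OF qc sc hc, symmetric])
        also have "p * h * s = p" unfolding assoc_mult_mat[OF pc hc sc] hs by (rule right_mult_one_mat[OF pc])
        also have "p * h = q" by (rule phq)
        finally have "q * (s * h) = q" .
        thus ?thesis unfolding e'_def mult_minus_distrib_mat[OF qc ec shc] q(3) by (simp add: mat_minus_self[OF qc])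
      qed
      \<comment> \<open>\<open>q\<close> is the one new direction: it is annihilated by
        \<open>e'\<close>, so being nonzero it cannot satisfy \<open>q * e' = q\<close>.\<close>
      have nin: "q \<notin> {f. hom H Q ?S f \<and> f * e' = f}" using qe' q(4) by auto
      have "{f. hom H Q ?S f \<and> f * e = f} = {x + k \<cdot>\<^sub>m q | x k. x \<in> {f. hom H Q ?S f \<and> f * e' = f}}"
      proof (intro equalityI subsetI)
        fix f assume "f \<in> {f. hom H Q ?S f \<and> f * e = f}"
        hence f: "hom H Q ?S f" "f * e = f" by auto
        note fc = homD(1)[OF f(1)]
        have fs: "hom H ?P ?S (f * s)" by (rule hom_comp[OF mP mQ mS[OF q(1)] s f(1)])
        obtain k where k: "f * s = k \<cdot>\<^sub>m p" by (rule cover_hom_scalar[OF ac p mP S fs])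
        have "f * s * h = k \<cdot>\<^sub>m q" unfolding k mult_smult_assoc_mat[OF pc hc] phq ..
        hence "f = f * e' + k \<cdot>\<^sub>m q" using decomp[OF f] by simp
        moreover have "hom H Q ?S (f * e')" by (rule hom_comp[OF mQ mQ mS[OF q(1)] e'h f(1)])
        moreover have "f * e' * e' = f * e'" unfolding assoc_mult_mat[OF fc e'c e'c] e'e' ..
        ultimately show "f \<in> {x + k \<cdot>\<^sub>m q | x k. x \<in> {f. hom H Q ?S f \<and> f * e' = f}}" by blast
      next
        fix f assume "f \<in> {x + k \<cdot>\<^sub>m q | x k. x \<in> {f. hom H Q ?S f \<and> f * e' = f}}"
        then obtain x k where x: "f = x + k \<cdot>\<^sub>m q" "hom H Q ?S x" "x * e' = x" by blast
        note xc = homD(1)[OF x(2)]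
        have kq: "k \<cdot>\<^sub>m q \<in> carrier_mat (rdim ?S) ?n" using qc by simp
        have "hom H Q ?S f" unfolding x(1) by (rule hom_add_smult[OF mQ mS[OF q(1)] x(2) q(2)])
        moreover have "f * e = f"
          unfolding x(1) add_mult_distrib_mat[OF xc kq ec] sub[OF x(2,3)] mult_smult_assoc_mat[OF qc ec] q(3) ..
        ultimately show "f \<in> {f. hom H Q ?S f \<and> f * e = f}" by simp
      qed
      thus ?thesis using mat_dim.step[OF c(1)[OF q(1)] qc nin] True by simp
    qed
    have "mtrace (e * ract Q i) = (\<Sum>l<length Ss. of_nat ((c(l0 := Suc (c l0))) l) * mtrace (ract (Ps ! l) i))"
      if i: "i < hdim H" for i
    proof -
      note rq = is_moduleD(1)[OF mQ i] and rp = is_moduleD(1)[OF mP i]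
      \<comment> \<open>Cyclicity of the trace moves the removed part to \<open>?P\<close>:
        equivariance of \<open>h\<close> and \<open>h * s = 1\<close> reduce it to the trace of
        \<open>ract ?P i\<close>.\<close>
      have "mtrace (e' * ract Q i) = mtrace (e * ract Q i) - mtrace (s * h * ract Q i)"
        unfolding e'_def minus_mult_distrib_mat[OF ec shc rq]
        by (rule mtrace_minus[OF mult_carrier_mat[OF ec rq] mult_carrier_mat[OF shc rq]])
      also have "s * h * ract Q i = s * (ract ?P i * h)"
        unfolding assoc_mult_mat[OF sc hc rq] homD(2)[OF h i] ..
      also have "mtrace \<dots> = mtrace (ract ?P i * h * s)" by (rule mtrace_comm[OF sc mult_carrier_mat[OF rp hc]])
      also have "ract ?P i * h * s = ract ?P i"
        unfolding assoc_mult_mat[OF rp hc sc] hs by (rule right_mult_one_mat[OF rp])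
      finally have t: "mtrace (e * ract Q i) = mtrace (e' * ract Q i) + mtrace (ract ?P i)" by simp
      have "(\<Sum>l<length Ss. of_nat ((c(l0 := Suc (c l0))) l) * mtrace (ract (Ps ! l) i)) =
        (\<Sum>l<length Ss. of_nat (c l) * mtrace (ract (Ps ! l) i) + (if l = l0 then mtrace (ract ?P i) else 0))"
        by (intro sum.cong refl) (auto simp: algebra_simps)
      also have "\<dots> = (\<Sum>l<length Ss. of_nat (c l) * mtrace (ract (Ps ! l) i)) + mtrace (ract ?P i)"
        using q(1) by (simp add: sum.distrib)
      finally show ?thesis using t c(2)[OF i] by simp
    qed
    thus ?thesis using dims by blast
  qed
qed

text \<open>The identity is the idempotent to start from. The splitting yields some multiplicities
  \<open>c\<close>; they agree with \<open>d\<close> because both are dimensions of the same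
  space.\<close>

lemma trace_projective:
  assumes Q: "projective H Q"
    and d: "\<And>l. l < length Ss \<Longrightarrow> mat_dim (rdim (Ss ! l)) (rdim Q) {f. hom H Q (Ss ! l) f} (d l)"
    and i: "i < hdim H"
  shows "mtrace (ract Q i) = (\<Sum>l<length Ss. of_nat (d l) * mtrace (ract (Ps ! l) i))"
proof -
  have mQ: "is_module H Q" using Q by (simp add: projective_def)
  obtain c where c: "\<And>l. l < length Ss \<Longrightarrow>
      mat_dim (rdim (Ss ! l)) (rdim Q) {f. hom H Q (Ss ! l) f \<and> f * 1\<^sub>m (rdim Q) = f} (c l)"
     "mtrace (1\<^sub>m (rdim Q) * ract Q i) = (\<Sum>l<length Ss. of_nat (c l) * mtrace (ract (Ps ! l) i))"
    using trace_idempotent[OF Q hom_id[OF mQ] left_mult_one_mat[OF one_carrier_mat]] i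
    by blast
  have "{f. hom H Q (Ss ! l) f \<and> f * 1\<^sub>m (rdim Q) = f} = {f. hom H Q (Ss ! l) f}" for l
    using right_mult_one_mat[OF homD(1)] by blast
  hence "c l = d l" if "l < length Ss" for l using mat_dim_unique[OF c(1)[OF that]] d[OF that] by simp
  thus ?thesis using c(2) left_mult_one_mat[OF is_moduleD(1)[OF mQ i]] by simp
qed

end

section \<open>Sweedler sums and tensor products\<close>

text \<open>Sweedler sum: \<open>sw H i f\<close> is \<open>\<Sum> f (x\<^sub>1, x\<^sub>2)\<close> for \<open>x = b\<^sub>i\<close> and \<open>f\<close> given on basis elements.\<close>
definition sw :: "('k::field, 'z) hopf_scheme \<Rightarrow> nat \<Rightarrow> (nat \<Rightarrow> nat \<Rightarrow> 'k) \<Rightarrow> 'k" where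
  "sw H i f = (\<Sum>j<hdim H. \<Sum>l<hdim H. hdelta H i j l * f j l)"

lemma sw_cong:
  "(\<And>j l. j < hdim H \<Longrightarrow> l < hdim H \<Longrightarrow> f j l = g j l) \<Longrightarrow> sw H i f = sw H i g"
  unfolding sw_def by (intro sum.cong refl) simp

lemma sw_sum: "sw H i (\<lambda>j l. \<Sum>x\<in>X. f x j l) = (\<Sum>x\<in>X. sw H i (f x))"
proof -
  have "sw H i (\<lambda>j l. \<Sum>x\<in>X. f x j l) = (\<Sum>j<hdim H. \<Sum>l<hdim H. \<Sum>x\<in>X. hdelta H i j l * f x j l)"
    unfolding sw_def by (simp add: sum_distrib_left)
  also have "\<dots> = (\<Sum>j<hdim H. \<Sum>x\<in>X. \<Sum>l<hdim H. hdelta H i j l * f x j l)"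
    by (intro sum.cong refl sum.swap)
  also have "\<dots> = (\<Sum>x\<in>X. sw H i (f x))" unfolding sw_def by (rule sum.swap)
  finally show ?thesis .
qed

lemma sw_scale: "sw H i (\<lambda>j l. c * f j l) = c * sw H i f"
  unfolding sw_def by (simp add: sum_distrib_left sum_distrib_right mult_ac)

lemma sw_scale_right: "sw H i (\<lambda>j l. f j l * c) = sw H i f * c"
  unfolding sw_def by (simp add: sum_distrib_left sum_distrib_right mult_ac)

lemma sw_swap: "sw H i (\<lambda>a b. sw H j (\<lambda>c e. f a b c e)) = sw H j (\<lambda>c e. sw H i (\<lambda>a b. f a b c e))"
proof -
  have "sw H i (\<lambda>a b. sw H j (\<lambda>c e. f a b c e)) =
      sw H i (\<lambda>a b. \<Sum>c<hdim H. \<Sum>e<hdim H. hdelta H j c e * f a b c e)"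
    by (simp add: sw_def)
  also have "\<dots> = (\<Sum>c<hdim H. \<Sum>e<hdim H. hdelta H j c e * sw H i (\<lambda>a b. f a b c e))"
    by (simp only: sw_sum sw_scale)
  also have "\<dots> = sw H j (\<lambda>c e. sw H i (\<lambda>a b. f a b c e))" by (simp add: sw_def)
  finally show ?thesis .
qed

lemma hopf_axioms:
  fixes H :: "('k::field, 'z) hopf_scheme"
  assumes "hopf_algebra H"
  shows hopf_coassoc: "\<And>i p q r. i < hdim H \<Longrightarrow> p < hdim H \<Longrightarrow> q < hdim H \<Longrightarrow> r < hdim H \<Longrightarrow>
      (\<Sum>j<hdim H. hdelta H i j r * hdelta H j p q) = (\<Sum>l<hdim H. hdelta H i p l * hdelta H l q r)"
    and hopf_counit_left: "\<And>i l. i < hdim H \<Longrightarrow> l < hdim H \<Longrightarrow> (\<Sum>j<hdim H. heps H j * hdelta H i j l) = kdelta i l"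
    and hopf_counit_right: "\<And>i l. i < hdim H \<Longrightarrow> l < hdim H \<Longrightarrow> (\<Sum>j<hdim H. hdelta H i l j * heps H j) = kdelta i l"
    and hopf_comult_mult: "\<And>i j p q. i < hdim H \<Longrightarrow> j < hdim H \<Longrightarrow> p < hdim H \<Longrightarrow> q < hdim H \<Longrightarrow>
        (\<Sum>l<hdim H. hmu H i j l * hdelta H l p q) =
        (\<Sum>a<hdim H. \<Sum>b<hdim H. \<Sum>c<hdim H. \<Sum>e<hdim H. hdelta H i a b * hdelta H j c e * hmu H a c p * hmu H b e q)"
    and hopf_comult_unit: "\<And>p q. p < hdim H \<Longrightarrow> q < hdim H \<Longrightarrow>
        (\<Sum>l<hdim H. heta H l * hdelta H l p q) = heta H p * heta H q"
    and hopf_counit_mult: "\<And>i j. i < hdim H \<Longrightarrow> j < hdim H \<Longrightarrow> (\<Sum>l<hdim H. hmu H i j l * heps H l) = heps H i * heps H j"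
    and hopf_counit_unit: "(\<Sum>l<hdim H. heta H l * heps H l) = 1"
    and hopf_antipode_left: "\<And>i q. i < hdim H \<Longrightarrow> q < hdim H \<Longrightarrow>
        (\<Sum>j<hdim H. \<Sum>l<hdim H. \<Sum>a<hdim H. hdelta H i j l * hanti H j a * hmu H a l q) = heps H i * heta H q"
    and hopf_antipode_right: "\<And>i q. i < hdim H \<Longrightarrow> q < hdim H \<Longrightarrow>
        (\<Sum>j<hdim H. \<Sum>l<hdim H. \<Sum>a<hdim H. hdelta H i j l * hanti H l a * hmu H j a q) = heps H i * heta H q"
proof goal_cases
  note ax = assms[unfolded hopf_algebra_def Let_def]
  note ax1 = ax[THEN conjunct2, THEN conjunct2]
  note ax2 = ax1[THEN conjunct2]
  note ax3 = ax2[THEN conjunct2]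
  note ax4 = ax3[THEN conjunct2]
  note ax5 = ax4[THEN conjunct2]
  note ax6 = ax5[THEN conjunct2]
  note ax7 = ax6[THEN conjunct2]
  {
    case 1 thus ?case using ax1[THEN conjunct1] by blast
  next
    case 2 thus ?case using ax2[THEN conjunct1] by blast
  next
    case 3 thus ?case using ax2[THEN conjunct1] by blast
  next
    case 4 thus ?case using ax3[THEN conjunct1] by blast
  next
    case 5 thus ?case using ax4[THEN conjunct1] by blast
  next
    case 6 thus ?case using ax5[THEN conjunct1] by blast
  next
    case 7 show ?case by (rule ax6[THEN conjunct1])
  next
    case 8 thus ?case using ax7 by blast
  next
    case 9 thus ?case using ax7 by blast
  }
qed

lemma sw_counit_left:
  assumes H: "hopf_algebra H" and i: "i < hdim H"
  shows "sw H i (\<lambda>j l. heps H j * f l) = f i"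
proof -
  have "sw H i (\<lambda>j l. heps H j * f l) = (\<Sum>l<hdim H. (\<Sum>j<hdim H. heps H j * hdelta H i j l) * f l)"
    unfolding sw_def by (subst sum.swap) (simp add: sum_distrib_left sum_distrib_right mult_ac)
  also have "\<dots> = (\<Sum>l<hdim H. if l = i then f l else 0)"
    by (intro sum.cong refl) (auto simp: hopf_counit_left[OF H i] kdelta_def)
  finally show ?thesis using i by simp
qed

lemma sw_counit_right:
  assumes H: "hopf_algebra H" and i: "i < hdim H"
  shows "sw H i (\<lambda>l j. heps H j * f l) = f i"
proof -
  have "sw H i (\<lambda>l j. heps H j * f l) = (\<Sum>l<hdim H. (\<Sum>j<hdim H. hdelta H i l j * heps H j) * f l)"
    unfolding sw_def by (simp add: sum_distrib_left sum_distrib_right mult_ac)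
  also have "\<dots> = (\<Sum>l<hdim H. if l = i then f l else 0)"
    by (intro sum.cong refl) (auto simp: hopf_counit_right[OF H i] kdelta_def)
  finally show ?thesis using i by simp
qed

text \<open>Evaluates a bilinear function on the coproduct of the element with coordinates
  \<open>c\<close>. Through it the axioms on structure constants become rewrite rules for Sweedler
  sums.\<close>

lemma sum_sw:
  "(\<Sum>l<hdim H. c l * sw H l f) = (\<Sum>p<hdim H. \<Sum>q<hdim H. (\<Sum>l<hdim H. c l * hdelta H l p q) * f p q)"
proof -
  let ?D = "{..<hdim H}"
  have "(\<Sum>l\<in>?D. c l * sw H l f) = (\<Sum>l\<in>?D. \<Sum>p\<in>?D. \<Sum>q\<in>?D. c l * hdelta H l p q * f p q)"
    unfolding sw_def by (simp add: sum_distrib_left mult_ac)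
  also have "\<dots> = (\<Sum>p\<in>?D. \<Sum>l\<in>?D. \<Sum>q\<in>?D. c l * hdelta H l p q * f p q)" by (rule sum.swap)
  also have "\<dots> = (\<Sum>p\<in>?D. \<Sum>q\<in>?D. \<Sum>l\<in>?D. c l * hdelta H l p q * f p q)"
    by (intro sum.cong refl sum.swap)
  finally show ?thesis by (simp add: sum_distrib_right)
qed

lemma sw_coassoc:
  assumes H: "hopf_algebra H" and i: "i < hdim H"
  shows "sw H i (\<lambda>j r. sw H j (\<lambda>p q. f p q r)) = sw H i (\<lambda>p l. sw H l (\<lambda>q r. f p q r))"
proof -
  let ?D = "{..<hdim H}"
  have "sw H i (\<lambda>j r. sw H j (\<lambda>p q. f p q r)) = (\<Sum>r\<in>?D. \<Sum>j\<in>?D. hdelta H i j r * sw H j (\<lambda>p q. f p q r))"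
    unfolding sw_def[of H i] by (rule sum.swap)
  also have "\<dots> = (\<Sum>r\<in>?D. \<Sum>p\<in>?D. \<Sum>q\<in>?D. (\<Sum>l\<in>?D. hdelta H i p l * hdelta H l q r) * f p q r)"
    unfolding sum_sw by (intro sum.cong refl arg_cong2[where f = "(*)"] hopf_coassoc[OF H i]) auto
  also have "\<dots> = (\<Sum>p\<in>?D. \<Sum>r\<in>?D. \<Sum>q\<in>?D. (\<Sum>l\<in>?D. hdelta H i p l * hdelta H l q r) * f p q r)"
    by (rule sum.swap)
  also have "\<dots> = (\<Sum>p\<in>?D. \<Sum>q\<in>?D. \<Sum>r\<in>?D. (\<Sum>l\<in>?D. hdelta H i p l * hdelta H l q r) * f p q r)"
    by (intro sum.cong refl sum.swap)
  also have "\<dots> = sw H i (\<lambda>p l. sw H l (\<lambda>q r. f p q r))"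
    unfolding sw_def[of H i] sum_sw ..
  finally show ?thesis .
qed

lemma sw_mult:
  assumes H: "hopf_algebra H" and ij: "i < hdim H" "j < hdim H"
  shows "(\<Sum>l<hdim H. hmu H i j l * sw H l f) =
    sw H i (\<lambda>a b. sw H j (\<lambda>c e. \<Sum>p<hdim H. \<Sum>q<hdim H. hmu H a c p * hmu H b e q * f p q))"
proof -
  let ?D = "{..<hdim H}"
  have "(\<Sum>l\<in>?D. hmu H i j l * sw H l f) = (\<Sum>p\<in>?D. \<Sum>q\<in>?D. (\<Sum>l\<in>?D. hmu H i j l * hdelta H l p q) * f p q)"
    by (rule sum_sw)
  also have "\<dots> = (\<Sum>p\<in>?D. \<Sum>q\<in>?D. sw H i (\<lambda>a b. sw H j (\<lambda>c e. hmu H a c p * hmu H b e q)) * f p q)"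
  proof (intro sum.cong refl arg_cong2[where f = "(*)"], goal_cases)
    case (1 p q)
    hence pq: "p < hdim H" "q < hdim H" by auto
    show ?case
      unfolding hopf_comult_mult[OF H ij pq] by (simp add: sw_def sum_distrib_left mult_ac)
  qed
  also have "\<dots> = sw H i (\<lambda>a b. sw H j (\<lambda>c e. \<Sum>p<hdim H. \<Sum>q<hdim H. hmu H a c p * hmu H b e q * f p q))"
    by (simp only: sw_sum sw_scale_right)
  finally show ?thesis .
qed

lemma sw_unit:
  assumes H: "hopf_algebra H"
  shows "(\<Sum>l<hdim H. heta H l * sw H l f) = (\<Sum>p<hdim H. \<Sum>q<hdim H. heta H p * heta H q * f p q)"
  unfolding sum_sw by (simp add: hopf_comult_unit[OF H])

lemma module_mult_entry:
  assumes V: "is_module H V" and ij: "i < hdim H" "j < hdim H" and rt: "r < rdim V" "t < rdim V"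
  shows "(\<Sum>u<rdim V. ract V i $$ (r, u) * ract V j $$ (u, t)) = (\<Sum>l<hdim H. hmu H i j l * ract V l $$ (r, t))"
  using mult_mat_entry[OF is_moduleD(1)[OF V ij(1)] is_moduleD(1)[OF V ij(2)] rt] rt
  unfolding is_moduleD(2)[OF V ij] by (simp add: lincomb_def)

lemma module_unit_entry:
  assumes V: "is_module H V" and rt: "r < rdim V" "t < rdim V"
  shows "(\<Sum>l<hdim H. heta H l * ract V l $$ (r, t)) = (if r = t then 1 else 0)"
proof -
  have "lincomb H V (heta H) $$ (r, t) = (if r = t then 1 else 0)"
    unfolding is_moduleD(3)[OF V] using rt by simp
  thus ?thesis using rt by (simp add: lincomb_def)
qed

lemma is_module_entryI:
  assumes c: "\<And>i. i < hdim H \<Longrightarrow> ract V i \<in> mats V V"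
    and m: "\<And>i j r t. i < hdim H \<Longrightarrow> j < hdim H \<Longrightarrow> r < rdim V \<Longrightarrow> t < rdim V \<Longrightarrow>
      (\<Sum>u<rdim V. ract V i $$ (r, u) * ract V j $$ (u, t)) = (\<Sum>l<hdim H. hmu H i j l * ract V l $$ (r, t))"
    and u: "\<And>r t. r < rdim V \<Longrightarrow> t < rdim V \<Longrightarrow>
      (\<Sum>l<hdim H. heta H l * ract V l $$ (r, t)) = (if r = t then 1 else 0)"
  shows "is_module H V"
  unfolding is_module_def
proof (intro conjI allI impI)
  fix i j assume ij: "i < hdim H" "j < hdim H"
  show "ract V i * ract V j = lincomb H V (hmu H i j)"
  proof (rule eq_matI)
    fix r t assume "r < dim_row (lincomb H V (hmu H i j))" "t < dim_col (lincomb H V (hmu H i j))"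
    hence rt: "r < rdim V" "t < rdim V" by (auto simp: lincomb_def)
    show "(ract V i * ract V j) $$ (r, t) = lincomb H V (hmu H i j) $$ (r, t)"
      unfolding mult_mat_entry[OF c[OF ij(1)] c[OF ij(2)] rt] m[OF ij rt] using rt by (simp add: lincomb_def)
  qed (use c ij in \<open>auto simp: lincomb_def\<close>)
next
  show "lincomb H V (heta H) = 1\<^sub>m (rdim V)"
    by (rule eq_matI) (auto simp: lincomb_def u)
qed (rule c)

lemma div_mod_less:
  assumes "(r::nat) < a * b"
  shows "r div b < a" "r mod b < b"
proof -
  have "b > 0" using assms by (cases b) auto
  thus "r div b < a" "r mod b < b" using assms by (auto simp: less_mult_imp_div_less)
qed

lemma pair_index_less: "i < a \<Longrightarrow> j < b \<Longrightarrow> i * b + j < a * (b::nat)"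
proof -
  assume "i < a" "j < b"
  hence "i * b + j < Suc i * b" by simp
  also have "\<dots> \<le> a * b" using \<open>i < a\<close> by (intro mult_le_mono1) simp
  finally show ?thesis .
qed

lemma sum_div_mod:
  "(\<Sum>k<a * b. g (k div b) (k mod b)) = (\<Sum>i<a. \<Sum>j<(b::nat). g i j)"
proof -
  have "(\<Sum>i<a. \<Sum>j<b. g i j) = (\<Sum>(i, j)\<in>{..<a} \<times> {..<b}. g i j)" by (rule sum.cartesian_product)
  also have "\<dots> = (\<Sum>k<a * b. g (k div b) (k mod b))"
  proof (rule sum.reindex_bij_witness[of _ "\<lambda>k. (k div b, k mod b)" "\<lambda>(i, j). i * b + j"])
    fix x assume x: "x \<in> {..<a} \<times> {..<b}"
    obtain i j where ij: "x = (i, j)" by (cases x)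
    hence l: "i < a" "j < b" using x by auto
    show "((case x of (i, j) \<Rightarrow> i * b + j) div b, (case x of (i, j) \<Rightarrow> i * b + j) mod b) = x"
      using l unfolding ij by simp
    show "(case x of (i, j) \<Rightarrow> i * b + j) \<in> {..<a * b}" using pair_index_less[OF l] unfolding ij by simp
    show "g ((case x of (i, j) \<Rightarrow> i * b + j) div b) ((case x of (i, j) \<Rightarrow> i * b + j) mod b) = (case x of (i, j) \<Rightarrow> g i j)"
      using l unfolding ij by simp
  next
    fix k assume k: "k \<in> {..<a * b}"
    thus "(k div b, k mod b) \<in> {..<a} \<times> {..<b}" using div_mod_less by auto
    show "(case (k div b, k mod b) of (i, j) \<Rightarrow> i * b + j) = k" by simp
  qed
  finally show ?thesis by simp
qed

lemma tensor_dim [simp]: "rdim (tensor H V W) = rdim V * rdim W"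
  by (simp add: tensor_def rdim_def)

lemma tensor_carrier: "ract (tensor H V W) i \<in> carrier_mat (rdim V * rdim W) (rdim V * rdim W)"
  by (simp add: tensor_def ract_def)

lemma tensor_entry:
  assumes "r < rdim V * rdim W" "t < rdim V * rdim W"
  shows "ract (tensor H V W) i $$ (r, t) = sw H i (\<lambda>j l.
     ract V j $$ (r div rdim W, t div rdim W) * ract W l $$ (r mod rdim W, t mod rdim W))"
  using assms by (simp add: tensor_def ract_def sw_def mult.assoc)

text \<open>A product of two actions is a double Sweedler sum in which the two tensor factors
  multiply separately; \<open>sw_mult\<close>, multiplicativity of the coproduct, contracts it to
  the action of the product. \<open>sw_unit\<close> does the same for the unit.\<close>

lemma is_module_tensor:
  assumes H: "hopf_algebra H" and V: "is_module H V" and W: "is_module H W"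
  shows "is_module H (tensor H V W)"
proof (rule is_module_entryI, unfold tensor_dim)
  let ?v = "rdim V" and ?w = "rdim W" and ?T = "tensor H V W"
  show "ract ?T i \<in> carrier_mat (?v * ?w) (?v * ?w)" for i by (rule tensor_carrier)
  {
    fix i j r t assume ij: "i < hdim H" "j < hdim H" and rt: "r < ?v * ?w" "t < ?v * ?w"
    note r = div_mod_less[OF rt(1)] and t = div_mod_less[OF rt(2)]
    let ?r1 = "r div ?w" and ?r2 = "r mod ?w" and ?t1 = "t div ?w" and ?t2 = "t mod ?w"
    have "(\<Sum>u<?v * ?w. ract ?T i $$ (r, u) * ract ?T j $$ (u, t)) =
      (\<Sum>u<?v * ?w. sw H i (\<lambda>a b. ract V a $$ (?r1, u div ?w) * ract W b $$ (?r2, u mod ?w)) *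
         sw H j (\<lambda>c e. ract V c $$ (u div ?w, ?t1) * ract W e $$ (u mod ?w, ?t2)))"
      by (intro sum.cong refl) (simp add: tensor_entry rt)
    also have "\<dots> = (\<Sum>x<?v. \<Sum>y<?w. sw H i (\<lambda>a b. ract V a $$ (?r1, x) * ract W b $$ (?r2, y)) *
         sw H j (\<lambda>c e. ract V c $$ (x, ?t1) * ract W e $$ (y, ?t2)))"
      by (rule sum_div_mod[of "\<lambda>x y. sw H i (\<lambda>a b. ract V a $$ (?r1, x) * ract W b $$ (?r2, y)) *
         sw H j (\<lambda>c e. ract V c $$ (x, ?t1) * ract W e $$ (y, ?t2))"])
    also have "\<dots> = (\<Sum>x<?v. \<Sum>y<?w. sw H i (\<lambda>a b. sw H j (\<lambda>c e.
        ract V a $$ (?r1, x) * ract W b $$ (?r2, y) * (ract V c $$ (x, ?t1) * ract W e $$ (y, ?t2)))))"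
      by (simp only: sw_scale sw_scale_right)
    also have "\<dots> = sw H i (\<lambda>a b. sw H j (\<lambda>c e. \<Sum>x<?v. \<Sum>y<?w.
        ract V a $$ (?r1, x) * ract W b $$ (?r2, y) * (ract V c $$ (x, ?t1) * ract W e $$ (y, ?t2))))"
      by (simp only: sw_sum)
    also have "\<dots> = sw H i (\<lambda>a b. sw H j (\<lambda>c e. \<Sum>p<hdim H. \<Sum>q<hdim H. hmu H a c p * hmu H b e q *
        (ract V p $$ (?r1, ?t1) * ract W q $$ (?r2, ?t2))))"
    proof (intro sw_cong, goal_cases)
      case l: (1 a b c e)
      have "(\<Sum>x<?v. \<Sum>y<?w. ract V a $$ (?r1, x) * ract W b $$ (?r2, y) * (ract V c $$ (x, ?t1) * ract W e $$ (y, ?t2)))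
        = (\<Sum>x<?v. \<Sum>y<?w. (ract V a $$ (?r1, x) * ract V c $$ (x, ?t1)) * (ract W b $$ (?r2, y) * ract W e $$ (y, ?t2)))"
        by (simp add: mult_ac)
      also have "\<dots> = (\<Sum>p<hdim H. hmu H a c p * ract V p $$ (?r1, ?t1)) * (\<Sum>q<hdim H. hmu H b e q * ract W q $$ (?r2, ?t2))"
        unfolding sum_product[symmetric] module_mult_entry[OF V l(1,3) r(1) t(1)] module_mult_entry[OF W l(2,4) r(2) t(2)] ..
      also have "\<dots> = (\<Sum>p<hdim H. \<Sum>q<hdim H. hmu H a c p * hmu H b e q * (ract V p $$ (?r1, ?t1) * ract W q $$ (?r2, ?t2)))"
        by (simp add: sum_product mult_ac)
      finally show ?case .
    qed
    also have "\<dots> = (\<Sum>l<hdim H. hmu H i j l * sw H l (\<lambda>p q. ract V p $$ (?r1, ?t1) * ract W q $$ (?r2, ?t2)))"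
      by (rule sw_mult[OF H ij, symmetric])
    also have "\<dots> = (\<Sum>l<hdim H. hmu H i j l * ract ?T l $$ (r, t))"
      by (simp add: tensor_entry[OF rt])
    finally show "(\<Sum>u<?v * ?w. ract ?T i $$ (r, u) * ract ?T j $$ (u, t)) =
      (\<Sum>l<hdim H. hmu H i j l * ract ?T l $$ (r, t))" .
  }
  fix r t assume rt: "r < ?v * ?w" "t < ?v * ?w"
  note r = div_mod_less[OF rt(1)] and t = div_mod_less[OF rt(2)]
  let ?r1 = "r div ?w" and ?r2 = "r mod ?w" and ?t1 = "t div ?w" and ?t2 = "t mod ?w"
  have "(\<Sum>l<hdim H. heta H l * ract ?T l $$ (r, t)) =
     (\<Sum>l<hdim H. heta H l * sw H l (\<lambda>p q. ract V p $$ (?r1, ?t1) * ract W q $$ (?r2, ?t2)))"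
    by (simp add: tensor_entry[OF rt])
  also have "\<dots> = (\<Sum>p<hdim H. \<Sum>q<hdim H. (heta H p * ract V p $$ (?r1, ?t1)) * (heta H q * ract W q $$ (?r2, ?t2)))"
    unfolding sw_unit[OF H] by (simp add: mult_ac)
  also have "\<dots> = (if ?r1 = ?t1 then 1 else 0) * (if ?r2 = ?t2 then 1 else 0)"
    unfolding sum_product[symmetric] module_unit_entry[OF V r(1) t(1)] module_unit_entry[OF W r(2) t(2)] ..
  also have "\<dots> = (if r = t then 1 else 0)" 
  proof -
    have "r = t \<longleftrightarrow> ?r1 = ?t1 \<and> ?r2 = ?t2" by (metis div_mult_mod_eq)
    thus ?thesis by simp
  qed
  finally show "(\<Sum>l<hdim H. heta H l * ract ?T l $$ (r, t)) = (if r = t then 1 else 0)" .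
qed

section \<open>The antipode and dual modules\<close>

text \<open>Matrices as plain functions, with \<open>n\<close> the range of the inner index. Without
  carrier conditions a product can be moved in and out of Sweedler sums by rewriting alone, as
  convolution arguments demand.\<close>

definition mm :: "nat \<Rightarrow> (nat \<Rightarrow> nat \<Rightarrow> 'k::field) \<Rightarrow> (nat \<Rightarrow> nat \<Rightarrow> 'k) \<Rightarrow> nat \<Rightarrow> nat \<Rightarrow> 'k" where
  "mm n A B r t = (\<Sum>u<n. A r u * B u t)"

text \<open>The identity cut off at \<open>n\<close>. It is neutral for functions that vanish
  outside the frame, which \<open>ent\<close> and \<open>aent\<close> do.\<close>

definition idm :: "nat \<Rightarrow> nat \<Rightarrow> nat \<Rightarrow> 'k::field" where
  "idm n r t = (if r = t \<and> r < n then 1 else 0)"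

text \<open>Matrix entries are extended by zero, so that identities hold without index bounds.\<close>
definition ent :: "'k::field rep \<Rightarrow> nat \<Rightarrow> nat \<Rightarrow> nat \<Rightarrow> 'k" where
  "ent V i r t = (if r < rdim V \<and> t < rdim V then ract V i $$ (r, t) else 0)"

text \<open>The entries of \<open>\<rho>(S(b\<^sub>i))\<close>.\<close>
definition aent :: "('k::field, 'z) hopf_scheme \<Rightarrow> 'k rep \<Rightarrow> nat \<Rightarrow> nat \<Rightarrow> nat \<Rightarrow> 'k" where
  "aent H V i r t = (\<Sum>m<hdim H. hanti H i m * ent V m r t)"

lemma mm_assoc: "mm n (mm n A B) C = mm n A (mm n B C)"
proof (intro ext)
  fix r t
  have "mm n (mm n A B) C r t = (\<Sum>u<n. \<Sum>w<n. A r w * B w u * C u t)"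
    by (simp add: mm_def sum_distrib_right)
  also have "\<dots> = (\<Sum>w<n. \<Sum>u<n. A r w * B w u * C u t)" by (rule sum.swap)
  also have "\<dots> = mm n A (mm n B C) r t" by (simp add: mm_def sum_distrib_left mult.assoc)
  finally show "mm n (mm n A B) C r t = mm n A (mm n B C) r t" .
qed

lemma mm_sw_right: "mm n A (\<lambda>r t. sw H i (\<lambda>a b. F a b r t)) r t = sw H i (\<lambda>a b. mm n A (F a b) r t)"
  by (simp only: mm_def sw_sum sw_scale)

lemma mm_sw_left: "mm n (\<lambda>r t. sw H i (\<lambda>a b. F a b r t)) A r t = sw H i (\<lambda>a b. mm n (F a b) A r t)"
  by (simp only: mm_def sw_sum sw_scale_right)

lemma mm_scale_right: "mm n A (\<lambda>r t. c * B r t) r t = c * mm n A B r t"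
  by (simp add: mm_def sum_distrib_left mult_ac)

lemma mm_scale_left: "mm n (\<lambda>r t. c * B r t) A r t = c * mm n B A r t"
  by (simp add: mm_def sum_distrib_left mult_ac)

lemma mm_sum_right: "mm n A (\<lambda>r t. \<Sum>x\<in>X. F x r t) r t = (\<Sum>x\<in>X. mm n A (F x) r t)"
  unfolding mm_def sum_distrib_left by (rule sum.swap)

lemma mm_sum_left: "mm n (\<lambda>r t. \<Sum>x\<in>X. F x r t) A r t = (\<Sum>x\<in>X. mm n (F x) A r t)"
  unfolding mm_def sum_distrib_right by (rule sum.swap)

lemma mm_idm_left: "(\<And>r t. n \<le> r \<Longrightarrow> A r t = 0) \<Longrightarrow> mm n (idm n) A = A"
proof (intro ext)
  fix r t assume z: "\<And>r t. n \<le> r \<Longrightarrow> A r t = 0"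
  have "mm n (idm n) A r t = (\<Sum>u<n. if u = r then A u t else 0)"
    unfolding mm_def by (intro sum.cong refl) (auto simp: idm_def)
  also have "\<dots> = A r t" using z[of r t] by (cases "r < n") auto
  finally show "mm n (idm n) A r t = A r t" .
qed

lemma mm_idm_right: "(\<And>r t. n \<le> t \<Longrightarrow> A r t = 0) \<Longrightarrow> mm n A (idm n) = A"
proof (intro ext)
  fix r t assume z: "\<And>r t. n \<le> t \<Longrightarrow> A r t = 0"
  have "mm n A (idm n) r t = (\<Sum>u<n. if u = t then A r u else 0)"
    unfolding mm_def by (intro sum.cong refl) (auto simp: idm_def)
  also have "\<dots> = A r t" using z[of t r] by (cases "t < n") auto
  finally show "mm n A (idm n) r t = A r t" .
qed

lemma ent_zero: "rdim V \<le> r \<Longrightarrow> ent V i r t = 0" "rdim V \<le> t \<Longrightarrow> ent V i r t = 0"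
  by (auto simp: ent_def)

lemma aent_zero: "rdim V \<le> r \<Longrightarrow> aent H V i r t = 0" "rdim V \<le> t \<Longrightarrow> aent H V i r t = 0"
  by (auto simp: aent_def ent_zero)

lemma ent_mult:
  assumes V: "is_module H V" and ij: "i < hdim H" "j < hdim H"
  shows "mm (rdim V) (ent V i) (ent V j) r t = (\<Sum>l<hdim H. hmu H i j l * ent V l r t)"
proof (cases "r < rdim V \<and> t < rdim V")
  case True
  hence rt: "r < rdim V" "t < rdim V" by auto
  have "mm (rdim V) (ent V i) (ent V j) r t = (\<Sum>u<rdim V. ract V i $$ (r, u) * ract V j $$ (u, t))"
    unfolding mm_def using rt by (intro sum.cong) (auto simp: ent_def)
  also have "\<dots> = (\<Sum>l<hdim H. hmu H i j l * ract V l $$ (r, t))" by (rule module_mult_entry[OF V ij rt])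
  finally show ?thesis using rt by (simp add: ent_def)
next
  case False
  thus ?thesis by (auto simp: mm_def ent_def)
qed

lemma ent_unit:
  assumes V: "is_module H V"
  shows "(\<Sum>l<hdim H. heta H l * ent V l r t) = idm (rdim V) r t"
proof (cases "r < rdim V \<and> t < rdim V")
  case True
  thus ?thesis using module_unit_entry[OF V, of r t] by (simp add: ent_def idm_def)
next
  case False
  thus ?thesis by (auto simp: idm_def ent_def)
qed

text \<open>The identity "sum of S(x_1) x_2 is epsilon(x) 1" pushed through the representation. It
  and its mirror image for x_1 S(x_2) are the form in which the antipode axioms are used from here
  on.\<close>

lemma antipode_left_ent:
  assumes H: "hopf_algebra H" and V: "is_module H V" and i: "i < hdim H"
  shows "sw H i (\<lambda>a b. mm (rdim V) (aent H V a) (ent V b) r t) = heps H i * idm (rdim V) r t"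
proof -
  let ?D = "{..<hdim H}"
  have "sw H i (\<lambda>a b. mm (rdim V) (aent H V a) (ent V b) r t) =
      sw H i (\<lambda>a b. \<Sum>m\<in>?D. \<Sum>q\<in>?D. hanti H a m * hmu H m b q * ent V q r t)"
  proof (rule sw_cong, goal_cases)
    case ab: (1 a b)
    have "mm (rdim V) (aent H V a) (ent V b) r t = (\<Sum>m\<in>?D. hanti H a m * mm (rdim V) (ent V m) (ent V b) r t)"
      unfolding aent_def mm_sum_left mm_scale_left ..
    also have "\<dots> = (\<Sum>m\<in>?D. \<Sum>q\<in>?D. hanti H a m * hmu H m b q * ent V q r t)"
      by (intro sum.cong refl) (simp add: ent_mult[OF V _ ab(2)] sum_distrib_left mult.assoc)
    finally show ?case .
  qed
  also have "\<dots> = sw H i (\<lambda>a b. \<Sum>q\<in>?D. \<Sum>m\<in>?D. hanti H a m * hmu H m b q * ent V q r t)"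
    by (intro sw_cong sum.swap)
  also have "\<dots> = (\<Sum>q\<in>?D. sw H i (\<lambda>a b. \<Sum>m\<in>?D. hanti H a m * hmu H m b q) * ent V q r t)"
    by (simp only: sw_sum sw_scale_right sum_distrib_right[symmetric])
  also have "\<dots> = (\<Sum>q\<in>?D. heps H i * heta H q * ent V q r t)"
  proof (intro sum.cong refl arg_cong2[where f = "(*)"], goal_cases)
    case (1 q)
    hence q: "q < hdim H" by simp
    show ?case
      unfolding hopf_antipode_left[OF H i q, symmetric] sw_def by (simp add: sum_distrib_left mult.assoc)
  qed
  also have "\<dots> = heps H i * idm (rdim V) r t"
    unfolding ent_unit[OF V, symmetric] by (simp add: sum_distrib_left mult.assoc)
  finally show ?thesis .
qed

lemma antipode_right_ent:
  assumes H: "hopf_algebra H" and V: "is_module H V" and i: "i < hdim H"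
  shows "sw H i (\<lambda>a b. mm (rdim V) (ent V a) (aent H V b) r t) = heps H i * idm (rdim V) r t"
proof -
  let ?D = "{..<hdim H}"
  have "sw H i (\<lambda>a b. mm (rdim V) (ent V a) (aent H V b) r t) =
      sw H i (\<lambda>a b. \<Sum>m\<in>?D. \<Sum>q\<in>?D. hanti H b m * hmu H a m q * ent V q r t)"
  proof (rule sw_cong, goal_cases)
    case ab: (1 a b)
    have "mm (rdim V) (ent V a) (aent H V b) r t = (\<Sum>m\<in>?D. hanti H b m * mm (rdim V) (ent V a) (ent V m) r t)"
      unfolding aent_def mm_sum_right mm_scale_right ..
    also have "\<dots> = (\<Sum>m\<in>?D. \<Sum>q\<in>?D. hanti H b m * hmu H a m q * ent V q r t)"
      by (intro sum.cong refl) (simp add: ent_mult[OF V ab(1)] sum_distrib_left mult.assoc)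
    finally show ?case .
  qed
  also have "\<dots> = sw H i (\<lambda>a b. \<Sum>q\<in>?D. \<Sum>m\<in>?D. hanti H b m * hmu H a m q * ent V q r t)"
    by (intro sw_cong sum.swap)
  also have "\<dots> = (\<Sum>q\<in>?D. sw H i (\<lambda>a b. \<Sum>m\<in>?D. hanti H b m * hmu H a m q) * ent V q r t)"
    by (simp only: sw_sum sw_scale_right sum_distrib_right[symmetric])
  also have "\<dots> = (\<Sum>q\<in>?D. heps H i * heta H q * ent V q r t)"
  proof (intro sum.cong refl arg_cong2[where f = "(*)"], goal_cases)
    case (1 q)
    hence q: "q < hdim H" by simp
    show ?case
      unfolding hopf_antipode_right[OF H i q, symmetric] sw_def by (simp add: sum_distrib_left mult.assoc)
  qed
  also have "\<dots> = heps H i * idm (rdim V) r t"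
    unfolding ent_unit[OF V, symmetric] by (simp add: sum_distrib_left mult.assoc)
  finally show ?thesis .
qed

text \<open>\<open>\<rho>(S(ab))\<close> and \<open>\<rho>(S(b)) \<rho>(S(a))\<close> are both convolution inverse to \<open>\<rho>(ab)\<close> on \<open>A \<otimes> A\<close>.\<close>
lemma aent_antimult:
  assumes H: "hopf_algebra H" and V: "is_module H V" and ij: "i < hdim H" "j < hdim H"
  shows "(\<Sum>l<hdim H. hmu H i j l * aent H V l r t) = mm (rdim V) (aent H V j) (aent H V i) r t"
proof -
  let ?D = "{..<hdim H}" and ?n = "rdim V"
  let ?s = "aent H V" and ?v = "ent V"
  \<comment> \<open>The action of the antipode applied to the product of basis elements
    \<open>a\<close> and \<open>b\<close>.\<close>
  define X where "X a b r t = (\<Sum>l\<in>?D. hmu H a b l * ?s l r t)" for a b r t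
  have Xz: "X a b r t = 0" if "?n \<le> t" for a b r t using that by (simp add: X_def aent_zero)
  \<comment> \<open>The image of S(a_1 b_1) a_2 b_2 S(b_3) S(a_3). Contracting its tail leaves
    S(ab), contracting its head leaves S(b) S(a).\<close>
  define \<Phi> where "\<Phi> a b p c e q = mm ?n (mm ?n (X a b) (mm ?n (?v p) (?v c))) (mm ?n (?s e) (?s q))" for a b p c e q
  \<comment> \<open>Counits are inserted in both arguments and then expanded as x_2 S(x_3): the
    factors from \<open>j\<close> are adjacent and contract first, after which those from
    \<open>i\<close> become adjacent.\<close>
  have "X i j r t = sw H i (\<lambda>a a'. heps H a' * X a j r t)" by (rule sw_counit_right[OF H ij(1), symmetric])
  also have "\<dots> = sw H i (\<lambda>a a'. heps H a' * sw H j (\<lambda>b b'. heps H b' * X a b r t))"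
    by (simp only: sw_counit_right[OF H ij(2)])
  also have "\<dots> = sw H i (\<lambda>a a'. sw H j (\<lambda>b b'. heps H a' * (heps H b' * X a b r t)))"
    by (simp only: sw_scale)
  also have "\<dots> = sw H i (\<lambda>a a'. sw H j (\<lambda>b b'. sw H a' (\<lambda>p q. sw H b' (\<lambda>c e. \<Phi> a b p c e q r t))))"
  proof (intro sw_cong, goal_cases)
    case (1 a a' b b')
    note l = 1(2,4)
    have "sw H a' (\<lambda>p q. sw H b' (\<lambda>c e. \<Phi> a b p c e q r t)) =
      sw H a' (\<lambda>p q. sw H b' (\<lambda>c e. mm ?n (mm ?n (X a b) (?v p)) (mm ?n (mm ?n (?v c) (?s e)) (?s q)) r t))"
      by (simp only: \<Phi>_def mm_assoc)
    also have "\<dots> = sw H a' (\<lambda>p q. mm ?n (mm ?n (X a b) (?v p)) (mm ?n (\<lambda>r t. sw H b' (\<lambda>c e. mm ?n (?v c) (?s e) r t)) (?s q)) r t)"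
      by (simp only: mm_sw_right[symmetric] mm_sw_left[symmetric, abs_def])
    also have "\<dots> = sw H a' (\<lambda>p q. heps H b' * mm ?n (mm ?n (X a b) (?v p)) (?s q) r t)"
      by (simp only: antipode_right_ent[OF H V l(2)] mm_scale_left[abs_def] mm_scale_right mm_idm_left[OF aent_zero(1)])
    also have "\<dots> = heps H b' * mm ?n (X a b) (\<lambda>r t. sw H a' (\<lambda>p q. mm ?n (?v p) (?s q) r t)) r t"
      by (simp only: sw_scale mm_assoc mm_sw_right)
    also have "\<dots> = heps H b' * (heps H a' * X a b r t)"
      by (simp only: antipode_right_ent[OF H V l(1)] mm_scale_right mm_idm_right[OF Xz])
    finally show ?case by (simp add: mult_ac)
  qed
  also have "\<dots> = sw H i (\<lambda>a a'. sw H a' (\<lambda>p q. sw H j (\<lambda>b b'. sw H b' (\<lambda>c e. \<Phi> a b p c e q r t))))"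
    by (intro sw_cong sw_swap)
  \<comment> \<open>Coassociativity in each argument groups the first two legs under
    \<open>\<alpha>\<close> and \<open>\<beta>\<close>, leaving \<open>q\<close> and
    \<open>e\<close> as third legs.\<close>
  also have "\<dots> = sw H i (\<lambda>a a'. sw H a' (\<lambda>p q. sw H j (\<lambda>\<beta> e. sw H \<beta> (\<lambda>b c. \<Phi> a b p c e q r t))))"
    by (intro sw_cong sw_coassoc[OF H ij(2), symmetric])
  also have "\<dots> = sw H i (\<lambda>\<alpha> q. sw H \<alpha> (\<lambda>a p. sw H j (\<lambda>\<beta> e. sw H \<beta> (\<lambda>b c. \<Phi> a b p c e q r t))))"
    by (rule sw_coassoc[OF H ij(1), symmetric])
  also have "\<dots> = sw H i (\<lambda>\<alpha> q. sw H j (\<lambda>\<beta> e. sw H \<alpha> (\<lambda>a p. sw H \<beta> (\<lambda>b c. \<Phi> a b p c e q r t))))"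
    by (intro sw_cong sw_swap)
  also have "\<dots> = sw H i (\<lambda>\<alpha> q. sw H j (\<lambda>\<beta> e. heps H \<alpha> * (heps H \<beta> * mm ?n (?s e) (?s q) r t)))"
  proof (intro sw_cong, goal_cases)
    case (1 \<alpha> q \<beta> e)
    note l = 1(1,3)
    \<comment> \<open>As the coproduct is multiplicative, the sum runs over S(x_1) x_2 for x the
      product of \<open>\<alpha>\<close> and \<open>\<beta>\<close>; the left antipode identity and
      multiplicativity of the counit evaluate it.\<close>
    have inner: "sw H \<alpha> (\<lambda>a p. sw H \<beta> (\<lambda>b c. mm ?n (X a b) (mm ?n (?v p) (?v c)) r t)) = heps H \<alpha> * heps H \<beta> * idm ?n r t" for r t
    proof -
      have "sw H \<alpha> (\<lambda>a p. sw H \<beta> (\<lambda>b c. mm ?n (X a b) (mm ?n (?v p) (?v c)) r t)) =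
        sw H \<alpha> (\<lambda>a p. sw H \<beta> (\<lambda>b c. \<Sum>x\<in>?D. \<Sum>y\<in>?D. hmu H a b x * hmu H p c y * mm ?n (?s x) (?v y) r t))"
      proof (intro sw_cong, goal_cases)
        case (1 a p b c)
        note pc = 1(2,4)
        have "mm ?n (?v p) (?v c) = (\<lambda>r t. \<Sum>y\<in>?D. hmu H p c y * ?v y r t)"
          by (intro ext) (rule ent_mult[OF V pc])
        hence "mm ?n (X a b) (mm ?n (?v p) (?v c)) r t =
            mm ?n (\<lambda>r t. \<Sum>x\<in>?D. hmu H a b x * ?s x r t) (\<lambda>r t. \<Sum>y\<in>?D. hmu H p c y * ?v y r t) r t"
          by (simp only: X_def[abs_def])
        also have "\<dots> = (\<Sum>x\<in>?D. hmu H a b x * (\<Sum>y\<in>?D. hmu H p c y * mm ?n (?s x) (?v y) r t))"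
          by (simp only: mm_sum_left mm_scale_left mm_sum_right mm_scale_right)
        also have "\<dots> = (\<Sum>x\<in>?D. \<Sum>y\<in>?D. hmu H a b x * hmu H p c y * mm ?n (?s x) (?v y) r t)"
          by (simp only: sum_distrib_left mult.assoc)
        finally show ?case .
      qed
      also have "\<dots> = (\<Sum>l\<in>?D. hmu H \<alpha> \<beta> l * sw H l (\<lambda>x y. mm ?n (?s x) (?v y) r t))"
        by (rule sw_mult[OF H l, symmetric])
      also have "\<dots> = (\<Sum>l\<in>?D. hmu H \<alpha> \<beta> l * heps H l) * idm ?n r t"
        by (simp add: antipode_left_ent[OF H V] sum_distrib_right mult.assoc)
      finally show ?thesis unfolding hopf_counit_mult[OF H l] .
    qed
    have "sw H \<alpha> (\<lambda>a p. sw H \<beta> (\<lambda>b c. \<Phi> a b p c e q r t)) =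
      mm ?n (\<lambda>r t. sw H \<alpha> (\<lambda>a p. sw H \<beta> (\<lambda>b c. mm ?n (X a b) (mm ?n (?v p) (?v c)) r t))) (mm ?n (?s e) (?s q)) r t"
      by (simp only: \<Phi>_def mm_sw_left)
    also have "\<dots> = heps H \<alpha> * heps H \<beta> * mm ?n (mm ?n (idm ?n) (?s e)) (?s q) r t"
      by (simp only: inner mm_scale_left mm_assoc)
    also have "\<dots> = heps H \<alpha> * (heps H \<beta> * mm ?n (?s e) (?s q) r t)"
      by (simp only: mm_idm_left[OF aent_zero(1)] mult.assoc)
    finally show ?case .
  qed
  also have "\<dots> = sw H i (\<lambda>\<alpha> q. heps H \<alpha> * mm ?n (?s j) (?s q) r t)"
    by (simp only: sw_scale sw_counit_left[OF H ij(2)])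
  also have "\<dots> = mm ?n (?s j) (?s i) r t" by (rule sw_counit_left[OF H ij(1)])
  finally show ?thesis by (simp only: X_def)
qed

text \<open>S(1) = 1 follows from the left antipode identity at 1, since the coproduct of 1 is 1
  \<otimes> 1 and its counit is 1.\<close>

lemma aent_unit:
  assumes H: "hopf_algebra H" and V: "is_module H V"
  shows "(\<Sum>l<hdim H. heta H l * aent H V l r t) = idm (rdim V) r t"
proof -
  let ?D = "{..<hdim H}" and ?n = "rdim V"
  have "idm ?n r t = (\<Sum>l\<in>?D. heta H l * heps H l) * idm ?n r t" by (simp add: hopf_counit_unit[OF H])
  also have "\<dots> = (\<Sum>l\<in>?D. heta H l * sw H l (\<lambda>a b. mm ?n (aent H V a) (ent V b) r t))"
    by (simp add: antipode_left_ent[OF H V] sum_distrib_right mult.assoc)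
  also have "\<dots> = (\<Sum>p\<in>?D. \<Sum>q\<in>?D. heta H p * heta H q * mm ?n (aent H V p) (ent V q) r t)"
    by (rule sw_unit[OF H])
  also have "\<dots> = (\<Sum>p\<in>?D. heta H p * mm ?n (aent H V p) (\<lambda>r t. \<Sum>q\<in>?D. heta H q * ent V q r t) r t)"
    by (simp only: mm_sum_right mm_scale_right sum_distrib_left mult.assoc)
  also have "\<dots> = (\<Sum>p\<in>?D. heta H p * aent H V p r t)"
    by (simp only: ent_unit[OF V] mm_idm_right[OF aent_zero(2)])
  finally show ?thesis by simp
qed

lemma dual_dim [simp]: "rdim (dual H V) = rdim V"
  by (simp add: dual_def rdim_def)

lemma dual_carrier: "ract (dual H V) i \<in> mats V V"
  by (simp add: dual_def ract_def)

lemma dual_entry: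
  assumes "r < rdim V" "t < rdim V"
  shows "ract (dual H V) i $$ (r, t) = aent H V i t r"
  using assms by (simp add: dual_def ract_def aent_def ent_def)

text \<open>Transposition reverses products and so does the antipode (\<open>aent_antimult\<close>);
  the two reversals cancel.\<close>

lemma is_module_dual:
  assumes H: "hopf_algebra H" and V: "is_module H V"
  shows "is_module H (dual H V)"
proof (rule is_module_entryI, unfold dual_dim)
  show "ract (dual H V) i \<in> mats V V" for i by (rule dual_carrier)
  fix r t assume rt: "r < rdim V" "t < rdim V"
  {
    fix i j assume ij: "i < hdim H" "j < hdim H"
    have "(\<Sum>u<rdim V. ract (dual H V) i $$ (r, u) * ract (dual H V) j $$ (u, t)) = mm (rdim V) (aent H V j) (aent H V i) t r"
      unfolding mm_def by (intro sum.cong refl) (simp add: dual_entry rt mult.commute)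
    also have "\<dots> = (\<Sum>l<hdim H. hmu H i j l * ract (dual H V) l $$ (r, t))"
      unfolding aent_antimult[OF H V ij, symmetric] by (simp add: dual_entry[OF rt])
    finally show "(\<Sum>u<rdim V. ract (dual H V) i $$ (r, u) * ract (dual H V) j $$ (u, t)) =
      (\<Sum>l<hdim H. hmu H i j l * ract (dual H V) l $$ (r, t))" .
  }
  show "(\<Sum>l<hdim H. heta H l * ract (dual H V) l $$ (r, t)) = (if r = t then 1 else 0)"
    using rt by (auto simp: dual_entry[OF rt] aent_unit[OF H V] idm_def)
qed

text \<open>\<open>B\<close> arises from \<open>A\<close> by an operator that lets \<open>M\<close>
  act through the second Sweedler leg. Applying the operator of \<open>N\<close> and regrouping by
  coassociativity brings \<open>M\<close> and \<open>N\<close> together as a convolution product,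
  which \<open>inv\<close> collapses to the counit. Keeping \<open>M\<close> and \<open>N\<close>
  arbitrary allows the action and its antipode to be put in either order.\<close>

lemma sw_twist_inverse:
  fixes A B :: "nat \<Rightarrow> nat \<Rightarrow> 'k::field"
  assumes H: "hopf_algebra H"
    and inv: "\<And>m y' y. m < hdim H \<Longrightarrow> sw H m (\<lambda>b l. mm v (M b) (N l) y' y) = heps H m * idm v y' y"
    and B: "\<And>i y. i < hdim H \<Longrightarrow> y < v \<Longrightarrow> B i y = sw H i (\<lambda>j l. \<Sum>y'<v. M l y' y * A j y')"
    and i: "i < hdim H" and y: "y < v"
  shows "A i y = sw H i (\<lambda>j l. \<Sum>y'<v. N l y' y * B j y')"
proof -
  have "sw H i (\<lambda>j l. \<Sum>y'<v. N l y' y * B j y') =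
      sw H i (\<lambda>j l. \<Sum>y'<v. N l y' y * sw H j (\<lambda>a b. \<Sum>z<v. M b z y' * A a z))"
    by (intro sw_cong sum.cong refl) (simp add: B)
  also have "\<dots> = sw H i (\<lambda>j l. sw H j (\<lambda>a b. \<Sum>y'<v. N l y' y * (\<Sum>z<v. M b z y' * A a z)))"
    by (simp only: sw_scale sw_sum)
  also have "\<dots> = sw H i (\<lambda>a m. sw H m (\<lambda>b l. \<Sum>y'<v. N l y' y * (\<Sum>z<v. M b z y' * A a z)))"
    by (rule sw_coassoc[OF H i])
  also have "\<dots> = sw H i (\<lambda>a m. sw H m (\<lambda>b l. \<Sum>z<v. mm v (M b) (N l) z y * A a z))"
  proof (intro sw_cong, goal_cases)
    case (1 a m b l)
    have "(\<Sum>y'<v. N l y' y * (\<Sum>z<v. M b z y' * A a z)) = (\<Sum>y'<v. \<Sum>z<v. M b z y' * N l y' y * A a z)"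
      by (simp add: sum_distrib_left mult_ac)
    also have "\<dots> = (\<Sum>z<v. \<Sum>y'<v. M b z y' * N l y' y * A a z)" by (rule sum.swap)
    also have "\<dots> = (\<Sum>z<v. mm v (M b) (N l) z y * A a z)" by (simp add: mm_def sum_distrib_right)
    finally show ?case .
  qed
  also have "\<dots> = sw H i (\<lambda>a m. heps H m * A a y)"
  proof (intro sw_cong, goal_cases)
    case (1 a m)
    have "sw H m (\<lambda>b l. \<Sum>z<v. mm v (M b) (N l) z y * A a z) = (\<Sum>z<v. heps H m * idm v z y * A a z)"
      by (simp only: sw_sum sw_scale_right inv[OF 1(2)])
    also have "\<dots> = (\<Sum>z<v. if z = y then heps H m * A a z else 0)"
      by (intro sum.cong refl) (auto simp: idm_def)
    also have "\<dots> = heps H m * A a y" using y by simp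
    finally show ?case .
  qed
  also have "\<dots> = A i y" by (rule sw_counit_right[OF H i])
  finally show ?thesis by simp
qed

section \<open>The tensor-dual adjunction\<close>

text \<open>A matrix \<open>P \<rightarrow> W \<otimes> V\<^sup>*\<close> is reshaped into a matrix \<open>P \<otimes> V \<rightarrow> W\<close>, with \<open>w\<close>, \<open>p\<close>, \<open>v\<close>
  the dimensions of \<open>W\<close>, \<open>P\<close>, \<open>V\<close>.\<close>
definition unadj :: "nat \<Rightarrow> nat \<Rightarrow> nat \<Rightarrow> 'k::field mat \<Rightarrow> 'k mat" where
  "unadj w p v G = mat w (p * v) (\<lambda>(r, c). G $$ (r * v + c mod v, c div v))"

definition adj :: "nat \<Rightarrow> nat \<Rightarrow> nat \<Rightarrow> 'k::field mat \<Rightarrow> 'k mat" where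
  "adj w p v F = mat (w * v) p (\<lambda>(r, x). F $$ (r div v, x * v + r mod v))"

lemma unadj_carrier [simp]: "unadj w p v G \<in> carrier_mat w (p * v)"
  by (simp add: unadj_def)

lemma adj_carrier [simp]: "adj w p v F \<in> carrier_mat (w * v) p"
  by (simp add: adj_def)

lemma unadj_entry:
  assumes "r < w" "x < p" "y < v"
  shows "unadj w p v G $$ (r, x * v + y) = G $$ (r * v + y, x)"
  using assms pair_index_less[OF assms(2,3)] by (simp add: unadj_def)

lemma unadj_adj:
  assumes F: "F \<in> carrier_mat w (p * v)"
  shows "unadj w p v (adj w p v F) = F"
proof (rule eq_matI)
  fix r c assume "r < dim_row F" "c < dim_col F"
  hence rc: "r < w" "c < p * v" using F by auto
  note c = div_mod_less[OF rc(2)]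
  have "unadj w p v (adj w p v F) $$ (r, c) = adj w p v F $$ (r * v + c mod v, c div v)"
    using rc by (simp add: unadj_def)
  also have "\<dots> = F $$ (r, c)" using pair_index_less[OF rc(1) c(2)] c by (simp add: adj_def)
  finally show "unadj w p v (adj w p v F) $$ (r, c) = F $$ (r, c)" .
qed (use F in \<open>auto simp: unadj_def\<close>)

lemma adj_unadj:
  assumes G: "G \<in> carrier_mat (w * v) p"
  shows "adj w p v (unadj w p v G) = G"
proof (rule eq_matI)
  fix r x assume "r < dim_row G" "x < dim_col G"
  hence rx: "r < w * v" "x < p" using G by auto
  note r = div_mod_less[OF rx(1)]
  have "adj w p v (unadj w p v G) $$ (r, x) = unadj w p v G $$ (r div v, x * v + r mod v)"
    using rx by (simp add: adj_def)
  also have "\<dots> = G $$ (r, x)" unfolding unadj_entry[OF r(1) rx(2) r(2)] by simp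
  finally show "adj w p v (unadj w p v G) $$ (r, x) = G $$ (r, x)" .
qed (use G in \<open>auto simp: adj_def\<close>)

lemma mat_eq_pair_col:
  assumes A: "A \<in> carrier_mat w (p * v)" and B: "B \<in> carrier_mat w (p * v)"
  shows "A = B \<longleftrightarrow> (\<forall>r<w. \<forall>x<p. \<forall>y<v. A $$ (r, x * v + y) = B $$ (r, x * v + y))"
proof
  assume e: "\<forall>r<w. \<forall>x<p. \<forall>y<v. A $$ (r, x * v + y) = B $$ (r, x * v + y)"
  show "A = B"
  proof (rule eq_matI)
    fix r c assume "r < dim_row B" "c < dim_col B"
    hence rc: "r < w" "c < p * v" using B by auto
    have "A $$ (r, (c div v) * v + c mod v) = B $$ (r, (c div v) * v + c mod v)"
      using e rc(1) div_mod_less[OF rc(2)] by blast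
    thus "A $$ (r, c) = B $$ (r, c)" by simp
  qed (use A B in auto)
qed simp

lemma mat_eq_pair_row:
  assumes A: "A \<in> carrier_mat (w * v) p" and B: "B \<in> carrier_mat (w * v) p"
  shows "A = B \<longleftrightarrow> (\<forall>r<w. \<forall>x<p. \<forall>y<v. A $$ (r * v + y, x) = B $$ (r * v + y, x))"
proof
  assume e: "\<forall>r<w. \<forall>x<p. \<forall>y<v. A $$ (r * v + y, x) = B $$ (r * v + y, x)"
  show "A = B"
  proof (rule eq_matI)
    fix c x assume "c < dim_row B" "x < dim_col B"
    hence rc: "x < p" "c < w * v" using B by auto
    have "A $$ ((c div v) * v + c mod v, x) = B $$ ((c div v) * v + c mod v, x)"
      using e rc(1) div_mod_less[OF rc(2)] by blast
    thus "A $$ (c, x) = B $$ (c, x)" by simp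
  qed (use A B in auto)
qed simp

lemma sum_pair_index:
  "(\<Sum>u<a * b. g u) = (\<Sum>x<a. \<Sum>y<(b::nat). g (x * b + y))"
  using sum_div_mod[of "\<lambda>x y. g (x * b + y)" b a] by simp

lemma tensor_pair_entry:
  assumes "x' < rdim V" "y' < rdim W" "x < rdim V" "y < rdim W"
  shows "ract (tensor H V W) i $$ (x' * rdim W + y', x * rdim W + y) =
    sw H i (\<lambda>j l. ract V j $$ (x', x) * ract W l $$ (y', y))"
  using tensor_entry[OF pair_index_less[OF assms(1,2)] pair_index_less[OF assms(3,4)], of H i] assms by simp

text \<open>Brings equivariance into the shape required by \<open>sw_twist_inverse\<close>: the
  \<open>V\<close> leg of the coproduct acts as a convolution operator on the entries of
  \<open>F\<close> times the action of \<open>P\<close>, and the result is to be the action of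
  \<open>W\<close> times \<open>F\<close>.\<close>

lemma hom_tensor_iff:
  assumes P: "is_module H P" and V: "is_module H V" and W: "is_module H W"
    and F: "F \<in> carrier_mat (rdim W) (rdim P * rdim V)"
  shows "hom H (tensor H P V) W F \<longleftrightarrow> (\<forall>i<hdim H. \<forall>r<rdim W. \<forall>x<rdim P. \<forall>y<rdim V.
     sw H i (\<lambda>j l. \<Sum>y'<rdim V. ent V l y' y * (\<Sum>x'<rdim P. F $$ (r, x' * rdim V + y') * ract P j $$ (x', x))) =
     (\<Sum>r'<rdim W. ract W i $$ (r, r') * F $$ (r', x * rdim V + y)))"
    (is "_ \<longleftrightarrow> (\<forall>i<hdim H. \<forall>r<_. \<forall>x<_. \<forall>y<_. ?A i r x y = ?B i r x y)")
proof -
  let ?p = "rdim P" and ?v = "rdim V" and ?w = "rdim W"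
  have l: "(F * ract (tensor H P V) i) $$ (r, x * ?v + y) = ?A i r x y"
    if r: "r < ?w" and x: "x < ?p" and y: "y < ?v" for i r x y
  proof -
    have "(F * ract (tensor H P V) i) $$ (r, x * ?v + y) =
      (\<Sum>u<?p * ?v. F $$ (r, u) * ract (tensor H P V) i $$ (u, x * ?v + y))"
      by (rule mult_mat_entry[OF F tensor_carrier r pair_index_less[OF x y]])
    also have "\<dots> = (\<Sum>x'<?p. \<Sum>y'<?v. F $$ (r, x' * ?v + y') * ract (tensor H P V) i $$ (x' * ?v + y', x * ?v + y))"
      by (rule sum_pair_index)
    also have "\<dots> = (\<Sum>x'<?p. \<Sum>y'<?v. sw H i (\<lambda>j l. F $$ (r, x' * ?v + y') * (ract P j $$ (x', x) * ent V l y' y)))"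
      by (intro sum.cong refl) (simp add: tensor_pair_entry x y sw_scale ent_def)
    also have "\<dots> = sw H i (\<lambda>j l. \<Sum>x'<?p. \<Sum>y'<?v. F $$ (r, x' * ?v + y') * (ract P j $$ (x', x) * ent V l y' y))"
      by (simp only: sw_sum)
    also have "\<dots> = ?A i r x y"
    proof (rule sw_cong, goal_cases)
      case (1 j l)
      have "(\<Sum>x'<?p. \<Sum>y'<?v. F $$ (r, x' * ?v + y') * (ract P j $$ (x', x) * ent V l y' y)) =
        (\<Sum>y'<?v. \<Sum>x'<?p. F $$ (r, x' * ?v + y') * (ract P j $$ (x', x) * ent V l y' y))" by (rule sum.swap)
      also have "\<dots> = (\<Sum>y'<?v. ent V l y' y * (\<Sum>x'<?p. F $$ (r, x' * ?v + y') * ract P j $$ (x', x)))"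
        by (simp add: sum_distrib_left mult_ac)
      finally show ?case .
    qed
    finally show ?thesis .
  qed
  have r: "(ract W i * F) $$ (r, x * ?v + y) = ?B i r x y"
    if "i < hdim H" "r < ?w" "x < ?p" "y < ?v" for i r x y
    by (rule mult_mat_entry[OF is_moduleD(1)[OF W that(1)] F that(2) pair_index_less[OF that(3,4)]])
  have "F * ract (tensor H P V) i = ract W i * F \<longleftrightarrow> (\<forall>r<?w. \<forall>x<?p. \<forall>y<?v. ?A i r x y = ?B i r x y)"
    if i: "i < hdim H" for i
    using mat_eq_pair_col[OF mult_carrier_mat[OF F tensor_carrier[of H P V i]] mult_carrier_mat[OF is_moduleD(1)[OF W i] F]] l r[OF i]
    by (simp del: index_mult_mat)
  thus ?thesis unfolding hom_def using F by simp
qed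

text \<open>Companion of \<open>hom_tensor_iff\<close> with the operator on the other side. The
  transpose in the dual action puts the indices of \<open>aent\<close> in the order that
  \<open>ent\<close> has there.\<close>

lemma hom_tensor_dual_iff:
  assumes P: "is_module H P" and V: "is_module H V" and W: "is_module H W"
    and G: "G \<in> carrier_mat (rdim W * rdim V) (rdim P)"
  shows "hom H P (tensor H W (dual H V)) G \<longleftrightarrow> (\<forall>i<hdim H. \<forall>r<rdim W. \<forall>x<rdim P. \<forall>y<rdim V.
     (\<Sum>x'<rdim P. G $$ (r * rdim V + y, x') * ract P i $$ (x', x)) =
     sw H i (\<lambda>j l. \<Sum>y'<rdim V. aent H V l y' y * (\<Sum>r'<rdim W. ract W j $$ (r, r') * G $$ (r' * rdim V + y', x))))"
    (is "_ \<longleftrightarrow> (\<forall>i<hdim H. \<forall>r<_. \<forall>x<_. \<forall>y<_. ?A i r x y = ?B i r x y)")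
proof -
  let ?p = "rdim P" and ?v = "rdim V" and ?w = "rdim W" and ?T = "tensor H W (dual H V)"
  have Tc: "ract ?T i \<in> carrier_mat (?w * ?v) (?w * ?v)" for i using tensor_carrier[of H W "dual H V" i] by simp
  have l: "(ract ?T i * G) $$ (r * ?v + y, x) = ?B i r x y"
    if r: "r < ?w" and x: "x < ?p" and y: "y < ?v" for i r x y
  proof -
    have "(ract ?T i * G) $$ (r * ?v + y, x) = (\<Sum>u<?w * ?v. ract ?T i $$ (r * ?v + y, u) * G $$ (u, x))"
      by (rule mult_mat_entry[OF Tc G pair_index_less[OF r y] x])
    also have "\<dots> = (\<Sum>r'<?w. \<Sum>y'<?v. ract ?T i $$ (r * ?v + y, r' * ?v + y') * G $$ (r' * ?v + y', x))"
      by (rule sum_pair_index)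
    also have "\<dots> = (\<Sum>r'<?w. \<Sum>y'<?v. sw H i (\<lambda>j l. ract W j $$ (r, r') * aent H V l y' y * G $$ (r' * ?v + y', x)))"
    proof (intro sum.cong refl, goal_cases)
      case (1 r' y')
      hence b: "r' < ?w" "y' < ?v" by auto
      have "ract ?T i $$ (r * ?v + y, r' * ?v + y') = sw H i (\<lambda>j l. ract W j $$ (r, r') * aent H V l y' y)"
        using tensor_pair_entry[of r W y "dual H V" r' y' H i] r y b by (simp add: dual_entry)
      thus ?case by (simp only: sw_scale_right)
    qed
    also have "\<dots> = sw H i (\<lambda>j l. \<Sum>r'<?w. \<Sum>y'<?v. ract W j $$ (r, r') * aent H V l y' y * G $$ (r' * ?v + y', x))"
      by (simp only: sw_sum)
    also have "\<dots> = ?B i r x y"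
    proof (rule sw_cong, goal_cases)
      case (1 j l)
      have "(\<Sum>r'<?w. \<Sum>y'<?v. ract W j $$ (r, r') * aent H V l y' y * G $$ (r' * ?v + y', x)) =
        (\<Sum>y'<?v. \<Sum>r'<?w. ract W j $$ (r, r') * aent H V l y' y * G $$ (r' * ?v + y', x))" by (rule sum.swap)
      also have "\<dots> = (\<Sum>y'<?v. aent H V l y' y * (\<Sum>r'<?w. ract W j $$ (r, r') * G $$ (r' * ?v + y', x)))"
        by (simp add: sum_distrib_left mult_ac)
      finally show ?case .
    qed
    finally show ?thesis .
  qed
  have r: "(G * ract P i) $$ (r * ?v + y, x) = ?A i r x y"
    if "i < hdim H" "r < ?w" "x < ?p" "y < ?v" for i r x y
    by (rule mult_mat_entry[OF G is_moduleD(1)[OF P that(1)] pair_index_less[OF that(2,4)] that(3)])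
  have "G * ract P i = ract ?T i * G \<longleftrightarrow> (\<forall>r<?w. \<forall>x<?p. \<forall>y<?v. ?A i r x y = ?B i r x y)"
    if i: "i < hdim H" for i
    using mat_eq_pair_row[OF mult_carrier_mat[OF G is_moduleD(1)[OF P i]] mult_carrier_mat[OF Tc G]] l r[OF i]
    by (simp del: index_mult_mat)
  thus ?thesis unfolding hom_def using G by simp
qed

text \<open>With \<open>A\<close> for \<open>G\<close> after the action of \<open>P\<close> and
  \<open>B\<close> for the action of \<open>W\<close> after \<open>G\<close>, one side says that
  \<open>B\<close> is the \<open>ent\<close> operator applied to \<open>A\<close>, the other that
  \<open>A\<close> is the \<open>aent\<close> operator applied to \<open>B\<close>. The antipode
  identities make these operators inverse to each other.\<close>

lemma tensor_dual_adjunction: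
  assumes H: "hopf_algebra H" and P: "is_module H P" and V: "is_module H V" and W: "is_module H W"
    and G: "G \<in> carrier_mat (rdim W * rdim V) (rdim P)"
  shows "hom H (tensor H P V) W (unadj (rdim W) (rdim P) (rdim V) G) \<longleftrightarrow> hom H P (tensor H W (dual H V)) G"
proof -
  let ?p = "rdim P" and ?v = "rdim V" and ?w = "rdim W"
  define A where "A r x i y = (\<Sum>x'<?p. G $$ (r * ?v + y, x') * ract P i $$ (x', x))" for r x i y
  define B where "B r x i y = (\<Sum>r'<?w. ract W i $$ (r, r') * G $$ (r' * ?v + y, x))" for r x i y
  have 1: "hom H (tensor H P V) W (unadj ?w ?p ?v G) \<longleftrightarrow> (\<forall>i<hdim H. \<forall>r<?w. \<forall>x<?p. \<forall>y<?v.
     sw H i (\<lambda>j l. \<Sum>y'<?v. ent V l y' y * A r x j y') = B r x i y)"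
    unfolding hom_tensor_iff[OF P V W unadj_carrier] A_def B_def by (simp add: unadj_entry)
  have 2: "hom H P (tensor H W (dual H V)) G \<longleftrightarrow> (\<forall>i<hdim H. \<forall>r<?w. \<forall>x<?p. \<forall>y<?v.
     A r x i y = sw H i (\<lambda>j l. \<Sum>y'<?v. aent H V l y' y * B r x j y'))"
    unfolding hom_tensor_dual_iff[OF P V W G] A_def B_def ..
  show ?thesis unfolding 1 2
  proof (intro iffI allI impI)
    fix i r x y assume b: "i < hdim H" "r < ?w" "x < ?p" "y < ?v"
    {
      assume a: "\<forall>i<hdim H. \<forall>r<?w. \<forall>x<?p. \<forall>y<?v. sw H i (\<lambda>j l. \<Sum>y'<?v. ent V l y' y * A r x j y') = B r x i y"
      show "A r x i y = sw H i (\<lambda>j l. \<Sum>y'<?v. aent H V l y' y * B r x j y')"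
        by (rule sw_twist_inverse[OF H antipode_right_ent[OF H V] _ b(1,4)]) (use a b in auto)
    }
    {
      assume a: "\<forall>i<hdim H. \<forall>r<?w. \<forall>x<?p. \<forall>y<?v. A r x i y = sw H i (\<lambda>j l. \<Sum>y'<?v. aent H V l y' y * B r x j y')"
      show "sw H i (\<lambda>j l. \<Sum>y'<?v. ent V l y' y * A r x j y') = B r x i y"
        by (rule sym, rule sw_twist_inverse[OF H antipode_left_ent[OF H V] _ b(1,4)]) (use a b in auto)
    }
  qed
qed

lemma adjunction_dim:
  assumes H: "hopf_algebra H" and P: "is_module H P" and V: "is_module H V" and W: "is_module H W"
    and d: "mat_dim (rdim W * rdim V) (rdim P) {f. hom H P (tensor H W (dual H V)) f} n"
  shows "mat_dim (rdim W) (rdim P * rdim V) {f. hom H (tensor H P V) W f} n"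
proof -
  let ?p = "rdim P" and ?v = "rdim V" and ?w = "rdim W"
  have "mat_dim ?w (?p * ?v) (unadj ?w ?p ?v ` {f. hom H P (tensor H W (dual H V)) f}) n"
  proof (rule mat_dim_image[OF d])
    show "unadj ?w ?p ?v (0\<^sub>m (?w * ?v) ?p) = (0\<^sub>m ?w (?p * ?v) :: 'a mat)"
      by (rule eq_matI) (auto simp: unadj_def pair_index_less div_mod_less)
    show "unadj ?w ?p ?v (x + k \<cdot>\<^sub>m y) = unadj ?w ?p ?v x + k \<cdot>\<^sub>m unadj ?w ?p ?v y"
      if "x \<in> carrier_mat (?w * ?v) ?p" "y \<in> carrier_mat (?w * ?v) ?p" for x y :: "'a mat" and k
      using that by (intro eq_matI) (auto simp: unadj_def pair_index_less div_mod_less)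
    show "inj_on (unadj ?w ?p ?v) (carrier_mat (?w * ?v) ?p)" by (rule inj_on_inverseI[where g = "adj ?w ?p ?v"]) (rule adj_unadj)
  qed simp
  moreover have "unadj ?w ?p ?v ` {f. hom H P (tensor H W (dual H V)) f} = {f. hom H (tensor H P V) W f}"
  proof (intro equalityI subsetI)
    fix f assume "f \<in> unadj ?w ?p ?v ` {f. hom H P (tensor H W (dual H V)) f}"
    then obtain g where g: "f = unadj ?w ?p ?v g" "hom H P (tensor H W (dual H V)) g" by blast
    have "g \<in> carrier_mat (?w * ?v) ?p" using homD(1)[OF g(2)] by simp
    thus "f \<in> {f. hom H (tensor H P V) W f}" using tensor_dual_adjunction[OF H P V W] g by blast
  next
    fix f assume "f \<in> {f. hom H (tensor H P V) W f}"
    hence f: "hom H (tensor H P V) W f" by simp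
    have fc: "f \<in> carrier_mat ?w (?p * ?v)" using homD(1)[OF f] by simp
    have "hom H P (tensor H W (dual H V)) (adj ?w ?p ?v f)"
      using tensor_dual_adjunction[OF H P V W adj_carrier[of _ _ _ f]] unadj_adj[OF fc] f by simp
    thus "f \<in> unadj ?w ?p ?v ` {f. hom H P (tensor H W (dual H V)) f}" using unadj_adj[OF fc] by (metis imageI mem_Collect_eq)
  qed
  ultimately show ?thesis by simp
qed

section \<open>Kronecker products and projectivity of P \<otimes> V\<close>

definition kron :: "'k::field mat \<Rightarrow> 'k mat \<Rightarrow> 'k mat" where
  "kron A B = mat (dim_row A * dim_row B) (dim_col A * dim_col B)
     (\<lambda>(r, c). A $$ (r div dim_row B, c div dim_col B) * B $$ (r mod dim_row B, c mod dim_col B))"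

lemma kron_carrier:
  "A \<in> carrier_mat n m \<Longrightarrow> B \<in> carrier_mat n' m' \<Longrightarrow> kron A B \<in> carrier_mat (n * n') (m * m')"
  by (auto simp: kron_def)

lemma kron_entry:
  assumes "A \<in> carrier_mat n m" "B \<in> carrier_mat n' m'" "r < n" "r' < n'" "c < m" "c' < m'"
  shows "kron A B $$ (r * n' + r', c * m' + c') = A $$ (r, c) * B $$ (r', c')"
  using assms pair_index_less[of r n r' n'] pair_index_less[of c m c' m'] by (simp add: kron_def)

lemma mat_eq_pair:
  assumes A: "A \<in> carrier_mat (n * n') (m * m')" and B: "B \<in> carrier_mat (n * n') (m * m')"
    and e: "\<And>r r' c c'. r < n \<Longrightarrow> r' < n' \<Longrightarrow> c < m \<Longrightarrow> c' < m' \<Longrightarrow>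
      A $$ (r * n' + r', c * m' + c') = B $$ (r * n' + r', c * m' + c')"
  shows "A = B"
proof (rule eq_matI)
  fix r c assume "r < dim_row B" "c < dim_col B"
  hence rc: "r < n * n'" "c < m * m'" using B by auto
  have "A $$ ((r div n') * n' + r mod n', (c div m') * m' + c mod m') = B $$ ((r div n') * n' + r mod n', (c div m') * m' + c mod m')"
    by (rule e[OF div_mod_less[OF rc(1)] div_mod_less[OF rc(2)]])
  thus "A $$ (r, c) = B $$ (r, c)" by simp
qed (use A B in auto)

lemma kron_mult:
  fixes A :: "'k::field mat"
  assumes A: "A \<in> carrier_mat n m" and B: "B \<in> carrier_mat n' m'"
    and C: "C \<in> carrier_mat m k" and D: "D \<in> carrier_mat m' k'"
  shows "kron A B * kron C D = kron (A * C) (B * D)"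
proof (rule mat_eq_pair)
  note AB = kron_carrier[OF A B] and CD = kron_carrier[OF C D] and AC = mult_carrier_mat[OF A C] and BD = mult_carrier_mat[OF B D]
  show "kron A B * kron C D \<in> carrier_mat (n * n') (k * k')" by (rule mult_carrier_mat[OF AB CD])
  show "kron (A * C) (B * D) \<in> carrier_mat (n * n') (k * k')" by (rule kron_carrier[OF AC BD])
  fix r r' c c' assume b: "r < n" "r' < n'" "c < k" "c' < k'"
  have "(kron A B * kron C D) $$ (r * n' + r', c * k' + c') =
     (\<Sum>u<m * m'. kron A B $$ (r * n' + r', u) * kron C D $$ (u, c * k' + c'))"
    by (rule mult_mat_entry[OF AB CD pair_index_less[OF b(1,2)] pair_index_less[OF b(3,4)]])
  also have "\<dots> = (\<Sum>x<m. \<Sum>y<m'. kron A B $$ (r * n' + r', x * m' + y) * kron C D $$ (x * m' + y, c * k' + c'))"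
    by (rule sum_pair_index)
  also have "\<dots> = (\<Sum>x<m. \<Sum>y<m'. (A $$ (r, x) * C $$ (x, c)) * (B $$ (r', y) * D $$ (y, c')))"
  proof (intro sum.cong refl, goal_cases)
    case (1 x y)
    hence xy: "x < m" "y < m'" by auto
    show ?case
      unfolding kron_entry[OF A B b(1,2) xy] kron_entry[OF C D xy b(3,4)] by (simp add: mult_ac)
  qed
  also have "\<dots> = (A * C) $$ (r, c) * (B * D) $$ (r', c')"
    unfolding sum_product[symmetric] mult_mat_entry[OF A C b(1,3)] mult_mat_entry[OF B D b(2,4)] ..
  also have "\<dots> = kron (A * C) (B * D) $$ (r * n' + r', c * k' + c')" by (rule kron_entry[OF AC BD b, symmetric])
  finally show "(kron A B * kron C D) $$ (r * n' + r', c * k' + c') = kron (A * C) (B * D) $$ (r * n' + r', c * k' + c')" .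
qed

lemma kron_one: "kron (1\<^sub>m n) (1\<^sub>m m) = (1\<^sub>m (n * m) :: 'k::field mat)"
proof (rule mat_eq_pair)
  fix r r' c c' assume b: "r < n" "r' < m" "c < n" "c' < m"
  have "r * m + r' = c * m + c' \<longleftrightarrow> r = c \<and> r' = c'"
  proof
    assume e: "r * m + r' = c * m + c'"
    have "(r * m + r') div m = r" "(c * m + c') div m = c" using b by auto
    thus "r = c \<and> r' = c'" using e by simp
  qed simp
  thus "kron (1\<^sub>m n) (1\<^sub>m m) $$ (r * m + r', c * m + c') = (1\<^sub>m (n * m) :: 'k mat) $$ (r * m + r', c * m + c')"
    unfolding kron_entry[OF one_carrier_mat one_carrier_mat b] using b
    by (auto simp: pair_index_less)
qed (auto intro: kron_carrier)

lemma hom_kron: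
  assumes m: "is_module H M" "is_module H N" "is_module H V" "is_module H W"
    and f: "hom H M N f" and g: "hom H V W g"
  shows "hom H (tensor H M V) (tensor H N W) (kron f g)"
  unfolding hom_def tensor_dim
proof (intro conjI allI impI)
  note fc = homD(1)[OF f] and gc = homD(1)[OF g]
  note kc = kron_carrier[OF fc gc]
  show "kron f g \<in> carrier_mat (rdim N * rdim W) (rdim M * rdim V)" by (rule kc)
  fix i assume i: "i < hdim H"
  show "kron f g * ract (tensor H M V) i = ract (tensor H N W) i * kron f g"
  proof (rule mat_eq_pair[OF mult_carrier_mat[OF kc tensor_carrier] mult_carrier_mat[OF tensor_carrier kc]])
    fix r r' c c' assume b: "r < rdim N" "r' < rdim W" "c < rdim M" "c' < rdim V"
    have "(kron f g * ract (tensor H M V) i) $$ (r * rdim W + r', c * rdim V + c') =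
      (\<Sum>x<rdim M. \<Sum>y<rdim V. kron f g $$ (r * rdim W + r', x * rdim V + y) * ract (tensor H M V) i $$ (x * rdim V + y, c * rdim V + c'))"
      unfolding mult_mat_entry[OF kc tensor_carrier pair_index_less[OF b(1,2)] pair_index_less[OF b(3,4)]] by (rule sum_pair_index)
    also have "\<dots> = (\<Sum>x<rdim M. \<Sum>y<rdim V. sw H i (\<lambda>j l. (f $$ (r, x) * ract M j $$ (x, c)) * (g $$ (r', y) * ract V l $$ (y, c'))))"
    proof (intro sum.cong refl, goal_cases)
      case (1 x y)
      hence xy: "x < rdim M" "y < rdim V" by auto
      show ?case
        unfolding kron_entry[OF fc gc b(1,2) xy] tensor_pair_entry[OF xy b(3,4)] sw_scale[symmetric]
        by (rule sw_cong) (simp add: mult_ac)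
    qed
    also have "\<dots> = sw H i (\<lambda>j l. (\<Sum>x<rdim M. f $$ (r, x) * ract M j $$ (x, c)) * (\<Sum>y<rdim V. g $$ (r', y) * ract V l $$ (y, c')))"
      by (simp only: sw_sum[symmetric] sum_product[symmetric])
    also have "\<dots> = sw H i (\<lambda>j l. (\<Sum>x<rdim N. ract N j $$ (r, x) * f $$ (x, c)) * (\<Sum>y<rdim W. ract W l $$ (r', y) * g $$ (y, c')))"
    proof (rule sw_cong, goal_cases)
      case (1 j l)
      note j = 1(1) and l = 1(2)
      show ?case unfolding mult_mat_entry[OF fc is_moduleD(1)[OF m(1) j] b(1,3), symmetric]
          mult_mat_entry[OF gc is_moduleD(1)[OF m(3) l] b(2,4), symmetric]
          mult_mat_entry[OF is_moduleD(1)[OF m(2) j] fc b(1,3), symmetric]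
          mult_mat_entry[OF is_moduleD(1)[OF m(4) l] gc b(2,4), symmetric]
          homD(2)[OF f j] homD(2)[OF g l] ..
    qed
    also have "\<dots> = (\<Sum>x<rdim N. \<Sum>y<rdim W. sw H i (\<lambda>j l. (ract N j $$ (r, x) * f $$ (x, c)) * (ract W l $$ (r', y) * g $$ (y, c'))))"
      by (simp only: sw_sum[symmetric] sum_product[symmetric])
    also have "\<dots> = (\<Sum>x<rdim N. \<Sum>y<rdim W. ract (tensor H N W) i $$ (r * rdim W + r', x * rdim W + y) * kron f g $$ (x * rdim W + y, c * rdim V + c'))"
    proof (intro sum.cong refl, goal_cases)
      case (1 x y)
      hence xy: "x < rdim N" "y < rdim W" by auto
      show ?case
        unfolding kron_entry[OF fc gc xy b(3,4)] tensor_pair_entry[OF b(1,2) xy] sw_scale_right[symmetric]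
        by (rule sw_cong) (simp add: mult_ac)
    qed
    also have "\<dots> = (ract (tensor H N W) i * kron f g) $$ (r * rdim W + r', c * rdim V + c')"
      unfolding mult_mat_entry[OF tensor_carrier kc pair_index_less[OF b(1,2)] pair_index_less[OF b(3,4)]] by (rule sum_pair_index[symmetric])
    finally show "(kron f g * ract (tensor H M V) i) $$ (r * rdim W + r', c * rdim V + c') =
      (ract (tensor H N W) i * kron f g) $$ (r * rdim W + r', c * rdim V + c')" .
  qed
qed

text \<open>Naturality of the adjunction in its target: composing with \<open>f\<close> on one side
  corresponds to composing with \<open>f\<close> \<otimes> 1 on the other.\<close>

lemma unadj_kron:
  fixes f :: "'k::field mat"
  assumes f: "f \<in> carrier_mat n m" and K: "K \<in> carrier_mat (m * v) p"
  shows "unadj n p v (kron f (1\<^sub>m v) * K) = f * unadj m p v K"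
proof -
  note kc = kron_carrier[OF f one_carrier_mat[of v]]
  note fu = mult_carrier_mat[OF f unadj_carrier]
  show ?thesis unfolding mat_eq_pair_col[OF unadj_carrier fu]
  proof (intro allI impI)
    fix r x y assume b: "r < n" "x < p" "y < v"
    have "unadj n p v (kron f (1\<^sub>m v) * K) $$ (r, x * v + y) = (kron f (1\<^sub>m v) * K) $$ (r * v + y, x)"
      by (rule unadj_entry[OF b])
    also have "\<dots> = (\<Sum>z<m. \<Sum>y'<v. kron f (1\<^sub>m v) $$ (r * v + y, z * v + y') * K $$ (z * v + y', x))"
      unfolding mult_mat_entry[OF kc K pair_index_less[OF b(1,3)] b(2)] by (rule sum_pair_index)
    also have "\<dots> = (\<Sum>z<m. \<Sum>y'<v. if y' = y then f $$ (r, z) * K $$ (z * v + y', x) else 0)"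
      by (intro sum.cong refl) (use b in \<open>auto simp: kron_entry[OF f one_carrier_mat]\<close>)
    also have "\<dots> = (\<Sum>z<m. f $$ (r, z) * K $$ (z * v + y, x))" using b by simp
    also have "\<dots> = (\<Sum>z<m. f $$ (r, z) * unadj m p v K $$ (z, x * v + y))"
      by (intro sum.cong refl) (simp add: unadj_entry b)
    also have "\<dots> = (f * unadj m p v K) $$ (r, x * v + y)"
      by (rule mult_mat_entry[OF f unadj_carrier b(1) pair_index_less[OF b(2,3)], symmetric])
    finally show "unadj n p v (kron f (1\<^sub>m v) * K) $$ (r, x * v + y) = (f * unadj m p v K) $$ (r, x * v + y)" .
  qed
qed

text \<open>A lifting problem for P \<otimes> V along \<open>f\<close> is transposed to one for
  \<open>P\<close> along \<open>f\<close> \<otimes> 1 on the dual of \<open>V\<close>. It is solved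
  there, and naturality shows that the transposed solution lifts \<open>g\<close>.\<close>

lemma projective_tensor:
  assumes H: "hopf_algebra H" and P: "projective H P" and V: "is_module H V"
  shows "projective H (tensor H P V)"
proof -
  have mP: "is_module H P" using P by (simp add: projective_def)
  note mD = is_module_dual[OF H V]
  let ?p = "rdim P" and ?v = "rdim V"
  have "\<exists>h. hom H (tensor H P V) M h \<and> f * h = g"
    if m: "is_module H M" "is_module H N" and f: "hom H M N f" and s: "surjective_map M N f"
      and g: "hom H (tensor H P V) N g" for M N f g
  proof -
    let ?D = "dual H V" and ?k = "kron f (1\<^sub>m ?v)"
    note fc = homD(1)[OF f]
    have gc: "g \<in> carrier_mat (rdim N) (?p * ?v)" using homD(1)[OF g] by simp
    let ?g = "adj (rdim N) ?p ?v g"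
    have g': "hom H P (tensor H N ?D) ?g"
      using tensor_dual_adjunction[OF H mP V m(2) adj_carrier[of _ _ _ g]] unadj_adj[OF gc] g by simp
    have idD: "hom H ?D ?D (1\<^sub>m ?v)" using hom_id[OF mD] by simp
    have kh: "hom H (tensor H M ?D) (tensor H N ?D) ?k" by (rule hom_kron[OF m mD mD f idD])
    obtain G where G: "G \<in> mats N M" "f * G = 1\<^sub>m (rdim N)"
      by (rule surjective_right_inverse[OF fc]) (use s in \<open>auto simp: surjective_map_def\<close>)
    have kc: "?k \<in> carrier_mat (rdim N * ?v) (rdim M * ?v)" by (rule kron_carrier[OF fc one_carrier_mat])
    have Gc: "kron G (1\<^sub>m ?v) \<in> carrier_mat (rdim M * ?v) (rdim N * ?v)" by (rule kron_carrier[OF G(1) one_carrier_mat])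
    \<comment> \<open>Surjectivity survives tensoring because a merely linear section
      \<open>G\<close> of \<open>f\<close> gives the section \<open>G\<close> \<otimes> 1.\<close>
    have kG: "?k * kron G (1\<^sub>m ?v) = 1\<^sub>m (rdim N * ?v)"
      unfolding kron_mult[OF fc one_carrier_mat G(1) one_carrier_mat] G(2) left_mult_one_mat[OF one_carrier_mat] by (rule kron_one)
    have ks: "surjective_map (tensor H M ?D) (tensor H N ?D) ?k"
      unfolding surjective_map_def tensor_dim dual_dim
    proof
      fix w :: "'a vec" assume w: "w \<in> carrier_vec (rdim N * ?v)"
      have "?k *\<^sub>v (kron G (1\<^sub>m ?v) *\<^sub>v w) = w" by (rule mult_inverse_vec[OF kc Gc kG w])
      thus "\<exists>v\<in>carrier_vec (rdim M * ?v). ?k *\<^sub>v v = w" using mult_mat_vec_carrier[OF Gc w] by blast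
    qed
    obtain h where h: "hom H P (tensor H M ?D) h" "?k * h = ?g"
      by (rule projective_lift[OF P is_module_tensor[OF H m(1) mD] is_module_tensor[OF H m(2) mD] kh ks g'])
    have hc: "h \<in> carrier_mat (rdim M * ?v) ?p" using homD(1)[OF h(1)] by simp
    have "hom H (tensor H P V) M (unadj (rdim M) ?p ?v h)"
      using tensor_dual_adjunction[OF H mP V m(1) hc] h(1) by simp
    moreover have "f * unadj (rdim M) ?p ?v h = g"
      unfolding unadj_kron[OF fc hc, symmetric] h(2) by (rule unadj_adj[OF gc])
    ultimately show ?thesis by blast
  qed
  thus ?thesis unfolding projective_def using is_module_tensor[OF H mP V] by blast
qed

text \<open>The composition series chosen for the two tensor products need not correspond, so the
  counts are compared as dimensions of Hom(P, -). Composition with 1 \<otimes> \<open>A\<close> is a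
  linear bijection between these spaces.\<close>

lemma comp_mult_tensor_iso:
  fixes S :: "'k::field rep"
  assumes ac: "algebraically_closed_field TYPE('k)" and H: "hopf_algebra H"
    and P: "projective H P" and p: "cover_map H P S p" and S: "simple_module H S"
    and T: "is_module H T" and V: "is_module H V" and V': "is_module H V'" and iso: "iso H V' V"
  shows "comp_mult H (tensor H T V') S = comp_mult H (tensor H T V) S"
proof -
  have mP: "is_module H P" using P by (simp add: projective_def)
  obtain A B where A: "hom H V' V A" "hom H V V' B" "A * B = 1\<^sub>m (rdim V)" "B * A = 1\<^sub>m (rdim V')"
    using iso unfolding iso_def by blast
  note Ac = homD(1)[OF A(1)] and Bc = homD(1)[OF A(2)]
  note m = is_module_tensor[OF H T V] and m' = is_module_tensor[OF H T V']
  let ?t = "rdim T" and ?p = "rdim P"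
  let ?K = "kron (1\<^sub>m ?t) A" and ?L = "kron (1\<^sub>m ?t) B"
  have Kh: "hom H (tensor H T V') (tensor H T V) ?K" by (rule hom_kron[OF T T V' V hom_id[OF T] A(1)])
  have Lh: "hom H (tensor H T V) (tensor H T V') ?L" by (rule hom_kron[OF T T V V' hom_id[OF T] A(2)])
  have Kc: "?K \<in> carrier_mat (?t * rdim V) (?t * rdim V')" and Lc: "?L \<in> carrier_mat (?t * rdim V') (?t * rdim V)"
    using homD(1)[OF Kh] homD(1)[OF Lh] by simp_all
  have KL: "?K * ?L = 1\<^sub>m (?t * rdim V)" and LK: "?L * ?K = 1\<^sub>m (?t * rdim V')"
    unfolding kron_mult[OF one_carrier_mat Ac one_carrier_mat Bc] kron_mult[OF one_carrier_mat Bc one_carrier_mat Ac]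
      A(3,4) left_mult_one_mat[OF one_carrier_mat] by (rule kron_one)+
  have d': "mat_dim (?t * rdim V') ?p {f. hom H P (tensor H T V') f} (comp_mult H (tensor H T V') S)"
    using hom_dim_comp_mult[OF ac P p S m'] by simp
  have d: "mat_dim (?t * rdim V) ?p {f. hom H P (tensor H T V) f} (comp_mult H (tensor H T V) S)"
    using hom_dim_comp_mult[OF ac P p S m] by simp
  have LKx: "?L * (?K * x) = x" if "x \<in> carrier_mat (?t * rdim V') ?p" for x
    unfolding assoc_mult_mat[OF Lc Kc that, symmetric] LK by (rule left_mult_one_mat[OF that])
  have KLx: "?K * (?L * x) = x" if "x \<in> carrier_mat (?t * rdim V) ?p" for x
    unfolding assoc_mult_mat[OF Kc Lc that, symmetric] KL by (rule left_mult_one_mat[OF that])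
  have "mat_dim (?t * rdim V) ?p ((\<lambda>x. ?K * x) ` {f. hom H P (tensor H T V') f}) (comp_mult H (tensor H T V') S)"
  proof (rule mat_dim_image[OF d'])
    show "?K * x \<in> carrier_mat (?t * rdim V) ?p" if "x \<in> carrier_mat (?t * rdim V') ?p" for x
      by (rule mult_carrier_mat[OF Kc that])
    show "?K * 0\<^sub>m (?t * rdim V') ?p = 0\<^sub>m (?t * rdim V) ?p" by (rule right_mult_zero_mat[OF Kc])
    show "?K * (x + k \<cdot>\<^sub>m y) = ?K * x + k \<cdot>\<^sub>m (?K * y)"
      if x: "x \<in> carrier_mat (?t * rdim V') ?p" and y: "y \<in> carrier_mat (?t * rdim V') ?p" for x y k
    proof -
      have ky: "k \<cdot>\<^sub>m y \<in> carrier_mat (?t * rdim V') ?p" using y by simp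
      show ?thesis unfolding mult_add_distrib_mat[OF Kc x ky] mult_smult_distrib[OF Kc y] ..
    qed
    show "inj_on (\<lambda>x. ?K * x) (carrier_mat (?t * rdim V') ?p)" by (rule inj_on_inverseI[where g = "\<lambda>x. ?L * x"]) (rule LKx)
  qed
  moreover have "(\<lambda>x. ?K * x) ` {f. hom H P (tensor H T V') f} = {f. hom H P (tensor H T V) f}"
  proof (intro equalityI subsetI)
    fix f assume "f \<in> (\<lambda>x. ?K * x) ` {f. hom H P (tensor H T V') f}"
    then obtain g where g: "f = ?K * g" "g \<in> {f. hom H P (tensor H T V') f}" by (rule imageE)
    thus "f \<in> {f. hom H P (tensor H T V) f}" using hom_comp[OF mP m' m _ Kh] by simp
  next
    fix f assume "f \<in> {f. hom H P (tensor H T V) f}"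
    hence f: "hom H P (tensor H T V) f" by simp
    have fc: "f \<in> carrier_mat (?t * rdim V) ?p" using homD(1)[OF f] by simp
    have Lf: "?L * f \<in> {f. hom H P (tensor H T V') f}" using hom_comp[OF mP m m' f Lh] by simp
    show "f \<in> (\<lambda>x. ?K * x) ` {f. hom H P (tensor H T V') f}"
      by (rule image_eqI[where x = "?L * f"], rule KLx[OF fc, symmetric], rule Lf)
  qed
  ultimately show ?thesis using mat_dim_unique d by simp
qed

section \<open>Traces of tensor products and the trace identity\<close>

lemma mtrace_eq: "A \<in> carrier_mat n n \<Longrightarrow> mtrace A = (\<Sum>i<n. A $$ (i, i))"
  by (simp add: mtrace_def)

lemma tr_eq_sum:
  assumes V: "is_module H V"
  shows "tr H V x = (\<Sum>i<hdim H. x $ i * mtrace (ract V i))"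
proof -
  have "tr H V x = (\<Sum>r<rdim V. \<Sum>i<hdim H. x $ i * ract V i $$ (r, r))"
    by (simp add: tr_def act_def lincomb_def mtrace_def)
  also have "\<dots> = (\<Sum>i<hdim H. \<Sum>r<rdim V. x $ i * ract V i $$ (r, r))" by (rule sum.swap)
  also have "\<dots> = (\<Sum>i<hdim H. x $ i * mtrace (ract V i))"
    by (intro sum.cong refl) (simp add: mtrace_eq[OF is_moduleD(1)[OF V]] sum_distrib_left)
  finally show ?thesis .
qed

lemma tr_unit_vec:
  assumes V: "is_module H V" and l: "l < hdim H"
  shows "tr H V (unit_vec (hdim H) l) = mtrace (ract V l)"
proof -
  have "tr H V (unit_vec (hdim H) l) = (\<Sum>i<hdim H. if i = l then mtrace (ract V i) else 0)"
    unfolding tr_eq_sum[OF V] by (intro sum.cong refl) (use l in auto)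
  thus ?thesis using l by simp
qed

lemma mtrace_tensor:
  assumes V: "is_module H V" and W: "is_module H W"
  shows "mtrace (ract (tensor H V W) i) = sw H i (\<lambda>j l. mtrace (ract V j) * mtrace (ract W l))"
proof -
  have "mtrace (ract (tensor H V W) i) = (\<Sum>x<rdim V. \<Sum>y<rdim W. ract (tensor H V W) i $$ (x * rdim W + y, x * rdim W + y))"
    unfolding mtrace_def carrier_matD(1)[OF tensor_carrier] by (rule sum_pair_index)
  also have "\<dots> = (\<Sum>x<rdim V. \<Sum>y<rdim W. sw H i (\<lambda>j l. ract V j $$ (x, x) * ract W l $$ (y, y)))"
    by (intro sum.cong refl) (simp add: tensor_pair_entry)
  also have "\<dots> = sw H i (\<lambda>j l. (\<Sum>x<rdim V. ract V j $$ (x, x)) * (\<Sum>y<rdim W. ract W l $$ (y, y)))"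
    by (simp only: sw_sum[symmetric] sum_product[symmetric])
  also have "\<dots> = sw H i (\<lambda>j l. mtrace (ract V j) * mtrace (ract W l))"
    by (rule sw_cong) (simp add: mtrace_eq[OF is_moduleD(1)[OF V]] mtrace_eq[OF is_moduleD(1)[OF W]])
  finally show ?thesis .
qed

lemma tr_tensor:
  assumes H: "hopf_algebra H" and P: "is_module H P" and V: "is_module H V"
  shows "tr H (tensor H P V) x = (\<Sum>j<hdim H. \<Sum>l<hdim H. comult H x j l * mtrace (ract V l) * mtrace (ract P j))"
  unfolding tr_eq_sum[OF is_module_tensor[OF H P V]] mtrace_tensor[OF P V] sum_sw comult_def
  by (intro sum.cong refl) (simp add: mult_ac)

text \<open>Compared entry by entry: column \<open>j\<close> of the matrix lists the multiplicities
  of the covers in P_j \<otimes> V, so that \<open>trace_projective\<close> can be applied basis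
  element by basis element and summed with the coordinates of \<open>x\<close>.\<close>

lemma trace_mckay_dual:
  fixes H :: "('k::field) hopf"
  assumes ac: "algebraically_closed_field TYPE('k)" and H: "hopf_algebra H"
    and simples: "\<forall>i<length Ss. simple_module H (Ss ! i)"
    and noniso: "\<forall>i<length Ss. \<forall>j<length Ss. i \<noteq> j \<longrightarrow> \<not> iso H (Ss ! i) (Ss ! j)"
    and complete: "\<forall>S. simple_module H S \<longrightarrow> (\<exists>i<length Ss. iso H S (Ss ! i))"
    and len: "length Ps = length Ss"
    and covers: "\<forall>i<length Ss. projective_cover H (Ps ! i) (Ss ! i)"
    and V: "is_module H V"
  shows "row_times (TrP H Ps x) (mckay H Ss (dual H V)) = sweedler_tr H Ps V x"
proof (rule eq_vecI)
  show "dim_vec (row_times (TrP H Ps x) (mckay H Ss (dual H V))) = dim_vec (sweedler_tr H Ps V x)"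
    by (simp add: row_times_def mckay_def sweedler_tr_def len)
  fix j assume "j < dim_vec (sweedler_tr H Ps V x)"
  hence j: "j < length Ss" by (simp add: sweedler_tr_def len)
  let ?m = "\<lambda>i. comp_mult H (tensor H (Ss ! i) (dual H V)) (Ss ! j)"
  have pr: "projective H (Ps ! i)" and mP: "is_module H (Ps ! i)" if "i < length Ss" for i
    using covers that by (auto simp: projective_cover_map projective_def)
  obtain p where p: "cover_map H (Ps ! j) (Ss ! j) p" using covers j by (auto simp: projective_cover_map)
  have S: "simple_module H (Ss ! i)" if "i < length Ss" for i using simples that by blast
  let ?Q = "tensor H (Ps ! j) V"
  have Q: "projective H ?Q" by (rule projective_tensor[OF H pr[OF j] V])
  have dims: "mat_dim (rdim (Ss ! l)) (rdim ?Q) {f. hom H ?Q (Ss ! l) f} (?m l)" if l: "l < length Ss" for l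
  proof -
    note mS = simple_is_module[OF S[OF l]]
    have "mat_dim (rdim (Ss ! l) * rdim V) (rdim (Ps ! j)) {f. hom H (Ps ! j) (tensor H (Ss ! l) (dual H V)) f} (?m l)"
      using hom_dim_comp_mult[OF ac pr[OF j] p S[OF j] is_module_tensor[OF H mS is_module_dual[OF H V]]] by simp
    from adjunction_dim[OF H mP[OF j] V mS this] show ?thesis by simp
  qed
  have "row_times (TrP H Ps x) (mckay H Ss (dual H V)) $ j = (\<Sum>i<length Ss. tr H (Ps ! i) x * of_nat (?m i))"
    using j by (simp add: row_times_def mckay_def TrP_def len)
  also have "\<dots> = (\<Sum>i<length Ss. \<Sum>a<hdim H. x $ a * (of_nat (?m i) * mtrace (ract (Ps ! i) a)))"
    by (intro sum.cong refl) (simp add: tr_eq_sum[OF mP] sum_distrib_left sum_distrib_right mult_ac)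
  also have "\<dots> = (\<Sum>a<hdim H. \<Sum>i<length Ss. x $ a * (of_nat (?m i) * mtrace (ract (Ps ! i) a)))" by (rule sum.swap)
  also have "\<dots> = (\<Sum>a<hdim H. x $ a * mtrace (ract ?Q a))"
    by (intro sum.cong refl)
      (simp add: trace_projective[OF ac simples noniso complete covers Q dims] sum_distrib_left)
  also have "\<dots> = tr H ?Q x" by (rule tr_eq_sum[OF is_module_tensor[OF H mP[OF j] V], symmetric])
  also have "\<dots> = (\<Sum>k<hdim H. \<Sum>l<hdim H. comult H x k l * tr H V (unit_vec (hdim H) l) * tr H (Ps ! j) (unit_vec (hdim H) k))"
    unfolding tr_tensor[OF H mP[OF j] V] by (intro sum.cong refl) (simp add: tr_unit_vec[OF V] tr_unit_vec[OF mP[OF j]])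
  also have "\<dots> = sweedler_tr H Ps V x $ j" using j by (simp add: sweedler_tr_def len)
  finally show "row_times (TrP H Ps x) (mckay H Ss (dual H V)) $ j = sweedler_tr H Ps V x $ j" .
qed

theorem mainTheorem6:
  fixes H :: "('k::field) hopf"
    and Ss Ps :: "'k rep list"
    and V :: "'k rep"
  assumes alg_closed: "algebraically_closed_field TYPE('k)"
    and hopf: "hopf_algebra H"
    and simples: "\<forall>i<length Ss. simple_module H (Ss ! i)"
    and noniso: "\<forall>i<length Ss. \<forall>j<length Ss. i \<noteq> j \<longrightarrow> \<not> iso H (Ss ! i) (Ss ! j)"
    and complete: "\<forall>S. simple_module H S \<longrightarrow> (\<exists>i<length Ss. iso H S (Ss ! i))"
    and len: "length Ps = length Ss"
    and covers: "\<forall>i<length Ss. projective_cover H (Ps ! i) (Ss ! i)"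
    and V: "is_module H V"
  shows "(\<forall>x\<in>carrier_vec (hdim H).
            row_times (TrP H Ps x) (mckay H Ss (dual H V)) = sweedler_tr H Ps V x) \<and>
         (iso H (dual H (dual H V)) V \<longrightarrow>
           (\<forall>x\<in>carrier_vec (hdim H).
              row_times (TrP H Ps x) (mckay H Ss V) = sweedler_tr H Ps (dual H V) x) \<and>
           (\<forall>g\<in>carrier_vec (hdim H). g \<noteq> 0\<^sub>v (hdim H) \<longrightarrow>
              (\<forall>j<hdim H. \<forall>l<hdim H. comult H g j l = g $ j * g $ l) \<longrightarrow>
              row_times (TrP H Ps g) (mckay H Ss V) = tr H (dual H V) g \<cdot>\<^sub>v TrP H Ps g) \<and>
           (\<forall>x\<in>carrier_vec (hdim H). \<forall>y\<in>carrier_vec (hdim H). \<forall>z\<in>carrier_vec (hdim H).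
              y \<noteq> 0\<^sub>v (hdim H) \<longrightarrow> z \<noteq> 0\<^sub>v (hdim H) \<longrightarrow>
              (\<forall>j<hdim H. \<forall>l<hdim H. comult H x j l = x $ j * y $ l + z $ j * x $ l) \<longrightarrow>
              row_times (TrP H Ps x) (mckay H Ss V) =
                tr H (dual H V) y \<cdot>\<^sub>v TrP H Ps x + tr H (dual H V) x \<cdot>\<^sub>v TrP H Ps z))"
proof -
  note main = trace_mckay_dual[OF alg_closed hopf simples noniso complete len covers]
  have D: "is_module H (dual H V)" by (rule is_module_dual[OF hopf V])
  have mP: "is_module H (Ps ! i)" if "i < length Ss" for i
    using covers that by (auto simp: projective_cover_map projective_def)
  \<comment> \<open>The identity is applied to the dual of \<open>V\<close>, which puts the bidual
    into the matrix. Each entry is then moved to \<open>V\<close> along the given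
    isomorphism.\<close>
  have bidual: "row_times (TrP H Ps x) (mckay H Ss V) = sweedler_tr H Ps (dual H V) x"
    if iso: "iso H (dual H (dual H V)) V" for x
  proof -
    have "comp_mult H (tensor H (Ss ! i) (dual H (dual H V))) (Ss ! j) = comp_mult H (tensor H (Ss ! i) V) (Ss ! j)"
      if i: "i < length Ss" and j: "j < length Ss" for i j
    proof -
      obtain p where p: "cover_map H (Ps ! j) (Ss ! j) p" and P: "projective H (Ps ! j)"
        using covers j by (auto simp: projective_cover_map)
      have S: "simple_module H (Ss ! i)" "simple_module H (Ss ! j)" using simples i j by blast+
      show ?thesis
        by (rule comp_mult_tensor_iso[OF alg_closed hopf P p S(2) simple_is_module[OF S(1)] V is_module_dual[OF hopf D] iso])
    qed
    hence "mckay H Ss (dual H (dual H V)) = mckay H Ss V"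
      unfolding mckay_def by (intro eq_matI) auto
    thus ?thesis using main[OF D, of x] by simp
  qed
  \<comment> \<open>For a pure tensor \<open>a\<close> \<otimes> \<open>b\<close> in place of the
    coproduct the double sum factors, the second leg being traced on the dual of \<open>V\<close>
    and the first on the cover. Both special forms of the coproduct are sums of pure
    tensors.\<close>
  have tensor2: "(\<Sum>j<hdim H. \<Sum>l<hdim H. a $ j * b $ l * tr H (dual H V) (unit_vec (hdim H) l) * tr H (Ps ! k) (unit_vec (hdim H) j)) =
      tr H (dual H V) b * tr H (Ps ! k) a" if k: "k < length Ss" for a b k
  proof -
    have "(\<Sum>j<hdim H. \<Sum>l<hdim H. a $ j * b $ l * tr H (dual H V) (unit_vec (hdim H) l) * tr H (Ps ! k) (unit_vec (hdim H) j)) =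
      (\<Sum>j<hdim H. \<Sum>l<hdim H. (a $ j * mtrace (ract (Ps ! k) j)) * (b $ l * mtrace (ract (dual H V) l)))"
      by (intro sum.cong refl) (simp add: tr_unit_vec[OF D] tr_unit_vec[OF mP[OF k]] mult_ac)
    also have "\<dots> = tr H (dual H V) b * tr H (Ps ! k) a"
      unfolding sum_product[symmetric] tr_eq_sum[OF D] tr_eq_sum[OF mP[OF k]] by (rule mult.commute)
    finally show ?thesis .
  qed
  have grouplike: "sweedler_tr H Ps (dual H V) g = tr H (dual H V) g \<cdot>\<^sub>v TrP H Ps g"
    if g: "\<forall>j<hdim H. \<forall>l<hdim H. comult H g j l = g $ j * g $ l" for g
  proof (rule eq_vecI)
    fix k assume "k < dim_vec (tr H (dual H V) g \<cdot>\<^sub>v TrP H Ps g)"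
    hence k: "k < length Ss" by (simp add: TrP_def len)
    show "sweedler_tr H Ps (dual H V) g $ k = (tr H (dual H V) g \<cdot>\<^sub>v TrP H Ps g) $ k"
      using k g tensor2[OF k, of g g] by (simp add: sweedler_tr_def TrP_def len)
  qed (simp add: sweedler_tr_def TrP_def)
  \<comment> \<open>The sum splits into the pure tensors \<open>x\<close> \<otimes> \<open>y\<close>
    and \<open>z\<close> \<otimes> \<open>x\<close>.\<close>
  have primitive: "sweedler_tr H Ps (dual H V) x = tr H (dual H V) y \<cdot>\<^sub>v TrP H Ps x + tr H (dual H V) x \<cdot>\<^sub>v TrP H Ps z"
    if x: "\<forall>j<hdim H. \<forall>l<hdim H. comult H x j l = x $ j * y $ l + z $ j * x $ l" for x y z
  proof (rule eq_vecI)
    fix k assume "k < dim_vec (tr H (dual H V) y \<cdot>\<^sub>v TrP H Ps x + tr H (dual H V) x \<cdot>\<^sub>v TrP H Ps z)"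
    hence k: "k < length Ss" by (simp add: TrP_def len)
    show "sweedler_tr H Ps (dual H V) x $ k = (tr H (dual H V) y \<cdot>\<^sub>v TrP H Ps x + tr H (dual H V) x \<cdot>\<^sub>v TrP H Ps z) $ k"
      using k x tensor2[OF k, of x y] tensor2[OF k, of z x]
      by (simp add: sweedler_tr_def TrP_def len distrib_right sum.distrib)
  qed (simp add: sweedler_tr_def TrP_def)
  show ?thesis using main[OF V] bidual grouplike primitive by simp
qed

end
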